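(* Let Assumption A (described in the context) hold and assume in addition that $\mathbb{E}[|\log \rho_0|^{\delta}]<\infty$ for every $0<\delta<6$. (i) If $\mathbb{E}[(\log_+ M_0)^{2+\epsilon}]<\infty$ for some $\epsilon>0$, then $S_n=0$ for infinitely many $n$, $P_0$-a.s. (ii) If $\liminf_{t\to\infty}\big(t^{\lambda}\cdot \mathbb{P}[\log M_0>t]\big)> 0$ for some $0<\lambda<2$, then $\lim_{n\to\infty}S_n=+\infty$ $P_0$-a.s.
   Context: Excited random walk in random environment (ERWRE). Let $\Omega:=([0,1]^{\mathbb{N}})^{\mathbb{Z}}$, with elements $\omega=((\omega(x,i))_{i\ge1})_{x\in\mathbb{Z}}$ chosen according to a probability measure $\mathbb{P}$ with expectation $\mathbb{E}$. For fixed $\omega$ and $z\in\mathbb{Z}$, $(S_n)_{n\ge0}$ is a nearest-neighbour walk under a law $P_{z,\omega}$ with $P_{z,\omega}[S_0=z]=1$ and $P_{z,\omega}[S_{n+1}=S_n+1\mid (S_m)_{m\le n}]=\omega(S_n,\#\{m\le n: S_m=S_n\})$, $P_{z,\omega}[S_{n+1}=S_n-1\mid (S_m)_{m\le n}]=1-\omega(S_n,\#\{m\le n: S_m=S_n\})$; i.e. $\omega(x,i)$ is the probability to step from $x$ to $x+1$ on the $i$-th visit to $x$. The annealed law is $P_z[\cdot]:=\mathbb{E}[P_{z,\omega}[\cdot]]$. With the convention $\sup\emptyset=0$, the number of cookies at $x$ is $M_x:=\sup\{i\ge1: \omega(x,j)=1 \text{ for all } 1\le j\le i\}$. Assumption A: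 $\mathbb{P}$-a.s. there is $(p_x)_{x\in\mathbb{Z}}\in(0,1)^{\mathbb{Z}}$ such that (A.1) $\mathbb{P}$-a.s. $\omega(x,i)=p_x$ for all $i>M_x$, and $\mathbb{P}[p_x=1/2]<1$; (A.2) $(p_x,M_x)_{x\in\mathbb{Z}}$ is i.i.d. under $\mathbb{P}$; (A.3) with $\rho_x:=(1-p_x)/p_x$, $\mathbb{E}[|\log\rho_0|]<\infty$ and $\mathbb{E}[\log\rho_0]=0$; (A.4) $\mathbb{P}[M_0=\infty]=0$ and $\mathbb{P}[M_0=0]>0$. Here $\log_+ x=\max(\log x,0)$. *)

theory Defs
  imports "HOL-Probability.Probability"
begin

type_synonym env = "int \<Rightarrow> nat \<Rightarrow> real"
  \<comment> \<open>omega x i : probability to step right from x at the i-th visit (only i >= 1 is used)\<close>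

definition env_measure :: "env measure" where
  "env_measure = PiM UNIV (\<lambda>_::int. PiM UNIV (\<lambda>_::nat. (borel :: real measure)))"

text \<open>Number of cookies at x: sup of i >= 1 with omega(x,j) = 1 for all 1 <= j <= i; sup of empty set is 0.\<close>
definition cookies :: "env \<Rightarrow> int \<Rightarrow> enat" where
  "cookies \<omega> x = Sup {enat i | i. 1 \<le> i \<and> (\<forall>j. 1 \<le> j \<and> j \<le> i \<longrightarrow> \<omega> x j = 1)}"

definition rho :: "(int \<Rightarrow> env \<Rightarrow> real) \<Rightarrow> int \<Rightarrow> env \<Rightarrow> real" where
  "rho p x \<omega> = (1 - p x \<omega>) / p x \<omega>"

definition assumption_A :: "env measure \<Rightarrow> (int \<Rightarrow> env \<Rightarrow> real) \<Rightarrow> bool" where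
  "assumption_A PE p \<longleftrightarrow>
     prob_space PE \<and> sets PE = sets env_measure \<and>
     (AE \<omega> in PE. \<forall>x i. 0 \<le> \<omega> x i \<and> \<omega> x i \<le> 1) \<and>
     \<comment> \<open>(A.1)\<close>
     (AE \<omega> in PE. \<forall>x. 0 < p x \<omega> \<and> p x \<omega> < 1 \<and>
                        (\<forall>i. enat i > cookies \<omega> x \<longrightarrow> \<omega> x i = p x \<omega>)) \<and>
     measure PE {\<omega> \<in> space PE. p 0 \<omega> = 1/2} < 1 \<and>
     \<comment> \<open>(A.2) i.i.d.\<close>
     prob_space.indep_vars PE (\<lambda>_. borel \<Otimes>\<^sub>M count_space UNIV)
        (\<lambda>x \<omega>. (p x \<omega>, cookies \<omega> x)) UNIV \<and>
     (\<forall>x. distr PE (borel \<Otimes>\<^sub>M count_space UNIV) (\<lambda>\<omega>. (p x \<omega>, cookies \<omega> x))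
          = distr PE (borel \<Otimes>\<^sub>M count_space UNIV) (\<lambda>\<omega>. (p 0 \<omega>, cookies \<omega> 0))) \<and>
     \<comment> \<open>(A.3)\<close>
     integrable PE (\<lambda>\<omega>. \<bar>ln (rho p 0 \<omega>)\<bar>) \<and>
     (\<integral>\<omega>. ln (rho p 0 \<omega>) \<partial>PE) = 0 \<and>
     \<comment> \<open>(A.4)\<close>
     measure PE {\<omega> \<in> space PE. cookies \<omega> 0 = \<infinity>} = 0 \<and>
     measure PE {\<omega> \<in> space PE. cookies \<omega> 0 = 0} > 0"

definition log_enat :: "enat \<Rightarrow> ereal" where
  "log_enat k = (case k of \<infinity> \<Rightarrow> \<infinity> | enat n \<Rightarrow> (if n = 0 then -\<infinity> else ereal (ln (real n))))"

text \<open>log_+ of a (finite) number of cookies; log_+ 0 = 0 (infinite M_0 has probability 0).\<close>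
definition log_plus_cookies :: "enat \<Rightarrow> real" where
  "log_plus_cookies k = (case k of \<infinity> \<Rightarrow> 0 | enat n \<Rightarrow> (if n = 0 then 0 else max (ln (real n)) 0))"

definition walk_step :: "env \<Rightarrow> (nat \<Rightarrow> int) \<Rightarrow> nat \<Rightarrow> real" where
  "walk_step \<omega> s m =
     (let i = card {k. k \<le> m \<and> s k = s m} in
      if s (Suc m) = s m + 1 then \<omega> (s m) i
      else if s (Suc m) = s m - 1 then 1 - \<omega> (s m) i else 0)"

text \<open>Quenched probability P_{z,omega}[S_m = s m for all m <= n].\<close>
definition path_weight :: "env \<Rightarrow> int \<Rightarrow> (nat \<Rightarrow> int) \<Rightarrow> nat \<Rightarrow> real" where
  "path_weight \<omega> z s n = (if s 0 = z then (\<Prod>m<n. walk_step \<omega> s m) else 0)"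

text \<open>(M, Ev, S) realizes the ERWRE started at z with annealed law P_z:
  Ev is the environment with law PE and, given the environment, S is the walk with law P_{z,omega}.
  The joint law is fixed by its values on the cylinder sets.\<close>
definition ERWRE_realization ::
  "env measure \<Rightarrow> int \<Rightarrow> 'a measure \<Rightarrow> ('a \<Rightarrow> env) \<Rightarrow> (nat \<Rightarrow> 'a \<Rightarrow> int) \<Rightarrow> bool" where
  "ERWRE_realization PE z M Ev S \<longleftrightarrow>
     prob_space M \<and> Ev \<in> M \<rightarrow>\<^sub>M PE \<and> (\<forall>n. S n \<in> M \<rightarrow>\<^sub>M count_space UNIV) \<and>
     (\<forall>A \<in> sets PE. \<forall>n s.
        measure M {a \<in> space M. Ev a \<in> A \<and> (\<forall>m\<le>n. S m a = s m)}
          = (\<integral>\<omega>. indicator A \<omega> * path_weight \<omega> z s n \<partial>PE))"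

end

theory Submission
  imports Defs
begin

text \<open>
  Fix the environment and let \<open>h\<close> be the scale function of the walk without cookies, with increments
  \<open>a\<^sub>x = \<rho>\<^sub>1 \<cdots> \<rho>\<^sub>x = exp (- \<Xi>\<^sub>x)\<close>. Eating a cookie at \<open>x\<close> raises \<open>h\<close> by exactly \<open>a\<^sub>x\<close>, so
  \<open>h(S\<^sub>n) + \<Sum>\<^sub>x a\<^sub>x \<cdot> (cookies left at x)\<close> is a martingale to the right of \<open>0\<close>.

  Recurrence. If \<open>1 + \<Sum>\<^sub>x\<^sub>\<le>\<^sub>n a\<^sub>x M\<^sub>x \<le> K a\<^sub>n\<close> and the site \<open>n + 1\<close> has no cookie, then the walk
  that is pushed back at \<open>n + 1\<close> makes at most about \<open>K\<close> attempts to pass before it returns to \<open>0\<close>;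
  hence a fixed fraction of the surviving mass is lost at each such \<open>n\<close>, and infinitely many of them
  force a return. The quotient \<open>Q\<^sub>n = (1 + \<Sum>\<^sub>x\<^sub>\<le>\<^sub>n a\<^sub>x M\<^sub>x) / a\<^sub>n\<close> satisfies the critical affine
  recursion \<open>Q\<^sub>n\<^sub>+\<^sub>1 = exp(\<xi>) Q\<^sub>n + M\<close>. As long as it stays above \<open>exp K\<close>, the logarithm of
  \<open>1 + \<Sum> a\<^sub>x M\<^sub>x\<close> grows only at sites where \<open>log M\<^sub>x - K\<close> exceeds the height of \<open>\<Xi>\<close> above its
  running minimum; that reflected walk spends a time of order \<open>\<surd>n\<close> in each bounded interval, so the
  total growth is at most \<open>\<eta>(K) \<surd>n\<close> with \<open>\<eta>(K) \<rightarrow> 0\<close>, whereas by the central limit theorem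
  \<open>- \<Xi>\<^sub>n\<close> is of order \<open>\<surd>n\<close> with positive probability. A zero-one law concludes.

  Transience. In almost every block \<open>[2\<^sup>k, 2\<^sup>k\<^sup>+\<^sup>1)\<close> some site has more than \<open>exp(T\<^sup>k)\<close> cookies with
  \<open>T\<^sup>2 > 2\<close>, while by Kolmogorov's maximal inequality \<open>\<Xi>\<close> varies by much less than \<open>T\<^sup>k\<close> up to
  \<open>2\<^sup>k\<^sup>+\<^sup>2\<close>. The walk then reaches the next block before it has used up these cookies, except with
  summable probability.
\<close>

section \<open>The walk in a fixed environment\<close>

text \<open>The position alone is not Markov, but the pair of remaining cookies and position is. The
  quenched estimates are therefore about functions of such a pair and hold from every state with at
  most the initial cookies; this uniformity gives a return after every fixed time, hence infinitely
  many. Stopping times are replaced by finite-horizon hitting probabilities and a minimum principle;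
  \<open>sum_paths_hit\<close> alone translates them into path weights. Recurrence also requires
  that the walk does not stay on the nonpositive side: the scale function is unbounded to the left,
  by the critical recursion without cookies, so every level to the right is reached. Origin of the
  exponents: at height \<open>h\<close> of the logarithm the mean growth is controlled by
  \<open>h powr (1 - q)\<close>, and its sum over heights converges for \<open>q > 2\<close>, which
  is why slightly more than two moments are assumed. For transience, the walk of the log-increments
  fluctuates by about \<open>2 powr (k / 2)\<close> over a block of \<open>2 ^ k\<close> sites,
  whereas the largest log-number of cookies there is of order at least
  \<open>2 powr (k / lam)\<close>; a scale \<open>T ^ k\<close> fits strictly between when
  \<open>lam < 2\<close>.\<close>

locale cookie_chain =
  fixes p :: "int \<Rightarrow> real"
  assumes p_pos: "\<And>x. 0 < p x" and p_less_1: "\<And>x. p x < 1"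
begin

text \<open>The transition operator of the chain with state \<open>m\<close> (cookies left at each
  site) and \<open>y\<close> (position).\<close>

definition step :: "((int \<Rightarrow> nat) \<Rightarrow> int \<Rightarrow> real) \<Rightarrow> (int \<Rightarrow> nat) \<Rightarrow> int \<Rightarrow> real" where
  "step F m y = (if m y > 0 then F (m(y := m y - 1)) (y + 1)
                 else p y * F m (y + 1) + (1 - p y) * F m (y - 1))"

text \<open>Probability of entering \<open>T\<close> within \<open>k\<close> steps with no earlier
  visit to \<open>U\<close>, written as first-step analysis so that no path measure is needed.
  \<open>T\<close> is tested first, so a state in both sets counts as a success.\<close>

fun hit :: "((int \<Rightarrow> nat) \<Rightarrow> int \<Rightarrow> bool) \<Rightarrow> ((int \<Rightarrow> nat) \<Rightarrow> int \<Rightarrow> bool)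
    \<Rightarrow> nat \<Rightarrow> (int \<Rightarrow> nat) \<Rightarrow> int \<Rightarrow> real" where
  "hit T U 0 m y = (if T m y then 1 else 0)"
| "hit T U (Suc k) m y = (if T m y then 1 else if U m y then 0 else step (hit T U k) m y)"

text \<open>Truncated subtraction makes \<open>m(y := m y - 1)\<close> equal to \<open>m\<close>
  when no cookie is left, so one hypothesis on the right neighbour serves both branches of
  \<open>step\<close>.\<close>

lemma step_mono:
  assumes "F (m(y := m y - 1)) (y + 1) \<le> G (m(y := m y - 1)) (y + 1)"
    "m y = 0 \<Longrightarrow> F m (y - 1) \<le> G m (y - 1)"
  shows "step F m y \<le> step G m y"
proof -
  have "m y = 0 \<Longrightarrow> m(y := m y - 1) = m" by auto
  then show ?thesis
    using assms p_pos[of y] p_less_1[of y] unfolding step_def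
    by (auto intro!: add_mono mult_left_mono)
qed

lemma step_lin: "step (\<lambda>m y. c * F m y + d * G m y + e) m y = c * step F m y + d * step G m y + e"
  by (simp add: step_def algebra_simps)

lemma step_const: "step (\<lambda>m y. c) m y = c"
  by (simp add: step_def algebra_simps)

lemma hit_bounds: "0 \<le> hit T U k m y \<and> hit T U k m y \<le> 1"
proof (induction k arbitrary: m y)
  case (Suc k)
  have "step (\<lambda>_ _. 0) m y \<le> step (hit T U k) m y" "step (hit T U k) m y \<le> step (\<lambda>_ _. 1) m y"
    by (rule step_mono; use Suc in blast)+
  then show ?case by (simp add: step_const)
qed auto

lemma hit_Suc_mono: "hit T U k m y \<le> hit T U (Suc k) m y"
proof (induction k arbitrary: m y)
  case 0
  then show ?case using hit_bounds[of T U "Suc 0" m y] by auto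
next
  case (Suc k)
  have "step (hit T U k) m y \<le> step (hit T U (Suc k)) m y"
    by (rule step_mono; use Suc in blast)
  then show ?case by simp
qed

lemma hit_mono_avoid: "(\<And>m y. U' m y \<Longrightarrow> U m y) \<Longrightarrow> hit T U k m y \<le> hit T U' k m y"
proof (induction k arbitrary: m y)
  case (Suc k)
  have "step (hit T U k) m y \<le> step (hit T U' k) m y"
    by (rule step_mono; use Suc in blast)
  then show ?case using hit_bounds[of T U' "Suc k" m y] Suc.prems by auto
qed auto

definition hitting :: "((int \<Rightarrow> nat) \<Rightarrow> int \<Rightarrow> bool) \<Rightarrow> ((int \<Rightarrow> nat) \<Rightarrow> int \<Rightarrow> bool)
    \<Rightarrow> (int \<Rightarrow> nat) \<Rightarrow> int \<Rightarrow> real" where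
  "hitting T U m y = (SUP k. hit T U k m y)"

lemma hit_tendsto: "(\<lambda>k. hit T U k m y) \<longlonglongrightarrow> hitting T U m y"
  unfolding hitting_def
  by (rule LIMSEQ_incseq_SUP) (auto intro!: bdd_aboveI[of _ 1] incseq_SucI hit_Suc_mono simp: hit_bounds)

lemma hit_le_hitting: "hit T U k m y \<le> hitting T U m y"
  by (rule incseq_le[OF _ hit_tendsto]) (auto intro!: incseq_SucI hit_Suc_mono)

lemma hitting_bounds: "0 \<le> hitting T U m y" "hitting T U m y \<le> 1"
  using hit_le_hitting[of T U 0 m y] hit_bounds[of T U 0 m y]
  by (auto intro: LIMSEQ_le_const2[OF hit_tendsto] simp: hit_bounds)

lemma hitting_target: "T m y \<Longrightarrow> hitting T U m y = 1"
  using hit_le_hitting[of T U 0 m y] hitting_bounds[of T U m y] by auto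

lemma hitting_avoid: "U m y \<Longrightarrow> \<not> T m y \<Longrightarrow> hitting T U m y = 0"
proof -
  assume "U m y" "\<not> T m y"
  then have "hit T U k m y = 0" for k by (cases k) auto
  then show ?thesis unfolding hitting_def by simp
qed

lemma hitting_step:
  assumes "\<not> T m y" "\<not> U m y"
  shows "hitting T U m y = step (hitting T U) m y"
proof (rule LIMSEQ_unique)
  show "(\<lambda>k. hit T U (Suc k) m y) \<longlonglongrightarrow> hitting T U m y"
    by (rule LIMSEQ_Suc[OF hit_tendsto])
  show "(\<lambda>k. hit T U (Suc k) m y) \<longlonglongrightarrow> step (hitting T U) m y"
    using assms by (auto simp: step_def intro!: tendsto_intros hit_tendsto)
qed

lemma hitting_mono_avoid: "(\<And>m y. U' m y \<Longrightarrow> U m y) \<Longrightarrow> hitting T U m y \<le> hitting T U' m y"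
  by (rule LIMSEQ_le[OF hit_tendsto hit_tendsto]) (auto intro!: exI[of _ 0] hit_mono_avoid)

text \<open>Induction on the horizon replaces optional stopping; \<open>C\<close> confines the
  comparison to a region that the chain cannot leave before it enters \<open>T\<close> or
  \<open>U\<close>.\<close>

lemma hit_le_superharmonic:
  assumes "\<And>m y. C m y \<Longrightarrow> 0 \<le> F m y" "\<And>m y. C m y \<Longrightarrow> T m y \<Longrightarrow> 1 \<le> F m y"
    and "\<And>m y. C m y \<Longrightarrow> \<not> T m y \<Longrightarrow> \<not> U m y \<Longrightarrow> step F m y \<le> F m y"
    and "\<And>m y. C m y \<Longrightarrow> \<not> T m y \<Longrightarrow> \<not> U m y \<Longrightarrow> C (m(y := m y - 1)) (y + 1)"
    and "\<And>m y. C m y \<Longrightarrow> \<not> T m y \<Longrightarrow> \<not> U m y \<Longrightarrow> m y = 0 \<Longrightarrow> C m (y - 1)"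
    and "C m y"
  shows "hit T U k m y \<le> F m y"
  using \<open>C m y\<close>
proof (induction k arbitrary: m y)
  case (Suc k)
  have "step (hit T U k) m y \<le> step F m y" if "\<not> T m y" "\<not> U m y"
    by (rule step_mono; use Suc assms(4,5) that in blast)
  then show ?case using assms(1-3)[OF Suc.prems]
    by (cases "T m y"; cases "U m y") (auto intro: order_trans)
qed (use assms in auto)

abbreviation outside :: "int \<Rightarrow> int \<Rightarrow> (int \<Rightarrow> nat) \<Rightarrow> int \<Rightarrow> bool" where
  "outside l r \<equiv> \<lambda>m y. y \<le> l \<or> r \<le> y"
abbreviation never :: "(int \<Rightarrow> nat) \<Rightarrow> int \<Rightarrow> bool" where
  "never \<equiv> \<lambda>m y. False"

text \<open>It suffices to follow the single path that goes right \<open>k\<close> times: a cookie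
  step is certain, any other step to the right has probability at least \<open>d\<close>.\<close>

lemma exit_run_right:
  assumes "0 \<le> d" "\<And>x. l < x \<Longrightarrow> x < r \<Longrightarrow> d \<le> p x" "d \<le> 1" "r - y \<le> int k"
  shows "d ^ k \<le> hit (outside l r) never k m y"
  using assms(4)
proof (induction k arbitrary: m y)
  case 0
  then show ?case using assms by auto
next
  case (Suc k)
  show ?case
  proof (cases "outside l r m y")
    case True
    then have "hit (outside l r) never (Suc k) m y = 1" by auto
    then show ?thesis using power_le_one[of d "Suc k"] assms by simp
  next
    case False
    let ?h = "hit (outside l r) never k"
    have IH: "d ^ k \<le> ?h m' (y + 1)" for m' using Suc by auto
    have d: "d \<le> p y" using False assms by auto
    have pos: "0 \<le> (1 - p y) * ?h m (y - 1)"
      using hit_bounds[of "outside l r" never k m "y - 1"] p_less_1[of y] by simp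
    have "d ^ Suc k \<le> step ?h m y"
    proof (cases "m y > 0")
      case True
      have "d ^ Suc k \<le> d ^ k" using assms(1,3) by (simp add: mult_left_le_one_le)
      with IH[of "m(y := m y - 1)"] True show ?thesis unfolding step_def by (simp only: if_True)
    next
      case F: False
      have "d ^ Suc k \<le> p y * ?h m (y + 1)"
        using IH d assms(1) p_pos[of y] by (simp add: mult_mono)
      then show ?thesis using F pos by (simp add: step_def)
    qed
    then show ?thesis using False by simp
  qed
qed

text \<open>The Markov property after \<open>k\<close> steps: since the failure bound
  \<open>\<theta>\<close> over \<open>n\<close> steps holds from every state, it can be applied
  again to whatever has survived so far.\<close>

lemma hit_shift:
  assumes "\<And>m y. 1 - hit T never n m y \<le> \<theta>" "0 \<le> \<theta>"
  shows "1 - hit T never (k + n) m y \<le> \<theta> * (1 - hit T never k m y)"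
proof (induction k arbitrary: m y)
  case 0
  show ?case
  proof (cases "T m y")
    case True
    then show ?thesis by (cases n) auto
  next
    case False
    then show ?thesis using assms(1)[of m y] by auto
  qed
next
  case (Suc k)
  have aux: "0 * (0::real) + (-1) * hit T never (k + n) m y + 1
      \<le> 0 * (0::real) + (-\<theta>) * hit T never k m y + \<theta>" for m y
    using Suc[of m y] by (simp add: algebra_simps)
  have "step (\<lambda>m y. 0 * (0::real) + (-1) * hit T never (k + n) m y + 1) m y
      \<le> step (\<lambda>m y. 0 * (0::real) + (-\<theta>) * hit T never k m y + \<theta>) m y"
    by (rule step_mono) (rule aux)+
  then have "1 - step (hit T never (k + n)) m y \<le> \<theta> * (1 - step (hit T never k) m y)"
    unfolding step_lin by (simp add: algebra_simps)
  then show ?case by simp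
qed

text \<open>In each period of \<open>nat (r - l)\<close> steps the exit has probability at least
  \<open>d ^ n\<close> from every state, so survival decays geometrically.\<close>

lemma exit_certain: "hitting (outside l r) never m y = 1"
proof -
  \<comment> \<open>Inserting 1 keeps the minimum defined for an empty strip and gives
    \<open>d \<le> 1\<close>.\<close>
  define d where "d = Min (insert 1 (p ` {l<..<r}))"
  have d: "0 < d" "d \<le> 1" "\<And>x. l < x \<Longrightarrow> x < r \<Longrightarrow> d \<le> p x"
    unfolding d_def by (auto simp: p_pos)
  define n where "n = nat (r - l)"
  let ?h = "hit (outside l r) never"
  have bnd: "1 - ?h n m y \<le> 1 - d ^ n" for m y
  proof (cases "y \<le> l")
    case True
    then have "?h n m y = 1" by (cases n) auto
    then show ?thesis using d by (auto intro: power_le_one)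
  next
    case False
    then have "d ^ n \<le> ?h n m y" using d unfolding n_def by (intro exit_run_right) auto
    then show ?thesis by simp
  qed
  have \<theta>: "0 \<le> 1 - d ^ n" "1 - d ^ n < 1" using d by (auto intro: power_le_one)
  have it: "1 - ?h (j * n) m y \<le> (1 - d ^ n) ^ j" for j m y
  proof (induction j)
    case 0
    then show ?case by simp
  next
    case (Suc j)
    have "1 - ?h (j * n + n) m y \<le> (1 - d ^ n) * (1 - ?h (j * n) m y)"
      by (rule hit_shift[OF bnd \<theta>(1)])
    also have "\<dots> \<le> (1 - d ^ n) * (1 - d ^ n) ^ j" using Suc \<theta>(1) by (rule mult_left_mono)
    finally show ?case by (simp add: add.commute)
  qed
  have "(\<lambda>j. (1 - d ^ n) ^ j) \<longlonglongrightarrow> 0" using \<theta> by (intro LIMSEQ_realpow_zero) auto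
  moreover have "1 - hitting (outside l r) never m y \<le> (1 - d ^ n) ^ j" for j
    using it[of j m y] hit_le_hitting[of "outside l r" never "j * n" m y] by linarith
  ultimately have "1 - hitting (outside l r) never m y \<le> 0"
    by (intro LIMSEQ_le_const[of _ 0]) auto
  then show ?thesis using hitting_bounds[of "outside l r" never m y] by simp
qed

text \<open>Optional stopping at the exit from the strip: induction on the horizon \<open>k\<close>
  gives the lower bound \<open>- B\<close> times the probability of not having left within
  \<open>k\<close> steps, and this tends to 0 by \<open>exit_certain\<close>. The side condition
  \<open>C\<close> on the cookies only has to survive the removal of one.\<close>

lemma minimum_principle:
  assumes low: "\<And>m y. C m \<Longrightarrow> l \<le> y \<Longrightarrow> y \<le> r \<Longrightarrow> - B \<le> F m y"
    and bd: "\<And>m. C m \<Longrightarrow> 0 \<le> F m l" "\<And>m. C m \<Longrightarrow> 0 \<le> F m r"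
    and sup: "\<And>m y. C m \<Longrightarrow> l < y \<Longrightarrow> y < r \<Longrightarrow> step F m y \<le> F m y"
    and C: "\<And>m y. C m \<Longrightarrow> C (m(y := m y - 1))"
    and "C m" "l \<le> y" "y \<le> r" "0 \<le> B"
  shows "0 \<le> F m y"
proof -
  let ?h = "hit (outside l r) never"
  have *: "- B * (1 - ?h k m y) \<le> F m y" if "C m" "l \<le> y" "y \<le> r" for k m y
    using that
  proof (induction k arbitrary: m y)
    case 0
    then show ?case using low bd \<open>0 \<le> B\<close>
      by (cases "y = l \<or> y = r") auto
  next
    case (Suc k)
    show ?case
    proof (cases "l < y \<and> y < r")
      case False
      then show ?thesis using bd Suc.prems by (cases "y = l") auto
    next
      case True
      have aux: "0 * (0::real) + B * ?h k m y + (- B) \<le> F m y" if "C m" "l \<le> y" "y \<le> r" for m y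
        using Suc.IH[OF that] by (simp add: algebra_simps)
      have "step (\<lambda>m y. 0 * (0::real) + B * ?h k m y + (- B)) m y \<le> step F m y"
        by (rule step_mono; rule aux) (use C[OF Suc.prems(1)] Suc.prems True in auto)
      then have "- B * (1 - step (?h k) m y) \<le> step F m y"
        unfolding step_lin by (simp add: algebra_simps)
      with sup[of m y] True Suc.prems show ?thesis by simp
    qed
  qed
  have "(\<lambda>k. - B * (1 - ?h k m y)) \<longlonglongrightarrow> - B * (1 - hitting (outside l r) never m y)"
    by (intro tendsto_intros hit_tendsto)
  then have "(\<lambda>k. - B * (1 - ?h k m y)) \<longlonglongrightarrow> 0" by (simp add: exit_certain)
  then show ?thesis by (rule LIMSEQ_le_const2) (use * assms in auto)
qed

section \<open>Scale function of the walk without cookies\<close>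

definition \<rho> :: "int \<Rightarrow> real" where "\<rho> x = (1 - p x) / p x"
text \<open>At least one of the two products is empty: to the right of 0 this is the product of
  \<open>\<rho> 1\<close> to \<open>\<rho> x\<close>, to the left the reciprocal of the product of
  \<open>\<rho> (x + 1)\<close> to \<open>\<rho> 0\<close>. Thus \<open>slope_step\<close> holds on
  all integers.\<close>

definition slope :: "int \<Rightarrow> real" where
  "slope x = (\<Prod>i\<in>{1..x}. \<rho> i) / (\<Prod>i\<in>{x+1..0}. \<rho> i)"
definition scale :: "int \<Rightarrow> real" where
  "scale x = (\<Sum>i\<in>{0..<x}. slope i) - (\<Sum>i\<in>{x..<0}. slope i)"

lemma \<rho>_pos: "0 < \<rho> x"
  using p_pos[of x] p_less_1[of x] by (simp add: \<rho>_def)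

lemma slope_pos: "0 < slope x"
  unfolding slope_def by (intro divide_pos_pos prod_pos) (auto simp: \<rho>_pos)

lemma slope_step: "slope x = slope (x - 1) * \<rho> x"
proof (cases "1 \<le> x")
  case True
  then have "{1..x} = insert x {1..x-1}" by auto
  then show ?thesis using True by (simp add: slope_def)
next
  case False
  then have "{x..0} = insert x {x+1..0}" by auto
  moreover have "\<rho> x \<noteq> 0" using \<rho>_pos[of x] by simp
  ultimately show ?thesis using False by (simp add: slope_def)
qed

lemma slope_0: "slope 0 = 1" and scale_0: "scale 0 = 0"
  by (simp_all add: slope_def scale_def)

lemma scale_step: "scale (x + 1) = scale x + slope x"
proof (cases "0 \<le> x")
  case True
  then have "{0..<x+1} = insert x {0..<x}" by auto
  then show ?thesis using True by (simp add: scale_def)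
next
  case False
  then have "{x..<0} = insert x {x+1..<0}" by auto
  then show ?thesis using False by (simp add: scale_def)
qed

lemma scale_harmonic: "p y * scale (y + 1) + (1 - p y) * scale (y - 1) = scale y"
proof -
  have "scale y = scale (y - 1) + slope (y - 1)" using scale_step[of "y - 1"] by simp
  moreover have "p y * slope y = (1 - p y) * slope (y - 1)"
    using slope_step[of y] p_pos[of y] by (simp add: \<rho>_def field_simps)
  ultimately show ?thesis using scale_step[of y] by (simp add: algebra_simps)
qed

lemma scale_mono: "x \<le> y \<Longrightarrow> scale x \<le> scale y"
  by (induction y rule: int_ge_induct)
     (auto simp: scale_step intro: order_trans less_imp_le[OF slope_pos] add_increasing2)

lemma scale_strict_mono: "x < y \<Longrightarrow> scale x < scale y"
  using scale_mono[of "x + 1" y] scale_step[of x] slope_pos[of x] by simp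

lemma scale_diff: "x \<le> y \<Longrightarrow> scale y - scale x = (\<Sum>z\<in>{x..<y}. slope z)"
proof (induction y rule: int_ge_induct)
  case (step i)
  then have "{x..<i+1} = insert i {x..<i}" by auto
  then show ?case using step by (simp add: scale_step)
qed simp

abbreviation at_most :: "int \<Rightarrow> (int \<Rightarrow> nat) \<Rightarrow> int \<Rightarrow> bool" where
  "at_most l \<equiv> \<lambda>m y. y \<le> l"
abbreviation at_least :: "int \<Rightarrow> (int \<Rightarrow> nat) \<Rightarrow> int \<Rightarrow> bool" where
  "at_least r \<equiv> \<lambda>m y. r \<le> y"

text \<open>Cookies only push to the right, so \<open>scale\<close> is subharmonic and the gambler's
  ruin formula of the walk without cookies bounds the probability of leaving the strip at
  \<open>l\<close>. It tends to 0 as \<open>l\<close> decreases, because \<open>scale\<close> is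
  unbounded below.\<close>

lemma hits_level_right:
  assumes unb: "\<And>K. \<exists>l. scale l < K" and "y \<le> r"
  shows "hitting (at_least r) never m y = 1"
proof -
  have *: "1 - hitting (at_least r) never m y \<le> (scale r - scale y) / (scale r - scale l)"
    if "l < y" for l
  proof -
    have pos: "0 < scale r - scale l" using scale_strict_mono[of l r] that assms(2) by simp
    define c where "c = 1 / (scale r - scale l)"
    have c: "0 < c" "c * (scale r - scale l) = 1" using pos by (auto simp: c_def)
    \<comment> \<open>The constants make this the hitting probability itself at \<open>l\<close>,
      and 0 at \<open>r\<close>.\<close>
    let ?F = "\<lambda>m y. 1 * hitting (at_least r) never m y + (- c) * scale y + (c * scale r - 1)"
    have lo: "-1 \<le> ?F m y" if "y \<le> r" for m y
    proof -
      have "c * scale y \<le> c * scale r" using scale_mono[OF that] c by simp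
      then show ?thesis using hitting_bounds(1)[of "at_least r" never m y] by simp
    qed
    have stsc: "scale y \<le> step (\<lambda>m. scale) m y" for m y
      using scale_harmonic[of y] scale_mono[of y "y + 1"] by (auto simp: step_def)
    have "0 \<le> ?F m y"
    proof (rule minimum_principle[where F = ?F and C = "\<lambda>_. True" and l = l and r = r and B = 1])
      fix m y assume "l < y" "y < r"
      have "step ?F m y = 1 * step (hitting (at_least r) never) m y
         + (- c) * step (\<lambda>m. scale) m y + (c * scale r - 1)"
        by (rule step_lin)
      also have "step (hitting (at_least r) never) m y = hitting (at_least r) never m y"
        by (rule hitting_step[symmetric]) (use \<open>y < r\<close> in auto)
      finally show "step ?F m y \<le> ?F m y"
        using mult_left_mono[OF stsc[of y m], of c] c by simp
    next
      fix m show "0 \<le> ?F m l" using hitting_bounds[of "at_least r" never m l] c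
        by (simp add: algebra_simps)
      show "0 \<le> ?F m r" using hitting_target[of "at_least r" m r never] by simp
    qed (use that assms lo in auto)
    then show ?thesis by (simp add: c_def field_simps diff_divide_distrib)
  qed
  have "1 - hitting (at_least r) never m y \<le> 0 + e" if "e > 0" for e
  proof -
    obtain l where l: "scale l < min (scale y) (scale r - (scale r - scale y) / e)" using unb by blast
    then have "l < y" using scale_mono[of y l] by (cases "l < y") auto
    moreover have "(scale r - scale y) / (scale r - scale l) \<le> e"
    proof -
      have "(scale r - scale y) / e < scale r - scale l" "0 < scale r - scale l"
        using l scale_strict_mono[of l r] \<open>l < y\<close> assms(2) by auto
      then show ?thesis using that by (simp add: field_simps)
    qed
    ultimately show ?thesis using *[of l] by simp
  qed
  then have "1 - hitting (at_least r) never m y \<le> 0" by (rule field_le_epsilon)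
  then show ?thesis using hitting_bounds[of "at_least r" never m y] by simp
qed

section \<open>Return to the nonpositive half-line\<close>

definition potential :: "int \<Rightarrow> (int \<Rightarrow> nat) \<Rightarrow> int \<Rightarrow> real" where
  "potential n m y = scale y + (\<Sum>x\<in>{1..n}. slope x * real (m x))"

text \<open>A cookie eaten at \<open>y\<close> removes \<open>slope y\<close> from the sum, while
  the forced step to the right adds \<open>slope y\<close> to \<open>scale\<close>. The cutoff at
  \<open>n\<close> keeps the sum finite and costs nothing as long as the walk has not passed
  \<open>n\<close>.\<close>

lemma potential_step:
  assumes "0 < y" "y \<le> n"
  shows "step (potential n) m y = potential n m y"
proof (cases "m y > 0")
  case True
  have "(\<Sum>x\<in>{1..n}. slope x * real ((m(y := m y - 1)) x))
      = (\<Sum>x\<in>{1..n}. slope x * real (m x) - (if x = y then slope y else 0))"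
    using True by (intro sum.cong) (auto simp: of_nat_diff algebra_simps)
  also have "\<dots> = (\<Sum>x\<in>{1..n}. slope x * real (m x)) - slope y"
    using assms by (simp add: sum_subtractf)
  finally show ?thesis using True by (simp add: step_def potential_def scale_step)
next
  case False
  then show ?thesis using scale_harmonic[of y] by (simp add: step_def potential_def algebra_simps)
qed

lemma potential_nonneg: "0 \<le> y \<Longrightarrow> scale y \<le> potential n m y" "0 \<le> y \<Longrightarrow> 0 \<le> potential n m y"
  using scale_mono[of 0 y] slope_pos by (auto simp: potential_def scale_0 less_imp_le intro!: sum_nonneg add_nonneg_nonneg)

abbreviation \<alpha> :: "int \<Rightarrow> (int \<Rightarrow> nat) \<Rightarrow> int \<Rightarrow> real" where
  "\<alpha> n \<equiv> hitting (at_most 0) (at_least n)"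

text \<open>Induction on the number \<open>L\<close> of attempts. At \<open>n + 1\<close> there is
  no cookie, so with probability \<open>q\<close> the walk steps back to \<open>n\<close>, where the
  potential is smaller by \<open>slope n\<close>: one unit of the budget \<open>L * slope n\<close>
  is spent.\<close>

lemma return_from_fresh_site:
  assumes n: "1 \<le> n" and M: "M (n + 1) = 0" and "L \<ge> 1"
    and "m \<le> M" "0 \<le> y" "y \<le> n + 1"
  shows "(1 - p (n + 1)) ^ L * (1 - potential n m y / (real L * slope n)) \<le> \<alpha> (n + 2) m y"
proof -
  define q where "q = 1 - p (n + 1)"
  have q: "0 < q" "q < 1" using p_pos[of "n + 1"] p_less_1[of "n + 1"] by (auto simp: q_def)
  have \<alpha>0: "\<alpha> (n + 2) m 0 = 1" for m by (rule hitting_target) simp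
  have an: "0 < slope n" by (rule slope_pos)
  \<comment> \<open>Only the value at the right end point has to be propagated: both sides are harmonic inside.\<close>
  have extend: "q ^ L * (1 - potential n m y / (real L * slope n)) \<le> \<alpha> (n + 2) m y"
    if L: "1 \<le> L" and my: "m \<le> M" "0 \<le> y" "y \<le> n + 1"
      and edge: "\<And>m. m \<le> M \<Longrightarrow>
        q ^ L * (1 - potential n m (n + 1) / (real L * slope n)) \<le> \<alpha> (n + 2) m (n + 1)" for L m y
  proof -
    define c where "c = q ^ L / (real L * slope n)"
    have c: "0 < c" using L q an by (simp add: c_def)
    have qL: "0 < q ^ L" "q ^ L \<le> 1" using q by (auto intro: power_le_one)
    have rew: "q ^ L * (1 - u / (real L * slope n)) = q ^ L - c * u" for u
      by (simp add: c_def algebra_simps)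
    let ?F = "\<lambda>m y. 1 * \<alpha> (n + 2) m y + c * potential n m y + (- (q ^ L))"
    have "0 \<le> ?F m y"
    proof (rule minimum_principle[where F = ?F and C = "\<lambda>m. m \<le> M" and l = 0 and r = "n + 1" and B = 1])
      fix m y assume "(0::int) \<le> y"
      then show "-1 \<le> ?F m y"
        using hitting_bounds[of "at_most 0" "at_least (n + 2)" m y]
          mult_nonneg_nonneg[of c "potential n m y"] potential_nonneg(2)[of y n m] c qL by linarith
    next
      fix m show "0 \<le> ?F m 0"
        using \<alpha>0[of m] mult_nonneg_nonneg[of c "potential n m 0"] potential_nonneg(2)[of 0 n m] c qL by linarith
    next
      fix m assume "m \<le> M"
      from edge[OF this] show "0 \<le> ?F m (n + 1)" by (simp add: rew)
    next
      fix m y assume "m \<le> M" "0 < y" "y < n + 1"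
      then have "step (\<alpha> (n + 2)) m y = \<alpha> (n + 2) m y" "step (potential n) m y = potential n m y"
        by (auto intro!: hitting_step[symmetric] potential_step)
      then show "step ?F m y \<le> ?F m y" unfolding step_lin by simp
    next
      fix m and y :: int assume "m \<le> M"
      then show "m(y := m y - 1) \<le> M" by (auto simp: le_fun_def intro: le_trans[OF diff_le_self])
    qed (use my in auto)
    then show ?thesis by (simp add: rew)
  qed
  show ?thesis
    unfolding q_def[symmetric] using \<open>L \<ge> 1\<close> \<open>m \<le> M\<close> \<open>0 \<le> y\<close> \<open>y \<le> n + 1\<close>
  proof (induction L arbitrary: m y rule: nat_induct_at_least)
    case base
    show ?case
    proof (rule extend)
      fix m
      \<comment> \<open>With a single attempt the bound at \<open>n + 1\<close> is trivial, since
        the potential there already uses up the budget and the left side is not positive.\<close>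
      have "slope n \<le> potential n m (n + 1)"
        using potential_nonneg(1)[of "n + 1" n m] scale_step[of n] scale_mono[of 0 n] n by (simp add: scale_0)
      then have "q * (1 - potential n m (n + 1) / slope n) \<le> 0"
        using q an by (simp add: mult_le_0_iff)
      then show "q ^ 1 * (1 - potential n m (n + 1) / (real 1 * slope n)) \<le> \<alpha> (n + 2) m (n + 1)"
        using hitting_bounds(1)[of "at_most 0" "at_least (n + 2)" m "n + 1"] by simp
    qed (use base in auto)
  next
    case (Suc L)
    show ?case
    proof (rule extend)
      fix m assume m: "m \<le> M"
      then have m0: "m (n + 1) = 0" using M by (metis le_fun_def le_zero_eq)
      let ?u = "potential n m (n + 1)"
      have pn: "potential n m n = ?u - slope n" by (simp add: potential_def scale_step)
      have "q * \<alpha> (n + 2) m n \<le> \<alpha> (n + 2) m (n + 1)"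
      proof -
        have "\<alpha> (n + 2) m (n + 1) = step (\<alpha> (n + 2)) m (n + 1)"
          by (rule hitting_step) (use n in auto)
        also have "\<dots> = p (n + 1) * \<alpha> (n + 2) m (n + 2) + q * \<alpha> (n + 2) m n"
          using m0 by (simp add: step_def q_def add.commute)
        finally show ?thesis using hitting_bounds(1)[of "at_most 0" "at_least (n + 2)" m "n + 2"]
          p_pos[of "n + 1"] by simp
      qed
      moreover have "q ^ L * (1 - (?u - slope n) / (real L * slope n)) \<le> \<alpha> (n + 2) m n"
        using Suc.IH[of m n] m n by (simp add: pn)
      then have "q * (q ^ L * (1 - (?u - slope n) / (real L * slope n))) \<le> q * \<alpha> (n + 2) m n"
        by (rule mult_left_mono) (use q in simp)
      ultimately have *: "q ^ Suc L * (1 - (?u - slope n) / (real L * slope n)) \<le> \<alpha> (n + 2) m (n + 1)"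
        by (simp add: mult.assoc)
      show "q ^ Suc L * (1 - ?u / (real (Suc L) * slope n)) \<le> \<alpha> (n + 2) m (n + 1)"
      \<comment> \<open>A potential above the whole budget makes the claim trivial; otherwise
        spending one unit does not increase the ratio of potential to budget.\<close>
      proof (cases "?u \<le> real (Suc L) * slope n")
        case True
        have "(?u - slope n) / (real L * slope n) \<le> ?u / (real (Suc L) * slope n)"
          using True an Suc.hyps by (simp add: divide_simps) (simp add: algebra_simps)
        then have "q ^ Suc L * (1 - ?u / (real (Suc L) * slope n))
           \<le> q ^ Suc L * (1 - (?u - slope n) / (real L * slope n))"
          using q by (intro mult_left_mono) auto
        with * show ?thesis by linarith
      next
        case False
        moreover have "0 < real (Suc L) * slope n" using an by simp
        ultimately have "1 \<le> ?u / (real (Suc L) * slope n)" by (subst le_divide_eq_1_pos) auto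
        then have "q ^ Suc L * (1 - ?u / (real (Suc L) * slope n)) \<le> 0"
          using q by (intro mult_nonneg_nonpos) auto
        then show ?thesis using hitting_bounds(1)[of "at_most 0" "at_least (n + 2)" m "n + 1"] by linarith
      qed
    qed (use Suc in auto)
  qed
qed

text \<open>A walk that reaches \<open>n + 1\<close> before returning, an event of mass
  \<open>1 - \<alpha> (n + 1) m y\<close>, still has the chance given by
  \<open>return_from_fresh_site\<close>. Harmonicity carries the potential term from
  \<open>n + 1\<close> back to the start; at 0 the potential is nonnegative, which is all that is
  required there.\<close>

lemma return_increment:
  assumes n: "1 \<le> n" and M: "M (n + 1) = 0" and L: "L \<ge> 1"
    and my: "m \<le> M" "0 \<le> y" "y \<le> n + 1"
  shows "\<alpha> (n + 1) m y + (1 - p (n + 1)) ^ L * (1 - \<alpha> (n + 1) m y - potential n m y / (real L * slope n))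
    \<le> \<alpha> (n + 2) m y"
proof -
  define q where "q = (1 - p (n + 1)) ^ L"
  have q: "0 < q" "q \<le> 1" using p_pos[of "n + 1"] p_less_1[of "n + 1"] by (auto simp: q_def intro: power_le_one)
  define c where "c = q / (real L * slope n)"
  have c: "0 < c" using L q slope_pos[of n] by (simp add: c_def)
  have rew: "q * (1 - v - u / (real L * slope n)) = q * (1 - v) - c * u" for u v
    by (simp add: c_def algebra_simps)
  let ?a = "\<alpha> (n + 1)" and ?b = "\<alpha> (n + 2)"
  let ?G = "\<lambda>m y. 1 * ?b m y + (- (1 - q)) * ?a m y + (- q)"
  let ?F = "\<lambda>m y. 1 * ?G m y + c * potential n m y + 0"
  have b: "0 \<le> ?a m y" "?a m y \<le> 1" "0 \<le> ?b m y" for m y by (auto intro: hitting_bounds)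
  have aq: "0 \<le> (1 - q) * ?a m y" "(1 - q) * ?a m y \<le> 1" for m y
    using b[of m y] q by (auto intro: mult_le_one)
  have cp: "0 \<le> c * potential n m y" if "0 \<le> y" for m y
    using potential_nonneg(2)[OF that] c by simp
  have "0 \<le> ?F m y"
  proof (rule minimum_principle[where F = ?F and C = "\<lambda>m. m \<le> M" and l = 0 and r = "n + 1" and B = 2])
    fix m y assume "(0::int) \<le> y"
    from aq[of m y] b[of m y] cp[OF this, of m] q show "- 2 \<le> ?F m y"
      by (simp only: mult_minus_left mult_1 add_0_right)
  next
    fix m
    have "?a m 0 = 1" "?b m 0 = 1" by (auto intro: hitting_target)
    then show "0 \<le> ?F m 0" using cp[of 0 m] by simp
  next
    fix m assume m: "m \<le> M"
    have "?a m (n + 1) = 0" by (rule hitting_avoid) (use n in auto)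
    moreover have "q - c * potential n m (n + 1) \<le> ?b m (n + 1)"
      using return_from_fresh_site[OF n M L m, of "n + 1"] n rew[of 0 "potential n m (n + 1)"]
      by (simp add: q_def)
    ultimately show "0 \<le> ?F m (n + 1)" by simp
  next
    fix m y assume "m \<le> M" "0 < y" "y < n + 1"
    then have "step ?b m y = ?b m y" "step ?a m y = ?a m y" "step (potential n) m y = potential n m y"
      by (auto intro!: hitting_step[symmetric] potential_step)
    then show "step ?F m y \<le> ?F m y" unfolding step_lin by simp
  next
    fix m and y :: int assume "m \<le> M"
    then show "m(y := m y - 1) \<le> M" by (auto simp: le_fun_def intro: le_trans[OF diff_le_self])
  qed (use my in auto)
  then show ?thesis unfolding q_def[symmetric] rew by (simp add: algebra_simps)
qed

text \<open>If the return probability \<open>\<beta>\<close> were less than 1, every suitable site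
  would raise \<open>\<alpha>\<close> by the same amount \<open>g\<close>, which is impossible
  infinitely often. What matters is that \<open>L\<close>, and hence \<open>g\<close>, does not
  depend on the site.\<close>

theorem returns_from_right:
  assumes inf: "\<exists>\<^sub>\<infinity>n::nat. 1 + (\<Sum>x\<in>{1..int n}. slope x * real (M x)) \<le> K * slope (int n)
      \<and> M (int n + 1) = 0 \<and> p (int n + 1) \<le> 1 - e"
    and e: "0 < e" and m: "m \<le> M" and y: "0 \<le> y"
  shows "hitting (at_most 0) never m y = 1"
proof (rule ccontr)
  define \<beta> where "\<beta> = hitting (at_most 0) never m y"
  assume "\<not> ?thesis"
  then have \<beta>: "\<beta> < 1" using hitting_bounds(2)[of "at_most 0" never m y] by (simp add: \<beta>_def)
  have mono: "mono (\<lambda>n. \<alpha> n m y)" by (intro monoI hitting_mono_avoid) auto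
  have le: "\<alpha> n m y \<le> \<beta>" for n unfolding \<beta>_def by (rule hitting_mono_avoid) simp
  \<comment> \<open>The potential is at most \<open>max 1 (scale y)\<close> times the quantity
    bounded by \<open>K * slope n\<close> in the hypothesis. \<open>L\<close> then makes the
    potential term at most half of \<open>1 - \<beta>\<close>.\<close>
  define K' where "K' = max 1 (scale y) * max K 1"
  obtain L where L: "2 * K' / (1 - \<beta>) \<le> real L" using real_arch_simple by blast
  have K': "1 \<le> K'" unfolding K'_def using mult_mono[of 1 "max 1 (scale y)" 1 "max K 1"] by simp
  have L1: "1 \<le> L"
    using L K' \<beta> by (cases L) (auto simp: field_simps)
  define g where "g = e ^ L * ((1 - \<beta>) / 2)"
  have g: "0 < g" using e \<beta> by (simp add: g_def)
  have inc: "\<exists>n'\<ge>0. \<alpha> n m y + g \<le> \<alpha> n' m y" if n0: "0 \<le> n" for n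
  proof -
    obtain k :: nat where k: "nat (max (n + y) 1) < k"
      "1 + (\<Sum>x\<in>{1..int k}. slope x * real (M x)) \<le> K * slope (int k)"
      "M (int k + 1) = 0" "p (int k + 1) \<le> 1 - e"
      using inf unfolding INFM_nat by blast
    let ?k = "int k"
    have ky: "y \<le> ?k" "n \<le> ?k" using k(1) y n0 by linarith+
    have a: "0 < slope ?k" by (rule slope_pos)
    let ?s = "\<Sum>x\<in>{1..?k}. slope x * real (m x)" and ?S = "\<Sum>x\<in>{1..?k}. slope x * real (M x)"
    have sS: "?s \<le> ?S" "0 \<le> ?s" using m slope_pos
      by (auto intro!: sum_mono mult_left_mono sum_nonneg simp: le_fun_def less_imp_le)
    have "potential ?k m y \<le> max 1 (scale y) * (1 + ?S)"
    proof -
      have "?S \<le> max 1 (scale y) * ?S" using sS mult_right_mono[of 1 "max 1 (scale y)" ?S] by simp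
      then show ?thesis using sS unfolding potential_def by (simp add: algebra_simps)
    qed
    also have "\<dots> \<le> max 1 (scale y) * (max K 1 * slope ?k)"
      using k(2) a by (intro mult_left_mono order_trans[OF k(2)] mult_right_mono) auto
    finally have pot: "potential ?k m y \<le> K' * slope ?k" by (simp add: K'_def algebra_simps)
    have "potential ?k m y / (real L * slope ?k) \<le> K' / real L"
      using pot a L1 by (simp add: field_simps)
    also have "\<dots> \<le> (1 - \<beta>) / 2" using L L1 \<beta> by (simp add: field_simps)
    finally have "(1 - \<beta>) / 2 \<le> 1 - \<alpha> (?k + 1) m y - potential ?k m y / (real L * slope ?k)"
      using le[of "?k + 1"] by (simp add: field_simps)
    moreover have "e ^ L \<le> (1 - p (?k + 1)) ^ L" using k(4) e by (intro power_mono) auto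
    ultimately have "g \<le> (1 - p (?k + 1)) ^ L * (1 - \<alpha> (?k + 1) m y - potential ?k m y / (real L * slope ?k))"
      unfolding g_def using \<beta> e p_less_1[of "?k + 1"] by (intro mult_mono) (auto simp: less_imp_le)
    moreover have "\<alpha> (?k + 1) m y + (1 - p (?k + 1)) ^ L *
        (1 - \<alpha> (?k + 1) m y - potential ?k m y / (real L * slope ?k)) \<le> \<alpha> (?k + 2) m y"
      by (rule return_increment[where M = M]) (use k L1 m y ky in auto)
    moreover have "\<alpha> n m y \<le> \<alpha> (?k + 1) m y" using ky by (intro monoD[OF mono]) auto
    ultimately have "\<alpha> n m y + g \<le> \<alpha> (?k + 2) m y" by linarith
    then show ?thesis by (intro exI[of _ "?k + 2"]) auto
  qed
  have "\<exists>n\<ge>0. real j * g \<le> \<alpha> n m y" for j :: nat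
  proof (induction j)
    case 0
    then show ?case using hitting_bounds(1) by auto
  next
    case (Suc j)
    then obtain n where "0 \<le> n" "real j * g \<le> \<alpha> n m y" by blast
    moreover obtain n' where "0 \<le> n'" "\<alpha> n m y + g \<le> \<alpha> n' m y" using inc[OF \<open>0 \<le> n\<close>] by blast
    ultimately show ?case by (intro exI[of _ n']) (simp add: algebra_simps)
  qed
  moreover obtain j :: nat where "1 < real j * g" using reals_Archimedean3[OF g] by blast
  ultimately show False using le \<beta> by (metis less_le_not_le order_trans less_imp_le)
qed

text \<open>The target requires that all \<open>N\<close> cookies at \<open>x\<close> are used, and
  that after each of them the walk came back from \<open>x + 1\<close> to \<open>x\<close> before
  \<open>Y\<close>; by gambler's ruin this has probability at most \<open>1 - q\<close>, and cookies
  elsewhere only help. The clause \<open>m x = 0\<close> excludes visits to \<open>x - 1\<close>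
  made before \<open>x\<close> is reached for the first time.\<close>

lemma backtrack_bound:
  assumes "x < Y" "y \<le> x" "m x = N"
  shows "hit (\<lambda>m z. z = x - 1 \<and> m x = 0) (at_least Y) k m y \<le> (1 - slope x / (scale Y - scale x)) ^ N"
proof -
  define q where "q = slope x / (scale Y - scale x)"
  define g where "g z = (scale Y - scale z) / (scale Y - scale x)" for z
  have d: "0 < scale Y - scale x" using scale_strict_mono[OF assms(1)] by simp
  have q: "0 < q" "q \<le> 1" using d slope_pos[of x] scale_step[of x] scale_mono[of "x + 1" Y] assms(1)
    by (auto simp: q_def)
  have gx: "g x = 1" "g (x + 1) = 1 - q" using d scale_step[of x] by (auto simp: g_def q_def field_simps)
  have gmono: "g z' \<le> g z" if "z \<le> z'" for z z' using scale_mono[OF that] d by (simp add: g_def divide_right_mono)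
  have g0: "0 \<le> g z" if "z \<le> Y" for z using scale_mono[OF that] d by (simp add: g_def)
  have gh: "p z * g (z + 1) + (1 - p z) * g (z - 1) = g z" for z
  proof -
    have "p z * g (z + 1) + (1 - p z) * g (z - 1)
      = (scale Y - (p z * scale (z + 1) + (1 - p z) * scale (z - 1))) / (scale Y - scale x)"
      by (simp add: g_def add_divide_distrib diff_divide_distrib algebra_simps)
    then show ?thesis by (simp add: scale_harmonic g_def)
  qed
  \<comment> \<open>At \<open>x\<close> a cookie is exchanged for one attempt to reach \<open>Y\<close> before returning to \<open>x\<close>.\<close>
  let ?F = "\<lambda>m z. (1 - q) ^ m x * g (max z x)"
  have "hit (\<lambda>m z. z = x - 1 \<and> m x = 0) (at_least Y) k m y \<le> ?F m y"
  proof (rule hit_le_superharmonic[where C = "\<lambda>m z. z \<le> Y"])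
    fix m :: "int \<Rightarrow> nat" and z assume z: "z \<le> Y" and U: "\<not> Y \<le> z"
    consider "z < x" | "z = x" "m z = 0" | "z = x" "m z > 0" | "z > x" by fastforce
    then show "step ?F m z \<le> ?F m z"
    proof cases
      case 1
      then have "max (z + 1) x = x" "max (z - 1) x = x" "max z x = x" by auto
      then show ?thesis using 1 by (simp add: step_def gx algebra_simps)
    next
      case 2
      have "p z * (1 - q) + (1 - p z) * 1 \<le> 1" using q p_pos[of z] by (simp add: algebra_simps)
      then show ?thesis using 2 by (simp add: step_def gx)
    next
      case 3
      then have "(1 - q) ^ m x = (1 - q) ^ (m x - 1) * (1 - q)" by (cases "m x") auto
      then show ?thesis using 3 by (simp add: step_def gx)
    next
      case 4
      then have mx: "max (z + 1) x = z + 1" "max (z - 1) x = z - 1" "max z x = z" by auto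
      have "(1 - q) ^ m x * g (z + 1) \<le> (1 - q) ^ m x * g z"
        using q gmono[of z "z + 1"] by (intro mult_left_mono) auto
      moreover have "p z * ((1 - q) ^ m x * g (z + 1)) + (1 - p z) * ((1 - q) ^ m x * g (z - 1))
         = (1 - q) ^ m x * g z"
        unfolding gh[of z, symmetric] by (simp add: algebra_simps)
      ultimately show ?thesis using 4 by (simp add: step_def mx)
    qed
  qed (use q g0 assms gx in \<open>auto simp: max_def\<close>)
  also have "\<dots> = (1 - q) ^ N" using assms gx by (simp add: max_def)
  finally show ?thesis by (simp add: q_def)
qed

end

section \<open>Critical affine recursions\<close>

primrec chain :: "(nat \<Rightarrow> 's \<Rightarrow> 'z \<Rightarrow> 's) \<Rightarrow> 's \<Rightarrow> (nat \<Rightarrow> 'z) \<Rightarrow> nat \<Rightarrow> 's" where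
  "chain f s z 0 = s"
| "chain f s z (Suc n) = f n (chain f s z n) (z n)"

lemma chain_cong: "(\<And>i. i < n \<Longrightarrow> z i = z' i) \<Longrightarrow> chain f s z n = chain f s z' n"
  by (induction n) auto

lemma chain_measurable:
  assumes f: "\<And>n. (\<lambda>x. f n (fst x) (snd x)) \<in> S \<Otimes>\<^sub>M N \<rightarrow>\<^sub>M S" and s: "s \<in> space S"
    and g: "\<And>i. i < n \<Longrightarrow> g i \<in> L \<rightarrow>\<^sub>M N"
  shows "(\<lambda>x. chain f s (\<lambda>i. g i x) n) \<in> L \<rightarrow>\<^sub>M S"
  using g
proof (induction n)
  case (Suc n)
  then have "(\<lambda>x. (chain f s (\<lambda>i. g i x) n, g n x)) \<in> L \<rightarrow>\<^sub>M S \<Otimes>\<^sub>M N" by measurable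
  from measurable_compose[OF this f[of n]] show ?case by simp
qed (use s in simp)

lemma ennreal_le_suminf: "f j \<le> suminf f" for f :: "nat \<Rightarrow> ennreal"
  using sum_le_suminf[of f "{j}"] by simp

section \<open>Independent, identically distributed inputs\<close>

locale iid_sequence = prob_space M for M :: "'a measure" +
  fixes N :: "'z measure" and Z :: "nat \<Rightarrow> 'a \<Rightarrow> 'z"
  assumes indep: "indep_vars (\<lambda>_. N) Z UNIV"
    and ident: "\<And>n. distr M N (Z n) = distr M N (Z 0)"
begin

lemma Z_measurable [measurable]: "Z n \<in> M \<rightarrow>\<^sub>M N"
  using indep unfolding indep_vars_def by auto

lemma nn_integral_ident:
  assumes [measurable]: "\<phi> \<in> borel_measurable N"
  shows "(\<integral>\<^sup>+w. \<phi> (Z n w) \<partial>M) = (\<integral>\<^sup>+w. \<phi> (Z 0 w) \<partial>M)"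
proof -
  have "(\<integral>\<^sup>+w. \<phi> (Z n w) \<partial>M) = (\<integral>\<^sup>+z. \<phi> z \<partial>distr M N (Z n))" by (simp add: nn_integral_distr)
  then show ?thesis by (simp add: ident[of n] nn_integral_distr)
qed

text \<open>Fubini for the joint law of the first \<open>n\<close> inputs and input
  \<open>n\<close>, which is then replaced by a copy of input 0. Integrals of nonnegative functions
  avoid integrability conditions.\<close>

lemma nn_integral_past:
  assumes u: "u \<in> PiM {..<n} (\<lambda>_. N) \<rightarrow>\<^sub>M S" and dep: "\<And>z. u (restrict z {..<n}) = u z"
    and \<phi>: "\<phi> \<in> borel_measurable (S \<Otimes>\<^sub>M N)"
  shows "(\<integral>\<^sup>+w. \<phi> (u (\<lambda>i. Z i w), Z n w) \<partial>M) = (\<integral>\<^sup>+w. (\<integral>\<^sup>+w'. \<phi> (u (\<lambda>i. Z i w), Z 0 w') \<partial>M) \<partial>M)"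
proof -
  note [measurable] = u \<phi>
  let ?A = "PiM {..<n} (\<lambda>_. N)" and ?B = "PiM {n} (\<lambda>_. N)"
  let ?U = "\<lambda>w. restrict (\<lambda>i. Z i w) {..<n}" and ?V = "\<lambda>w. restrict (\<lambda>i. Z i w) {n}"
  have "indep_var ?A ?U ?B ?V" by (rule indep_var_restrict[OF indep]) auto
  then have [measurable]: "?U \<in> M \<rightarrow>\<^sub>M ?A" "?V \<in> M \<rightarrow>\<^sub>M ?B"
    and d: "distr M ?A ?U \<Otimes>\<^sub>M distr M ?B ?V = distr M (?A \<Otimes>\<^sub>M ?B) (\<lambda>w. (?U w, ?V w))"
    unfolding indep_var_distribution_eq by auto
  interpret D: prob_space "distr M ?B ?V" by (rule prob_space_distr) simp
  have [measurable]: "(\<lambda>b. b n) \<in> ?B \<rightarrow>\<^sub>M N" by (rule measurable_component_singleton) simp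
  have "(\<integral>\<^sup>+w. \<phi> (u (\<lambda>i. Z i w), Z n w) \<partial>M) = (\<integral>\<^sup>+w. \<phi> (u (?U w), ?V w n) \<partial>M)"
    by (simp add: dep)
  also have "\<dots> = (\<integral>\<^sup>+x. \<phi> (u (fst x), snd x n) \<partial>(distr M ?A ?U \<Otimes>\<^sub>M distr M ?B ?V))"
    unfolding d by (subst nn_integral_distr) (auto simp: dep)
  also have "\<dots> = (\<integral>\<^sup>+a. (\<integral>\<^sup>+b. \<phi> (u a, b n) \<partial>distr M ?B ?V) \<partial>distr M ?A ?U)"
    by (subst D.nn_integral_fst[symmetric]) auto
  also have "\<dots> = (\<integral>\<^sup>+a. (\<integral>\<^sup>+w'. \<phi> (u a, Z 0 w') \<partial>M) \<partial>distr M ?A ?U)"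
  proof (rule nn_integral_cong)
    fix a assume "a \<in> space (distr M ?A ?U)"
    then have [measurable]: "u a \<in> space S" using measurable_space[OF u] by simp
    have "(\<integral>\<^sup>+b. \<phi> (u a, b n) \<partial>distr M ?B ?V) = (\<integral>\<^sup>+w. \<phi> (u a, Z n w) \<partial>M)"
      by (subst nn_integral_distr) auto
    also have "\<dots> = (\<integral>\<^sup>+w. \<phi> (u a, Z 0 w) \<partial>M)" by (rule nn_integral_ident) simp
    finally show "(\<integral>\<^sup>+b. \<phi> (u a, b n) \<partial>distr M ?B ?V) = (\<integral>\<^sup>+w'. \<phi> (u a, Z 0 w') \<partial>M)" .
  qed
  also have "\<dots> = (\<integral>\<^sup>+w. (\<integral>\<^sup>+w'. \<phi> (u (?U w), Z 0 w') \<partial>M) \<partial>M)"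
    by (subst nn_integral_distr) auto
  finally show ?thesis by (simp add: dep)
qed

lemma nn_integral_chain:
  assumes f: "\<And>n. (\<lambda>x. f n (fst x) (snd x)) \<in> S \<Otimes>\<^sub>M N \<rightarrow>\<^sub>M S" and s: "s \<in> space S"
    and \<phi>: "\<phi> \<in> borel_measurable (S \<Otimes>\<^sub>M N)"
  shows "(\<integral>\<^sup>+w. \<phi> (chain f s (\<lambda>i. Z i w) n, Z n w) \<partial>M)
    = (\<integral>\<^sup>+w. (\<integral>\<^sup>+w'. \<phi> (chain f s (\<lambda>i. Z i w) n, Z 0 w') \<partial>M) \<partial>M)"
proof (rule nn_integral_past[OF _ _ \<phi>])
  show "(\<lambda>z. chain f s z n) \<in> PiM {..<n} (\<lambda>_. N) \<rightarrow>\<^sub>M S"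
    using chain_measurable[OF f s, of n "\<lambda>i z. z i" "PiM {..<n} (\<lambda>_. N)"] by auto
qed (auto intro: chain_cong)

lemma prob_tail_event:
  assumes E: "\<And>n. E \<in> sigma_sets (space M) (\<Union>i\<in>{n..}. {Z i -` A \<inter> space M | A. A \<in> sets N})"
  shows "prob E = 0 \<or> prob E = 1"
proof (rule kolmogorov_0_1_law)
  show "indep_sets (\<lambda>i. {Z i -` A \<inter> space M | A. A \<in> sets N}) UNIV"
    using indep unfolding indep_vars_def2 by auto
  show "sigma_algebra (space M) {Z i -` A \<inter> space M | A. A \<in> sets N}" for i
    using sets.sigma_algebra_axioms[of "vimage_algebra (space M) (Z i) N"]
      measurable_space[OF Z_measurable] by (subst (asm) sets_vimage_algebra2) auto
  show "E \<in> tail_events (\<lambda>i. {Z i -` A \<inter> space M | A. A \<in> sets N})"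
    using E unfolding tail_events_def by auto
qed

end

lemma (in prob_space) nn_integral_square_shift:
  fixes Y :: "'a \<Rightarrow> real"
  assumes [measurable]: "Y \<in> borel_measurable M" and sq: "integrable M (\<lambda>w. (Y w)\<^sup>2)" and mean: "expectation Y = 0"
  shows "(\<integral>\<^sup>+w. ennreal ((y + Y w)\<^sup>2) \<partial>M) = ennreal (y\<^sup>2 + expectation (\<lambda>w. (Y w)\<^sup>2))"
proof -
  have int: "integrable M Y" by (rule square_integrable_imp_integrable[OF _ sq]) simp
  have i: "integrable M (\<lambda>w. y\<^sup>2 + (2 * y * Y w + (Y w)\<^sup>2))" using int sq by auto
  have e: "(\<lambda>w. (y + Y w)\<^sup>2) = (\<lambda>w. y\<^sup>2 + (2 * y * Y w + (Y w)\<^sup>2))"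
    by (auto simp: power2_eq_square algebra_simps)
  have "expectation (\<lambda>w. (y + Y w)\<^sup>2) = y\<^sup>2 + expectation (\<lambda>w. (Y w)\<^sup>2)"
    unfolding e using int sq mean by (simp add: prob_space)
  then show ?thesis using i unfolding e[symmetric] by (subst nn_integral_eq_integral) auto
qed

text \<open>Kolmogorov's maximal inequality, by freezing the partial sums once they leave \<open>(-t, t)\<close>.\<close>

lemma (in iid_sequence) maximal_inequality:
  fixes f :: "'z \<Rightarrow> real"
  assumes [measurable]: "f \<in> borel_measurable N" and sq: "integrable M (\<lambda>w. (f (Z 0 w))\<^sup>2)"
    and mean: "expectation (\<lambda>w. f (Z 0 w)) = 0" and t: "0 < t"
  shows "prob {w \<in> space M. \<exists>k\<le>n. t \<le> \<bar>\<Sum>i<k. f (Z i w)\<bar>} \<le> real n * expectation (\<lambda>w. (f (Z 0 w))\<^sup>2) / t\<^sup>2"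
proof -
  let ?v = "expectation (\<lambda>w. (f (Z 0 w))\<^sup>2)"
  define g :: "nat \<Rightarrow> real \<Rightarrow> 'z \<Rightarrow> real" where "g n y z = (if t \<le> \<bar>y\<bar> then y else y + f z)" for n y z
  define Y where "Y n w = chain g 0 (\<lambda>i. Z i w) n" for n w
  have g: "(\<lambda>x. g n (fst x) (snd x)) \<in> borel \<Otimes>\<^sub>M N \<rightarrow>\<^sub>M borel" for n unfolding g_def by measurable
  have [measurable]: "Y n \<in> borel_measurable M" for n
    unfolding Y_def[abs_def] by (rule chain_measurable[OF g]) auto
  have Y_Suc: "Y (Suc n) w = g n (Y n w) (Z n w)" for n w by (simp add: Y_def)
  have v: "0 \<le> ?v" by simp
  have sqY: "(\<integral>\<^sup>+w. ennreal ((Y n w)\<^sup>2) \<partial>M) \<le> ennreal (real n * ?v)" for n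
  proof (induction n)
    case (Suc n)
    let ?\<phi> = "\<lambda>x. ennreal ((g n (fst x) (snd x))\<^sup>2)"
    have "(\<integral>\<^sup>+w. ennreal ((Y (Suc n) w)\<^sup>2) \<partial>M) = (\<integral>\<^sup>+w. ?\<phi> (Y n w, Z n w) \<partial>M)"
      by (simp add: Y_Suc)
    also have "\<dots> = (\<integral>\<^sup>+w. (\<integral>\<^sup>+w'. ?\<phi> (Y n w, Z 0 w') \<partial>M) \<partial>M)"
      unfolding Y_def by (rule nn_integral_chain[OF g]) (use g in measurable)
    also have "\<dots> \<le> (\<integral>\<^sup>+w. ennreal ((Y n w)\<^sup>2) + ennreal ?v \<partial>M)"
    proof (rule nn_integral_mono)
      fix w
      show "(\<integral>\<^sup>+w'. ?\<phi> (Y n w, Z 0 w') \<partial>M) \<le> ennreal ((Y n w)\<^sup>2) + ennreal ?v"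
        using nn_integral_square_shift[of "\<lambda>w. f (Z 0 w)" "Y n w"] sq mean
        by (cases "t \<le> \<bar>Y n w\<bar>") (auto simp: g_def emeasure_space_1)
    qed
    also have "\<dots> = (\<integral>\<^sup>+w. ennreal ((Y n w)\<^sup>2) \<partial>M) + ennreal ?v"
      by (subst nn_integral_add) (auto simp: emeasure_space_1)
    also have "\<dots> \<le> ennreal (real n * ?v) + ennreal ?v" using Suc by (rule add_right_mono)
    also have "\<dots> = ennreal (real (Suc n) * ?v)"
      using v by (subst ennreal_plus[symmetric]) (auto simp: algebra_simps)
    finally show ?case .
  qed (simp add: Y_def)
  have frozen: "(\<exists>k\<le>n. t \<le> \<bar>\<Sum>i<k. f (Z i w)\<bar>) \<longrightarrow> t \<le> \<bar>Y n w\<bar>" for n w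
  proof -
    have "(\<forall>k\<le>n. \<bar>\<Sum>i<k. f (Z i w)\<bar> < t) \<and> Y n w = (\<Sum>i<n. f (Z i w)) \<or> t \<le> \<bar>Y n w\<bar>"
    proof (induction n)
      case 0
      then show ?case using t by (simp add: Y_def)
    next
      case (Suc n)
      then show ?case by (auto simp: Y_Suc g_def le_Suc_eq)
    qed
    then show ?thesis by (auto simp: not_le[symmetric])
  qed
  have "emeasure M {w \<in> space M. \<exists>k\<le>n. t \<le> \<bar>\<Sum>i<k. f (Z i w)\<bar>}
      \<le> emeasure M {w \<in> space M. 1 \<le> ennreal (1 / t\<^sup>2) * ennreal ((Y n w)\<^sup>2)}"
  proof (rule emeasure_mono)
    have "1 \<le> ennreal (1 / t\<^sup>2) * ennreal (y\<^sup>2)" if "t \<le> \<bar>y\<bar>" for y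
    proof -
      have "t\<^sup>2 \<le> y\<^sup>2" using that t by (simp add: abs_le_square_iff[symmetric])
      then have "ennreal 1 \<le> ennreal (1 / t\<^sup>2 * y\<^sup>2)" using t by (intro ennreal_leI) (simp add: field_simps)
      then show ?thesis by (subst (asm) ennreal_mult') auto
    qed
    then show "{w \<in> space M. \<exists>k\<le>n. t \<le> \<bar>\<Sum>i<k. f (Z i w)\<bar>}
        \<subseteq> {w \<in> space M. 1 \<le> ennreal (1 / t\<^sup>2) * ennreal ((Y n w)\<^sup>2)}" using frozen by blast
  qed measurable
  also have "\<dots> \<le> ennreal (1 / t\<^sup>2) * (\<integral>\<^sup>+w. ennreal ((Y n w)\<^sup>2) * indicator (space M) w \<partial>M)"
    by (rule nn_integral_Markov_inequality) auto
  also have "\<dots> = ennreal (1 / t\<^sup>2) * (\<integral>\<^sup>+w. ennreal ((Y n w)\<^sup>2) \<partial>M)"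
    by (intro arg_cong2[where f = times] nn_integral_cong) auto
  also have "\<dots> \<le> ennreal (1 / t\<^sup>2) * ennreal (real n * ?v)" by (intro mult_left_mono sqY) simp
  also have "\<dots> = ennreal (real n * ?v / t\<^sup>2)" using ennreal_mult'[of "1 / t\<^sup>2" "real n * ?v"] by simp
  finally show ?thesis using v by (simp add: emeasure_eq_measure)
qed

lemma (in prob_space) prob_gt_tendsto_0:
  fixes L :: "'a \<Rightarrow> real"
  assumes [measurable]: "L \<in> borel_measurable M"
  shows "(\<lambda>k::nat. prob {w \<in> space M. L w > real k}) \<longlonglongrightarrow> 0"
proof -
  have "(\<lambda>k::nat. prob {w \<in> space M. L w > real k}) \<longlonglongrightarrow> prob (\<Inter>k. {w \<in> space M. L w > real k})"
    by (rule finite_Lim_measure_decseq) (auto simp: decseq_def)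
  moreover have "(\<Inter>k. {w \<in> space M. L w > real k}) = {}"
    using real_arch_simple by (auto simp: not_le[symmetric])
  ultimately show ?thesis by simp
qed

lemma std_normal_cdf_pos: "0 < cdf std_normal_distribution x"
proof -
  have "emeasure std_normal_distribution {..x} \<noteq> 0"
  proof
    assume "emeasure std_normal_distribution {..x} = 0"
    then have "(\<integral>\<^sup>+y. ennreal (std_normal_density y) * indicator {..x} y \<partial>lborel) = 0"
      by (simp add: emeasure_density)
    then have "AE y in lborel. ennreal (std_normal_density y) * indicator {..x} y = 0"
      by (subst (asm) nn_integral_0_iff_AE) auto
    then have "AE y in lborel. y \<notin> {..x}"
      by eventually_elim (auto simp: indicator_def std_normal_density_def split: if_splits)
    then have "emeasure lborel {..x} = 0" by (subst (asm) AE_iff_null) (auto simp: null_sets_def atMost_def)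
    moreover have "emeasure lborel {x-1..x} \<le> emeasure lborel {..x}" by (rule emeasure_mono) auto
    ultimately show False by simp
  qed
  interpret prob_space std_normal_distribution by (rule prob_space_normal_density) simp
  show ?thesis using \<open>emeasure std_normal_distribution {..x} \<noteq> 0\<close> unfolding cdf_def by (simp add: emeasure_eq_measure zero_less_measure_iff)
qed


lemma std_normal_isCont_cdf: "isCont (cdf std_normal_distribution) x"
proof -
  interpret prob_space std_normal_distribution by (rule prob_space_normal_density) simp
  interpret real_distribution std_normal_distribution by unfold_locales auto
  have "emeasure std_normal_distribution {x} = (\<integral>\<^sup>+y. ennreal (std_normal_density y) * indicator {x} y \<partial>lborel)"
    by (rule emeasure_density) auto
  also have "\<dots> = 0" by (rule nn_integral_null_set) (auto simp: null_sets_def)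
  finally show ?thesis by (simp add: isCont_cdf emeasure_eq_measure)
qed

text \<open>An input consists of the log-increment and the number of cookies of one site. The moment
  is imposed on \<open>B * exp (- X)\<close> because this number, divided by \<open>Q\<close>, is
  what enters the increment of \<open>lnH\<close> in \<open>lnH_Suc\<close>.\<close>

locale critical_recursion = iid_sequence M "borel \<Otimes>\<^sub>M borel" Z
  for M :: "'a measure" and Z :: "nat \<Rightarrow> 'a \<Rightarrow> real \<times> real" +
  fixes q :: real
  assumes B_nonneg: "\<And>n w. 0 \<le> snd (Z n w)"
    and X_sq: "integrable M (\<lambda>w. (fst (Z 0 w))\<^sup>2)"
    and X_mean: "expectation (\<lambda>w. fst (Z 0 w)) = 0"
    and X_var: "0 < expectation (\<lambda>w. (fst (Z 0 w))\<^sup>2)"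
    and q: "2 < q"
    and B_moment: "integrable M (\<lambda>w. ln (1 + snd (Z 0 w) * exp (- fst (Z 0 w))) powr q)"
begin

abbreviation X where "X n w \<equiv> fst (Z n w)"
abbreviation B where "B n w \<equiv> snd (Z n w)"
abbreviation \<sigma>2 where "\<sigma>2 \<equiv> expectation (\<lambda>w. (X 0 w)\<^sup>2)"

lemma X_int: "integrable M (X 0)"
  by (rule square_integrable_imp_integrable[OF _ X_sq]) simp

text \<open>\<open>W k n\<close> is the height of the random walk above its running minimum since time \<open>k\<close>.\<close>

definition wstep :: "nat \<Rightarrow> nat \<Rightarrow> real \<Rightarrow> real \<times> real \<Rightarrow> real" where
  "wstep k n y z = (if n < k then 0 else max (y + fst z) 0)"

definition W :: "nat \<Rightarrow> nat \<Rightarrow> 'a \<Rightarrow> real" where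
  "W k n w = chain (wstep k) 0 (\<lambda>i. Z i w) n"

lemma W_Suc: "W k (Suc n) w = wstep k n (W k n w) (Z n w)"
  by (simp add: W_def)

lemma W_nonneg: "0 \<le> W k n w"
  by (cases n) (auto simp: W_def wstep_def)

lemma W_start: "W k k w = 0"
  by (cases k) (auto simp: W_def wstep_def)

lemma wstep_measurable: "(\<lambda>x. wstep k n (fst x) (snd x)) \<in> borel \<Otimes>\<^sub>M (borel \<Otimes>\<^sub>M borel) \<rightarrow>\<^sub>M borel"
  unfolding wstep_def by measurable

lemma W_measurable [measurable]: "W k n \<in> borel_measurable M"
  unfolding W_def[abs_def] by (rule chain_measurable[OF wstep_measurable]) auto

lemma nn_integral_W:
  assumes "\<phi> \<in> borel_measurable (borel \<Otimes>\<^sub>M (borel \<Otimes>\<^sub>M borel))"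
  shows "(\<integral>\<^sup>+w. \<phi> (W k n w, Z n w) \<partial>M) = (\<integral>\<^sup>+w. (\<integral>\<^sup>+w'. \<phi> (W k n w, Z 0 w') \<partial>M) \<partial>M)"
  unfolding W_def by (rule nn_integral_chain[OF wstep_measurable _ assms]) simp

text \<open>Clipping at 0 can only decrease the square, so the second moment grows by at most
  \<open>\<sigma>2\<close> per step.\<close>

lemma W_square: "(\<integral>\<^sup>+w. ennreal ((W k n w)\<^sup>2) \<partial>M) \<le> ennreal (real n * \<sigma>2)"
proof (induction n)
  case 0
  then show ?case by (simp add: W_def)
next
  case (Suc n)
  let ?\<phi> = "\<lambda>x. ennreal ((fst x + fst (snd x))\<^sup>2)"
  have "(\<integral>\<^sup>+w. ennreal ((W k (Suc n) w)\<^sup>2) \<partial>M) \<le> (\<integral>\<^sup>+w. ?\<phi> (W k n w, Z n w) \<partial>M)"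
    by (intro nn_integral_mono ennreal_leI)
       (auto simp: W_Suc wstep_def max_def)
  also have "\<dots> = (\<integral>\<^sup>+w. (\<integral>\<^sup>+w'. ?\<phi> (W k n w, Z 0 w') \<partial>M) \<partial>M)"
    by (rule nn_integral_W) simp
  also have "\<dots> = (\<integral>\<^sup>+w. ennreal ((W k n w)\<^sup>2) + ennreal \<sigma>2 \<partial>M)"
    using X_var by (simp add: nn_integral_square_shift X_sq X_mean)
  also have "\<dots> = (\<integral>\<^sup>+w. ennreal ((W k n w)\<^sup>2) \<partial>M) + ennreal \<sigma>2"
    by (subst nn_integral_add) (auto simp: emeasure_space_1)
  also have "\<dots> \<le> ennreal (real n * \<sigma>2) + ennreal \<sigma>2" using Suc by (rule add_right_mono)
  also have "\<dots> = ennreal (real (Suc n) * \<sigma>2)"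
    using X_var by (subst ennreal_plus[symmetric]) (auto simp: algebra_simps)
  finally show ?case .
qed

lemma W_mean:
  assumes "1 \<le> n"
  shows "(\<integral>\<^sup>+w. ennreal (W k n w) \<partial>M) \<le> ennreal ((\<sigma>2 + 1) * sqrt (real n))"
proof -
  let ?r = "sqrt (real n)"
  have r: "0 < ?r" "?r * ?r = real n" using assms by auto
  \<comment> \<open>Splitting at the threshold \<open>sqrt n\<close> takes the place of the
    Cauchy-Schwarz inequality.\<close>
  have "y \<le> (1 / ?r) * y\<^sup>2 + ?r" if "0 \<le> y" for y
  proof (cases "y \<le> ?r")
    case True
    moreover have "0 \<le> (1 / ?r) * y\<^sup>2" by simp
    ultimately show ?thesis by linarith
  next
    case False
    then have "?r * y \<le> y * y" using that by (intro mult_right_mono) auto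
    then show ?thesis using r that by (simp add: field_simps power2_eq_square)
  qed
  then have "(\<integral>\<^sup>+w. ennreal (W k n w) \<partial>M) \<le> (\<integral>\<^sup>+w. ennreal (1 / ?r) * ennreal ((W k n w)\<^sup>2) + ennreal ?r \<partial>M)"
    using r by (intro nn_integral_mono) (auto simp: ennreal_mult'[symmetric] ennreal_plus[symmetric] W_nonneg simp del: ennreal_plus intro!: ennreal_leI)
  also have "\<dots> = ennreal (1 / ?r) * (\<integral>\<^sup>+w. ennreal ((W k n w)\<^sup>2) \<partial>M) + ennreal ?r"
    by (simp add: nn_integral_add nn_integral_cmult emeasure_space_1)
  also have "\<dots> \<le> ennreal (1 / ?r) * ennreal (real n * \<sigma>2) + ennreal ?r"
    by (intro add_mono mult_left_mono W_square) auto
  also have "\<dots> = ennreal ((\<sigma>2 + 1) * ?r)"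
  proof -
    have "1 / ?r * (real n * \<sigma>2) + ?r = (\<sigma>2 + 1) * ?r"
      using r by (simp add: field_simps)
    moreover have "0 \<le> 1 / ?r * (real n * \<sigma>2)" using X_var r by auto
    ultimately show ?thesis using r
      by (simp add: ennreal_mult'[symmetric] ennreal_plus[symmetric] del: ennreal_plus)
  qed
  finally show ?thesis .
qed

text \<open>For a centred variable the mean positive part is half of the mean absolute value, that
  is \<open>2 * \<mu>\<close>; a shift by at most \<open>\<mu>\<close> then still leaves a gap of
  \<open>\<mu>\<close>. The same number is the mesh of the height cells in
  \<open>drop_bound\<close>.\<close>

definition \<mu> where "\<mu> = expectation (\<lambda>w. \<bar>X 0 w\<bar>) / 4"

lemma \<mu>_pos: "0 < \<mu>"
proof -
  have "expectation (\<lambda>w. \<bar>X 0 w\<bar>) \<noteq> 0"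
  proof
    assume "expectation (\<lambda>w. \<bar>X 0 w\<bar>) = 0"
    then have "AE w in M. \<bar>X 0 w\<bar> = 0"
      using X_int by (subst (asm) integral_nonneg_eq_0_iff_AE) auto
    then have "AE w in M. (X 0 w)\<^sup>2 = 0" by eventually_elim auto
    then have "\<sigma>2 = 0" by (subst integral_cong_AE[where g = "\<lambda>_. 0"]) auto
    then show False using X_var by simp
  qed
  then show ?thesis unfolding \<mu>_def by (simp add: order.not_eq_order_implies_strict)
qed

text \<open>The positive part is convex with a kink at \<^term>\<open>0\<close>, so near the kink Jensen's inequality
  has a uniform gap.\<close>

lemma positive_part_gap:
  "ennreal (max u 0) + ennreal \<mu> * of_bool (\<bar>u\<bar> \<le> \<mu>) \<le> (\<integral>\<^sup>+w. ennreal (max (u + X 0 w) 0) \<partial>M)"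
proof -
  have absint: "integrable M (\<lambda>w. \<bar>X 0 w\<bar>)" using X_int by auto
  have int: "integrable M (\<lambda>w. max (u + X 0 w) 0)" using X_int by auto
  have E: "expectation (\<lambda>w. \<bar>X 0 w\<bar>) = 4 * \<mu>" by (simp add: \<mu>_def)
  have half: "expectation (\<lambda>w. (\<bar>X 0 w\<bar> + c * X 0 w) / 2 + d) = 2 * \<mu> + d" for c d
    using absint X_int X_mean E by (simp add: prob_space add_divide_distrib)
  have iH: "integrable M (\<lambda>w. (\<bar>X 0 w\<bar> + c * X 0 w) / 2 + d)" for c d using absint X_int by auto
  let ?e = "expectation (\<lambda>w. max (u + X 0 w) 0)"
  have "max u 0 + \<mu> * of_bool (\<bar>u\<bar> \<le> \<mu>) \<le> ?e"
  proof (cases "\<bar>u\<bar> \<le> \<mu>")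
    case True
    show ?thesis
    proof (cases "0 \<le> u")
      case u: True
      have "2 * \<mu> + 0 \<le> ?e"
        unfolding half[of 1 0, symmetric] using u by (intro integral_mono iH int) (auto simp: max_def abs_if)
      moreover have "u \<le> \<mu>" using True by auto
      ultimately show ?thesis using True u by simp
    next
      case u: False
      have "2 * \<mu> + (- \<mu>) \<le> ?e"
        unfolding half[of 1 "- \<mu>", symmetric] using u True by (intro integral_mono iH int) (auto simp: max_def abs_if)
      then show ?thesis using True u by simp
    qed
  next
    case False
    have "0 \<le> ?e" by simp
    moreover have "expectation (\<lambda>w. u + X 0 w) \<le> ?e"
      using X_int by (intro integral_mono int) auto
    then have "u \<le> ?e" using X_int X_mean by (simp add: prob_space)
    ultimately show ?thesis using False by simp
  qed
  then have "ennreal (max u 0 + \<mu> * of_bool (\<bar>u\<bar> \<le> \<mu>)) \<le> ennreal ?e" by (rule ennreal_leI)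
  moreover have "ennreal (max u 0 + \<mu> * of_bool (\<bar>u\<bar> \<le> \<mu>)) = ennreal (max u 0) + ennreal \<mu> * of_bool (\<bar>u\<bar> \<le> \<mu>)"
    using \<mu>_pos by (cases "\<bar>u\<bar> \<le> \<mu>") auto
  ultimately show ?thesis using int by (subst nn_integral_eq_integral) auto
qed

definition occ :: "nat \<Rightarrow> nat \<Rightarrow> real \<Rightarrow> ennreal" where
  "occ k n c = (\<integral>\<^sup>+w. of_bool (\<bar>W k n w - c\<bar> \<le> \<mu>) \<partial>M)"

text \<open>A discrete Tanaka formula: by \<open>positive_part_gap\<close> the mean of
  \<open>max (W - c) 0\<close> gains at least \<open>\<mu>\<close> times the probability of being
  within \<open>\<mu>\<close> of \<open>c\<close>. As \<open>c\<close> is nonnegative, reflection at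
  0 does not change this positive part.\<close>

lemma local_time:
  assumes c: "0 \<le> c" and n: "k \<le> n"
  shows "ennreal \<mu> * (\<Sum>i\<in>{k..<n}. occ k i c) \<le> (\<integral>\<^sup>+w. ennreal (max (W k n w - c) 0) \<partial>M)"
  using n
proof (induction n rule: dec_induct)
  case (step n)
  let ?\<phi> = "\<lambda>x. ennreal (max (fst x - c + fst (snd x)) 0)"
  have "ennreal \<mu> * (\<Sum>i\<in>{k..<Suc n}. occ k i c)
      \<le> (\<integral>\<^sup>+w. ennreal (max (W k n w - c) 0) \<partial>M) + ennreal \<mu> * occ k n c"
    using step by (simp add: distrib_left add_mono)
  also have "\<dots> = (\<integral>\<^sup>+w. ennreal (max (W k n w - c) 0) + ennreal \<mu> * of_bool (\<bar>W k n w - c\<bar> \<le> \<mu>) \<partial>M)"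
    unfolding occ_def by (subst nn_integral_add) (auto simp: nn_integral_cmult)
  also have "\<dots> \<le> (\<integral>\<^sup>+w. (\<integral>\<^sup>+w'. ?\<phi> (W k n w, Z 0 w') \<partial>M) \<partial>M)"
    unfolding fst_conv snd_conv by (intro nn_integral_mono positive_part_gap)
  also have "\<dots> = (\<integral>\<^sup>+w. ?\<phi> (W k n w, Z n w) \<partial>M)"
    by (rule nn_integral_W[symmetric]) simp
  also have "\<dots> = (\<integral>\<^sup>+w. ennreal (max (W k (Suc n) w - c) 0) \<partial>M)"
    using step.hyps c by (intro nn_integral_cong arg_cong[where f = ennreal]) (auto simp: W_Suc wstep_def)
  finally show ?case .
qed simp

text \<open>Uniformity in the level \<open>c\<close> is essential: it permits the sum over all
  levels in \<open>drop_bound\<close>.\<close>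

lemma occupation_bound:
  assumes "0 \<le> c" "k \<le> n" "1 \<le> n"
  shows "(\<Sum>i\<in>{k..<n}. occ k i c) \<le> ennreal ((\<sigma>2 + 1) / \<mu> * sqrt (real n))"
proof -
  have "ennreal \<mu> * (\<Sum>i\<in>{k..<n}. occ k i c) \<le> (\<integral>\<^sup>+w. ennreal (max (W k n w - c) 0) \<partial>M)"
    by (rule local_time) fact+
  also have "\<dots> \<le> (\<integral>\<^sup>+w. ennreal (W k n w) \<partial>M)"
    using assms(1) by (intro nn_integral_mono ennreal_leI) (auto simp: W_nonneg)
  also have "\<dots> \<le> ennreal ((\<sigma>2 + 1) * sqrt (real n))" by (rule W_mean) fact
  finally have "ennreal (1 / \<mu>) * (ennreal \<mu> * (\<Sum>i\<in>{k..<n}. occ k i c))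
      \<le> ennreal (1 / \<mu>) * ennreal ((\<sigma>2 + 1) * sqrt (real n))" by (rule mult_left_mono) simp
  then show ?thesis using \<mu>_pos
    by (simp add: mult.assoc[symmetric] ennreal_mult'[symmetric])
qed

text \<open>The mean increment of \<open>lnH\<close> at a time when \<open>Q\<close> equals
  \<open>exp (j * \<mu>)\<close>.\<close>

definition e :: "nat \<Rightarrow> ennreal" where
  "e j = (\<integral>\<^sup>+w. ennreal (ln (1 + B 0 w * exp (- X 0 w) * exp (- (real j * \<mu>)))) \<partial>M)"

text \<open>With \<open>t = j * \<mu> / 2\<close>, values \<open>v \<le> exp t\<close> contribute at
  most \<open>exp (- t)\<close>. For larger \<open>v\<close> the logarithm
  \<open>L = ln (1 + v)\<close> is at least \<open>t\<close>, so
  \<open>L \<le> L powr q * t powr (1 - q)\<close>, and the exponent \<open>1 - q\<close> is below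
  -1.\<close>

lemma e_summable: "(\<Sum>j. e j) < \<infinity>"
proof -
  let ?l = "\<lambda>w. ln (1 + B 0 w * exp (- X 0 w))"
  let ?m = "expectation (\<lambda>w. ?l w powr q)"
  define g where "g j = exp (- (\<mu> / 2)) ^ j + ?m * (real j * \<mu> / 2) powr (1 - q)" for j
  have m: "0 \<le> ?m" by simp
  have bound: "e j \<le> ennreal (g j)" if j: "1 \<le> j" for j
  proof -
    let ?t = "real j * \<mu> / 2"
    have t: "0 < ?t" using j \<mu>_pos by simp
    have pt: "ln (1 + v * exp (- (real j * \<mu>))) \<le> exp (- ?t) + ln (1 + v) powr q * ?t powr (1 - q)"
      if v: "0 \<le> v" for v
    proof (cases "v \<le> exp ?t")
      case True
      have "ln (1 + v * exp (- (real j * \<mu>))) \<le> v * exp (- (real j * \<mu>))"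
        using v by (intro ln_add_one_self_le_self) auto
      also have "\<dots> \<le> exp ?t * exp (- (real j * \<mu>))" using True by (intro mult_right_mono) auto
      also have "\<dots> = exp (- ?t)" by (simp add: exp_add[symmetric])
      finally show ?thesis by (simp add: add_increasing2)
    next
      case False
      let ?L = "ln (1 + v)"
      have "?t = ln (exp ?t)" by simp
      also have "\<dots> \<le> ?L" using False by (subst ln_le_cancel_iff) (auto intro: add_pos_nonneg v)
      finally have tL: "?t \<le> ?L" .
      have "ln (1 + v * exp (- (real j * \<mu>))) \<le> ?L"
      proof -
        have "v * exp (- (real j * \<mu>)) \<le> v * 1" using v \<mu>_pos by (intro mult_left_mono) auto
        then show ?thesis using v by (subst ln_le_cancel_iff) (auto intro!: add_pos_nonneg)
      qed
      also have "?L = ?L powr q * ?L powr (1 - q)"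
        using tL t by (simp add: powr_add[symmetric])
      also have "\<dots> \<le> ?L powr q * ?t powr (1 - q)"
        using tL t q by (intro mult_left_mono powr_mono2') auto
      finally show ?thesis by (simp add: add_increasing)
    qed
    have "e j \<le> (\<integral>\<^sup>+w. ennreal (exp (- ?t) + ?l w powr q * ?t powr (1 - q)) \<partial>M)"
      unfolding e_def by (intro nn_integral_mono ennreal_leI pt) (auto simp: B_nonneg)
    also have "\<dots> = ennreal (expectation (\<lambda>w. exp (- ?t) + ?l w powr q * ?t powr (1 - q)))"
      using B_moment by (intro nn_integral_eq_integral) auto
    also have "expectation (\<lambda>w. exp (- ?t) + ?l w powr q * ?t powr (1 - q)) = g j"
      using B_moment by (simp add: g_def prob_space exp_of_nat_mult[symmetric] mult.commute)
    finally show ?thesis .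
  qed
  have "summable g"
  proof -
    have "summable (\<lambda>j. exp (- (\<mu> / 2)) ^ j)" using \<mu>_pos by (intro summable_geometric) auto
    moreover have "summable (\<lambda>j. (?m * (\<mu> / 2) powr (1 - q)) * real j powr (1 - q))"
      using q by (intro summable_mult) (simp add: summable_real_powr_iff)
    moreover have "(?m * (\<mu> / 2) powr (1 - q)) * real j powr (1 - q) = ?m * (real j * \<mu> / 2) powr (1 - q)" for j
      using \<mu>_pos powr_mult[of "real j" "\<mu> / 2" "1 - q"] by simp
    ultimately show ?thesis unfolding g_def by (intro summable_add) auto
  qed
  moreover have g0: "0 \<le> g j" for j unfolding g_def by (intro add_nonneg_nonneg mult_nonneg_nonneg m) auto
  ultimately have fin: "(\<Sum>j. ennreal (g (Suc j))) < \<infinity>"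
    by (subst suminf_ennreal2) (auto simp: summable_Suc_iff)
  have e0: "e 0 < \<infinity>"
  proof -
    have le: "ln (1 + v) \<le> 1 + ln (1 + v) powr q" if "0 \<le> v" for v :: real
    proof (cases "ln (1 + v) \<le> 1")
      case False
      then have "ln (1 + v) powr 1 \<le> ln (1 + v) powr q" using q by (intro powr_mono) auto
      then show ?thesis using False by simp
    qed (simp add: add_increasing2)
    have "e 0 \<le> (\<integral>\<^sup>+w. ennreal (1 + ?l w powr q) \<partial>M)"
      unfolding e_def by (intro nn_integral_mono ennreal_leI) (auto simp: B_nonneg intro!: le)
    also have "\<dots> = ennreal (expectation (\<lambda>w. 1 + ?l w powr q))"
      using B_moment by (intro nn_integral_eq_integral) auto
    finally show ?thesis by (simp add: le_less_trans)
  qed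
  have "(\<Sum>j. e j) = e 0 + (\<Sum>j. e (Suc j))"
    using suminf_offset[of e 1] by simp
  also have "\<dots> \<le> e 0 + (\<Sum>j. ennreal (g (Suc j)))"
    by (intro add_left_mono suminf_le bound) auto
  also have "\<dots> < \<infinity>" using e0 fin by (simp add: ennreal_add_less_top)
  finally show ?thesis .
qed

text \<open>Times are sorted by the cell of width \<open>\<mu>\<close> that contains the height
  \<open>W\<close>. The input at time \<open>i\<close> is independent of that height, so cell
  \<open>j\<close> contributes its expected occupation, at most a constant times
  \<open>sqrt n\<close>, times \<open>e (j + J)\<close>. The offset \<open>J\<close> stands for the
  level above which \<open>Q\<close> is assumed to stay.\<close>

lemma drop_bound:
  assumes "k \<le> n" "1 \<le> n"
  shows "(\<integral>\<^sup>+w. ennreal (\<Sum>i\<in>{k..<n}. ln (1 + B i w * exp (- X i w) * exp (- (real J * \<mu>)) * exp (- W k i w))) \<partial>M)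
    \<le> ennreal ((\<sigma>2 + 1) / \<mu> * sqrt (real n)) * (\<Sum>j. e (j + J))"
proof -
  let ?v = "\<lambda>i w. B i w * exp (- X i w)"
  let ?d = "\<lambda>i w. ln (1 + ?v i w * exp (- (real J * \<mu>)) * exp (- W k i w))"
  have v0: "0 \<le> ?v i w" for i w by (simp add: B_nonneg)
  have single: "(\<integral>\<^sup>+w. ennreal (?d i w) \<partial>M)
     \<le> (\<Sum>j. occ k i (real j * \<mu>) * e (j + J))" for i
  proof -
    let ?\<phi> = "\<lambda>j x. of_bool (\<bar>fst x - real j * \<mu>\<bar> \<le> \<mu>) *
        ennreal (ln (1 + snd (snd x) * exp (- fst (snd x)) * exp (- (real (j + J) * \<mu>))))"
    have "(\<integral>\<^sup>+w. ennreal (?d i w) \<partial>M)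
      \<le> (\<integral>\<^sup>+w. (\<Sum>j. ?\<phi> j (W k i w, Z i w)) \<partial>M)"
    proof (rule nn_integral_mono)
      fix w
      define j where "j = nat \<lfloor>W k i w / \<mu>\<rfloor>"
      have "0 \<le> W k i w / \<mu>" using W_nonneg \<mu>_pos by simp
      then have "real j \<le> W k i w / \<mu>" "W k i w / \<mu> < real j + 1" unfolding j_def by linarith+
      then have j: "real j * \<mu> \<le> W k i w" "W k i w < real j * \<mu> + \<mu>"
        using \<mu>_pos by (auto simp: field_simps)
      have "?v i w * exp (- (real J * \<mu>)) * exp (- W k i w) \<le> ?v i w * exp (- (real (j + J) * \<mu>))"
      proof -
        have "exp (- (real J * \<mu>)) * exp (- W k i w) \<le> exp (- (real (j + J) * \<mu>))"
          using j unfolding exp_add[symmetric] by (simp add: algebra_simps)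
        from mult_left_mono[OF this v0[of i w]] show ?thesis by (simp only: mult.assoc)
      qed
      then have "?d i w
         \<le> ln (1 + ?v i w * exp (- (real (j + J) * \<mu>)))"
        using v0[of i w] by (subst ln_le_cancel_iff) (auto intro!: add_pos_nonneg mult_nonneg_nonneg)
      moreover have "\<bar>W k i w - real j * \<mu>\<bar> \<le> \<mu>" using j by auto
      ultimately have "ennreal (?d i w)
         \<le> ?\<phi> j (W k i w, Z i w)"
        by (simp add: ennreal_leI)
      also have "\<dots> \<le> (\<Sum>j. ?\<phi> j (W k i w, Z i w))"
        by (rule ennreal_le_suminf)
      finally show "ennreal (?d i w)
        \<le> (\<Sum>j. ?\<phi> j (W k i w, Z i w))" .
    qed
    also have "\<dots> = (\<Sum>j. \<integral>\<^sup>+w. ?\<phi> j (W k i w, Z i w) \<partial>M)"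
      by (rule nn_integral_suminf) simp
    also have "\<dots> = (\<Sum>j. \<integral>\<^sup>+w. (\<integral>\<^sup>+w'. ?\<phi> j (W k i w, Z 0 w') \<partial>M) \<partial>M)"
      by (intro suminf_cong nn_integral_W) simp
    also have "\<dots> = (\<Sum>j. occ k i (real j * \<mu>) * e (j + J))"
      unfolding occ_def e_def
      by (intro suminf_cong) (simp add: nn_integral_cmult nn_integral_multc)
    finally show ?thesis .
  qed
  have "(\<integral>\<^sup>+w. ennreal (\<Sum>i\<in>{k..<n}. ?d i w) \<partial>M)
    = (\<integral>\<^sup>+w. (\<Sum>i\<in>{k..<n}. ennreal (?d i w)) \<partial>M)"
    using v0 by (intro nn_integral_cong sum_ennreal[symmetric]) auto
  also have "\<dots> = (\<Sum>i\<in>{k..<n}. \<integral>\<^sup>+w. ennreal (?d i w) \<partial>M)"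
    by (rule nn_integral_sum) simp
  also have "\<dots> \<le> (\<Sum>i\<in>{k..<n}. \<Sum>j. occ k i (real j * \<mu>) * e (j + J))"
    by (intro sum_mono single)
  also have "\<dots> = (\<Sum>j. \<Sum>i\<in>{k..<n}. occ k i (real j * \<mu>) * e (j + J))"
    by (rule suminf_sum[symmetric]) auto
  also have "\<dots> \<le> (\<Sum>j. ennreal ((\<sigma>2 + 1) / \<mu> * sqrt (real n)) * e (j + J))"
  proof (rule suminf_le)
    fix j
    show "(\<Sum>i\<in>{k..<n}. occ k i (real j * \<mu>) * e (j + J)) \<le> ennreal ((\<sigma>2 + 1) / \<mu> * sqrt (real n)) * e (j + J)"
      unfolding sum_distrib_right[symmetric] using assms \<mu>_pos
      by (intro mult_right_mono occupation_bound) auto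
  qed auto
  also have "\<dots> = ennreal ((\<sigma>2 + 1) / \<mu> * sqrt (real n)) * (\<Sum>j. e (j + J))"
    by simp
  finally show ?thesis .
qed

section \<open>The affine recursion keeps returning to bounded values\<close>

definition qstep :: "nat \<Rightarrow> real \<Rightarrow> real \<times> real \<Rightarrow> real" where
  "qstep n x z = exp (fst z) * x + snd z"

definition Q :: "nat \<Rightarrow> 'a \<Rightarrow> real" where
  "Q n w = chain qstep 1 (\<lambda>i. Z i w) n"

lemma qstep_measurable: "(\<lambda>x. qstep n (fst x) (snd x)) \<in> borel \<Otimes>\<^sub>M (borel \<Otimes>\<^sub>M borel) \<rightarrow>\<^sub>M borel"
  unfolding qstep_def by measurable

lemma Q_measurable [measurable]: "Q n \<in> borel_measurable M"
  unfolding Q_def[abs_def] by (rule chain_measurable[OF qstep_measurable]) auto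

lemma Q_0: "Q 0 w = 1" and Q_Suc: "Q (Suc n) w = exp (X n w) * Q n w + B n w"
  by (simp_all add: Q_def qstep_def)

lemma Q_pos: "0 < Q n w"
  by (induction n) (auto simp: Q_0 Q_Suc B_nonneg intro!: add_pos_nonneg)

abbreviation S :: "nat \<Rightarrow> 'a \<Rightarrow> real" where "S n w \<equiv> (\<Sum>i<n. X i w)"
text \<open>The logarithm of \<open>1 + \<Sum>\<^sub>i\<^sub><\<^sub>n B\<^sub>i exp (- S\<^sub>i\<^sub>+\<^sub>1)\<close>.\<close>

definition lnH :: "nat \<Rightarrow> 'a \<Rightarrow> real" where "lnH n w = ln (Q n w) - S n w"

lemma lnH_measurable [measurable]: "lnH n \<in> borel_measurable M"
  unfolding lnH_def[abs_def] by measurable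

lemma lnH_Suc: "lnH (Suc n) w = lnH n w + ln (1 + B n w * exp (- X n w) / Q n w)"
proof -
  have *: "Q (Suc n) w = exp (X n w) * (Q n w * (1 + B n w * exp (- X n w) / Q n w))"
    using Q_pos[of n w] by (simp add: Q_Suc exp_minus field_simps)
  have "0 < 1 + B n w * exp (- X n w) / Q n w"
    using Q_pos[of n w] B_nonneg[of n w] by (intro add_pos_nonneg) auto
  then have "ln (Q (Suc n) w) = X n w + (ln (Q n w) + ln (1 + B n w * exp (- X n w) / Q n w))"
    unfolding * using Q_pos[of n w] by (simp add: ln_mult)
  then show ?thesis by (simp add: lnH_def)
qed

text \<open>The two bounds feed each other. \<open>lnH\<close> is nondecreasing and exceeds
  \<open>a - S i\<close> at every \<open>i\<close> from \<open>k\<close> to \<open>n\<close>, hence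
  also their maximum \<open>a + W - S\<close>. So \<open>Q\<close> is at least
  \<open>exp (a + W)\<close>, which limits the next increment of \<open>lnH\<close>.\<close>

lemma no_return_bound:
  assumes "k \<le> n" and big: "\<And>i. k \<le> i \<Longrightarrow> i \<le> n \<Longrightarrow> exp a < Q i w"
  shows "a + W k n w - S n w \<le> lnH n w \<and>
    lnH n w \<le> lnH k w + (\<Sum>i\<in>{k..<n}. ln (1 + B i w * exp (- X i w) * exp (- a) * exp (- W k i w)))"
  using assms
proof (induction n rule: dec_induct)
  case base
  have "a < ln (Q k w)" using base Q_pos by (metis exp_less_cancel_iff exp_ln order_refl)
  then show ?case by (simp add: W_start lnH_def)
next
  case (step n)
  have IH: "a + W k n w - S n w \<le> lnH n w"
    "lnH n w \<le> lnH k w + (\<Sum>i\<in>{k..<n}. ln (1 + B i w * exp (- X i w) * exp (- a) * exp (- W k i w)))"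
    using step by auto
  let ?v = "B n w * exp (- X n w)"
  have v: "0 \<le> ?v" by (simp add: B_nonneg)
  have q: "0 < Q n w" by (rule Q_pos)
  have mono: "lnH n w \<le> lnH (Suc n) w"
    unfolding lnH_Suc using v q by (simp add: divide_nonneg_pos)
  have "exp a < Q (Suc n) w" using step.prems[of "Suc n"] step.hyps by simp
  then have "a < ln (Q (Suc n) w)" using Q_pos by (metis exp_less_cancel_iff exp_ln)
  then have 1: "a + W k (Suc n) w - S (Suc n) w \<le> lnH (Suc n) w"
    using mono IH(1) step.hyps by (auto simp: W_Suc wstep_def max_def lnH_def)
  have "a + W k n w \<le> ln (Q n w)" using IH(1) by (simp add: lnH_def)
  then have "exp (a + W k n w) \<le> Q n w" using q by (metis exp_le_cancel_iff exp_ln)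
  then have "?v / Q n w \<le> ?v / exp (a + W k n w)" using v q by (intro divide_left_mono) auto
  also have "\<dots> = ?v * exp (- a) * exp (- W k n w)" by (simp add: exp_add exp_minus field_simps)
  finally have "ln (1 + ?v / Q n w) \<le> ln (1 + ?v * exp (- a) * exp (- W k n w))"
    using v q by (subst ln_le_cancel_iff) (auto intro!: add_pos_nonneg divide_nonneg_pos mult_nonneg_nonneg)
  then have 2: "lnH (Suc n) w \<le> lnH k w + (\<Sum>i\<in>{k..<Suc n}. ln (1 + B i w * exp (- X i w) * exp (- a) * exp (- W k i w)))"
    using IH(2) step.hyps lnH_Suc[of n w] by simp
  from 1 2 show ?case by blast
qed

text \<open>The central limit theorem at the point -1, where the normal distribution function is
  positive and continuous; half of its value serves as \<open>\<delta>\<close>.\<close>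

lemma clt_lower:
  "\<exists>\<delta>>0. \<exists>n0. \<forall>n\<ge>n0. \<delta> \<le> prob {w \<in> space M. S n w \<le> - sqrt (real n * \<sigma>2)}"
proof -
  have idX: "distr M borel (X n) = distr M borel (X 0)" for n
  proof -
    have "distr M borel (X n) = distr (distr M (borel \<Otimes>\<^sub>M borel) (Z n)) borel fst"
      by (subst distr_distr) (auto simp: comp_def)
    also have "\<dots> = distr M borel (X 0)" unfolding ident[of n] by (subst distr_distr) (auto simp: comp_def)
    finally show ?thesis .
  qed
  have int_id: "expectation (\<lambda>w. f (X n w)) = expectation (\<lambda>w. f (X 0 w))"
    "integrable M (\<lambda>w. f (X n w)) \<longleftrightarrow> integrable M (\<lambda>w. f (X 0 w))"
    if [measurable]: "f \<in> borel_measurable borel" for f :: "real \<Rightarrow> real" and n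
    using integral_distr[of "X n" M borel f] integral_distr[of "X 0" M borel f]
      integrable_distr_eq[of "X n" M borel f] integrable_distr_eq[of "X 0" M borel f]
    by (simp_all add: idX[of n])
  have mean: "expectation (X n) = 0" for n using int_id(1)[of "\<lambda>x. x" n] X_mean by simp
  have "weak_conv_m (\<lambda>n. distr M borel (\<lambda>w. S n w / sqrt (real n * (sqrt \<sigma>2)\<^sup>2))) std_normal_distribution"
  proof (rule central_limit_theorem_zero_mean)
    show "indep_vars (\<lambda>i. borel) X UNIV"
      by (rule indep_vars_compose2[OF indep]) simp
    show "0 < sqrt \<sigma>2" using X_var by simp
    show "variance (X n) = (sqrt \<sigma>2)\<^sup>2" for n
      using int_id(1)[of "\<lambda>x. x\<^sup>2" n] mean[of n] X_var by simp
    show "integrable M (\<lambda>w. (X n w)\<^sup>2)" for n using int_id(2)[of "\<lambda>x. x\<^sup>2" n] X_sq by simp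
  qed (use mean idX in auto)
  then have lim: "(\<lambda>n. cdf (distr M borel (\<lambda>w. S n w / sqrt (real n * \<sigma>2))) (-1))
      \<longlonglongrightarrow> cdf std_normal_distribution (-1)"
    using X_var unfolding weak_conv_m_def weak_conv_def
    by (auto simp: std_normal_isCont_cdf)
  let ?c = "cdf std_normal_distribution (-1)"
  have c: "0 < ?c" by (rule std_normal_cdf_pos)
  then have "\<forall>\<^sub>F n in sequentially. ?c / 2 < cdf (distr M borel (\<lambda>w. S n w / sqrt (real n * \<sigma>2))) (-1)"
    by (intro order_tendstoD(1)[OF lim]) simp
  then obtain n0 where n0: "\<And>n. n0 \<le> n \<Longrightarrow> ?c / 2 < cdf (distr M borel (\<lambda>w. S n w / sqrt (real n * \<sigma>2))) (-1)"
    unfolding eventually_sequentially by blast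
  have "?c / 2 \<le> prob {w \<in> space M. S n w \<le> - sqrt (real n * \<sigma>2)}" if n: "max n0 1 \<le> n" for n
  proof -
    have "0 < sqrt (real n * \<sigma>2)" using n X_var by simp
    then have "(\<lambda>w. S n w / sqrt (real n * \<sigma>2)) -` {..- 1} \<inter> space M
        = {w \<in> space M. S n w \<le> - sqrt (real n * \<sigma>2)}"
      by (auto simp: divide_le_eq)
    then have "cdf (distr M borel (\<lambda>w. S n w / sqrt (real n * \<sigma>2))) (-1)
        = prob {w \<in> space M. S n w \<le> - sqrt (real n * \<sigma>2)}"
      unfolding cdf_def by (subst measure_distr) auto
    then show ?thesis using n0[of n] n by simp
  qed
  with c show ?thesis by (intro exI[of _ "?c / 2"] conjI exI[of _ "max n0 1"]) auto
qed

text \<open>If \<open>Q\<close> stayed above \<open>exp a\<close> from time \<open>k\<close> on,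
  then on the event of \<open>clt_lower\<close> the value \<open>lnH n\<close> would be at least
  \<open>\<sigma> * sqrt n\<close>. But \<open>lnH k\<close> and the later growth \<open>D\<close>
  each account for at most half of this, and for \<open>D\<close> strictly less, outside two events
  of probability at most \<open>\<delta> / 4\<close>.\<close>

lemma small_values_prob:
  "\<exists>\<delta>>0. \<exists>K. \<forall>k. \<delta> \<le> prob {w \<in> space M. \<exists>n\<ge>k. Q n w \<le> K}"
proof -
  obtain \<delta> n0 where \<delta>: "0 < \<delta>" and n0: "\<And>n. n0 \<le> n \<Longrightarrow> \<delta> \<le> prob {w \<in> space M. S n w \<le> - sqrt (real n * \<sigma>2)}"
    using clt_lower by blast
  define \<sigma> where "\<sigma> = sqrt \<sigma>2"
  have \<sigma>: "0 < \<sigma>" using X_var by (simp add: \<sigma>_def)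
  define C where "C = (\<sigma>2 + 1) / \<mu>"
  have C: "0 < C" using X_var \<mu>_pos by (simp add: C_def add_pos_pos)
  \<comment> \<open>Solves
    \<open>C * sqrt n * \<eta> / (\<sigma> / 2 * sqrt n) = \<delta> / 4\<close>, the bound that
    Markov's inequality gives for \<open>D\<close>.\<close>
  define \<eta> where "\<eta> = \<delta> / 4 * (\<sigma> / 2) / C"
  have \<eta>: "0 < \<eta>" using \<delta> \<sigma> C by (simp add: \<eta>_def)
  have "\<exists>J. (\<Sum>j. e (j + J)) \<le> ennreal \<eta>"
  proof -
    have fin: "e j < \<infinity>" for j
      using ennreal_le_suminf[of e j] e_summable by (rule le_less_trans)
    define r where "r j = enn2real (e j)" for j
    have er: "e j = ennreal (r j)" for j using fin[of j] by (simp add: r_def)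
    have sr: "summable r"
      using e_summable unfolding er by (intro summable_suminf_not_top) (auto simp: r_def)
    have "(\<lambda>J. \<Sum>j. r (j + J)) \<longlonglongrightarrow> 0" by (rule suminf_exist_split2[OF sr])
    then have "\<forall>\<^sub>F J in sequentially. (\<Sum>j. r (j + J)) < \<eta>" using \<eta> by (rule order_tendstoD(2))
    then obtain J where "(\<Sum>j. r (j + J)) < \<eta>" by (auto simp: eventually_sequentially)
    moreover have "(\<Sum>j. e (j + J)) = ennreal (\<Sum>j. r (j + J))"
      unfolding er using sr summable_iff_shift[of r J] by (intro suminf_ennreal2) (auto simp: r_def)
    ultimately show ?thesis by (auto intro!: exI[of _ J] ennreal_leI)
  qed
  then obtain J where J: "(\<Sum>j. e (j + J)) \<le> ennreal \<eta>" by blast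
  define a where "a = real J * \<mu>"
  have "\<delta> / 2 \<le> prob {w \<in> space M. \<exists>n\<ge>k. Q n w \<le> exp a}" for k
  proof -
    have "\<forall>\<^sub>F j in sequentially. prob {w \<in> space M. lnH k w > real j} < \<delta> / 4"
      using \<delta> by (intro order_tendstoD(2)[OF prob_gt_tendsto_0]) auto
    then obtain j where j: "prob {w \<in> space M. lnH k w > real j} < \<delta> / 4" by (auto simp: eventually_sequentially)
    obtain l :: nat where l: "real j / (\<sigma> / 2) \<le> real l" using real_arch_simple by blast
    \<comment> \<open>The square of \<open>l\<close> makes \<open>\<sigma> / 2 * sqrt n\<close> at
      least \<open>j\<close>, the typical bound for \<open>lnH k\<close>.\<close>
    define n where "n = max (l\<^sup>2) (max (max n0 1) k)"
    have n: "k \<le> n" "n0 \<le> n" "1 \<le> n" "l\<^sup>2 \<le> n" by (auto simp: n_def)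
    have "real l = sqrt (real (l\<^sup>2))" by simp
    also have "\<dots> \<le> sqrt (real n)" using n(4) by (subst real_sqrt_le_iff) (simp only: of_nat_le_iff)
    finally have ln: "real j \<le> \<sigma> / 2 * sqrt (real n)" using l \<sigma>
      by (simp add: field_simps) (smt (verit) mult_left_mono)
    let ?t = "\<sigma> / 2 * sqrt (real n)"
    have t: "0 < ?t" using \<sigma> n by simp
    define D where "D w = (\<Sum>i\<in>{k..<n}. ln (1 + B i w * exp (- X i w) * exp (- a) * exp (- W k i w)))" for w
    have [measurable]: "D \<in> borel_measurable M" unfolding D_def[abs_def] by measurable
    let ?A = "{w \<in> space M. S n w \<le> - sqrt (real n * \<sigma>2)}"
    let ?H = "{w \<in> space M. lnH k w > real j}"
    let ?D = "{w \<in> space M. ?t \<le> D w}"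
    let ?G = "{w \<in> space M. \<exists>n\<ge>k. Q n w \<le> exp a}"
    have "?A \<subseteq> ?G \<union> (?H \<union> ?D)"
    proof (rule subsetI, rule ccontr)
      fix w assume A: "w \<in> ?A" and no: "w \<notin> ?G \<union> (?H \<union> ?D)"
      have "exp a < Q i w" if "k \<le> i" for i
        using no A that by (intro not_le_imp_less) blast
      from no_return_bound[OF n(1) this] have "a + W k n w - S n w \<le> lnH k w + D w" by (auto simp: D_def)
      moreover have "0 \<le> a" using \<mu>_pos by (simp add: a_def)
      moreover have "lnH k w \<le> real j" "D w < ?t" using no A by auto
      moreover have "S n w \<le> - (\<sigma> * sqrt (real n))" using A by (simp add: \<sigma>_def real_sqrt_mult mult.commute)
      ultimately show False using W_nonneg[of k n w] ln by simp
    qed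
    then have "prob ?A \<le> prob (?G \<union> (?H \<union> ?D))" by (rule finite_measure_mono) measurable
    also have "\<dots> \<le> prob ?G + prob (?H \<union> ?D)" by (rule measure_Un_le) measurable
    also have "prob (?H \<union> ?D) \<le> prob ?H + prob ?D" by (rule measure_Un_le) measurable
    finally have sum: "prob ?A \<le> prob ?G + (prob ?H + prob ?D)" by simp
    have "emeasure M ?D \<le> \<delta> / 4"
    proof -
      have "emeasure M ?D \<le> emeasure M {w \<in> space M. 1 \<le> ennreal (1 / ?t) * ennreal (D w)}"
      proof (rule emeasure_mono)
        have "1 \<le> ennreal (1 / ?t) * ennreal d" if "?t \<le> d" for d
        proof -
          have "1 \<le> 1 / ?t * d" using that t by (simp add: field_simps)
          then have "ennreal 1 \<le> ennreal (1 / ?t * d)" by (rule ennreal_leI)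
          then show ?thesis using t by (subst (asm) ennreal_mult') auto
        qed
        then show "?D \<subseteq> {w \<in> space M. 1 \<le> ennreal (1 / ?t) * ennreal (D w)}" by auto
      qed measurable
      also have "\<dots> \<le> ennreal (1 / ?t) * (\<integral>\<^sup>+w. ennreal (D w) * indicator (space M) w \<partial>M)"
        by (rule nn_integral_Markov_inequality) auto
      also have "\<dots> = ennreal (1 / ?t) * (\<integral>\<^sup>+w. ennreal (D w) \<partial>M)"
        by (intro arg_cong2[where f = times] nn_integral_cong) auto
      also have "\<dots> \<le> ennreal (1 / ?t) * (ennreal (C * sqrt (real n)) * ennreal \<eta>)"
      proof (rule mult_left_mono)
        have "(\<integral>\<^sup>+w. ennreal (D w) \<partial>M) \<le> ennreal (C * sqrt (real n)) * (\<Sum>j. e (j + J))"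
          unfolding D_def a_def C_def by (rule drop_bound) fact+
        also have "\<dots> \<le> ennreal (C * sqrt (real n)) * ennreal \<eta>" by (intro mult_left_mono J) simp
        finally show "(\<integral>\<^sup>+w. ennreal (D w) \<partial>M) \<le> ennreal (C * sqrt (real n)) * ennreal \<eta>" .
      qed simp
      also have "\<dots> = ennreal (1 / ?t * (C * sqrt (real n) * \<eta>))"
      proof -
        have h: "0 \<le> 1 / ?t" "0 \<le> C * sqrt (real n)" using t C by auto
        show ?thesis by (simp only: ennreal_mult'[OF h(1)] ennreal_mult'[OF h(2)])
      qed
      also have "1 / ?t * (C * sqrt (real n) * \<eta>) = \<delta> / 4" using t C \<sigma> n by (simp add: \<eta>_def field_simps)
      finally show ?thesis .
    qed
    then have "prob ?D \<le> \<delta> / 4" using \<delta> by (simp add: emeasure_eq_measure)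
    then show ?thesis using sum j n0[OF n(2)] by linarith
  qed
  then show ?thesis using \<delta> by (intro exI[of _ "\<delta> / 2"] conjI exI[of _ "exp a"]) auto
qed

text \<open>Decomposition by the first \<open>n \<ge> k\<close> with \<open>Q n w \<le> K\<close>.
  Whether \<open>n\<close> is that time is decided by the inputs before \<open>n\<close>, so
  \<open>Z n\<close> is independent of it.\<close>

lemma small_values_prob_and_next:
  assumes G [measurable]: "G \<in> sets (borel \<Otimes>\<^sub>M borel)"
  shows "prob {w \<in> space M. Z 0 w \<in> G} * prob {w \<in> space M. \<exists>n\<ge>k. Q n w \<le> K}
    \<le> prob {w \<in> space M. \<exists>n\<ge>k. Q n w \<le> K \<and> Z n w \<in> G}"
proof -
  let ?Q = "\<lambda>z n. chain qstep 1 z n"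
  define F where "F n z \<longleftrightarrow> k \<le> n \<and> ?Q z n \<le> K \<and> (\<forall>i\<in>{k..<n}. \<not> ?Q z i \<le> K)" for n z
  let ?Z = "\<lambda>w i. Z i w"
  have F_meas: "Measurable.pred (PiM {..<n} (\<lambda>_. borel \<Otimes>\<^sub>M borel)) (F n)" for n
  proof -
    have [measurable]: "(\<lambda>z. ?Q z i) \<in> borel_measurable (PiM {..<n} (\<lambda>_. borel \<Otimes>\<^sub>M borel))" if "i \<le> n" for i
      using that chain_measurable[OF qstep_measurable, of 1 i "\<lambda>i z. z i" "PiM {..<n} (\<lambda>_. borel \<Otimes>\<^sub>M borel)"]
      by auto
    have "Measurable.pred (PiM {..<n} (\<lambda>_. borel \<Otimes>\<^sub>M borel)) (\<lambda>z. \<forall>i\<in>{k..<n}. \<not> ?Q z i \<le> K)"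
      by (intro pred_intros_finite) auto
    then show ?thesis unfolding F_def[abs_def] by measurable
  qed
  have F_dep: "F n (restrict z {..<n}) = F n z" for n z
  proof -
    have "?Q (restrict z {..<n}) i = ?Q z i" if "i \<le> n" for i by (rule chain_cong) (use that in auto)
    then show ?thesis unfolding F_def by auto
  qed
  define A where "A n = {w \<in> space M. F n (?Z w)}" for n
  define A' where "A' n = {w \<in> space M. F n (?Z w) \<and> Z n w \<in> G}" for n
  have FQ: "F n (?Z w) \<longleftrightarrow> k \<le> n \<and> Q n w \<le> K \<and> (\<forall>i\<in>{k..<n}. \<not> Q i w \<le> K)" for n w
    by (simp add: F_def Q_def)
  have [measurable]: "A n \<in> sets M" "A' n \<in> sets M" for n
    unfolding A_def A'_def FQ by measurable
  have G0: "(\<integral>\<^sup>+w'. indicator G (Z 0 w') \<partial>M) = emeasure M {w \<in> space M. Z 0 w \<in> G}"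
  proof -
    have "{w \<in> space M. Z 0 w \<in> G} \<in> sets M" by measurable
    then have "emeasure M {w \<in> space M. Z 0 w \<in> G} = (\<integral>\<^sup>+w'. indicator {w \<in> space M. Z 0 w \<in> G} w' \<partial>M)"
      by (rule nn_integral_indicator[symmetric])
    also have "\<dots> = (\<integral>\<^sup>+w'. indicator G (Z 0 w') \<partial>M)"
      by (rule nn_integral_cong) (simp add: indicator_def)
    finally show ?thesis by (rule sym)
  qed
  have prod: "emeasure M (A' n) = emeasure M {w \<in> space M. Z 0 w \<in> G} * emeasure M (A n)" for n
  proof -
    let ?\<phi> = "\<lambda>x. of_bool (fst x) * indicator G (snd x) :: ennreal"
    have "emeasure M (A' n) = (\<integral>\<^sup>+w. ?\<phi> (F n (?Z w), Z n w) \<partial>M)"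
      unfolding nn_integral_indicator[OF \<open>A' n \<in> sets M\<close>, symmetric]
      by (auto simp: A'_def intro!: nn_integral_cong split: split_indicator)
    also have "\<dots> = (\<integral>\<^sup>+w. (\<integral>\<^sup>+w'. ?\<phi> (F n (?Z w), Z 0 w') \<partial>M) \<partial>M)"
      by (rule nn_integral_past[where S = "count_space UNIV", OF F_meas F_dep]) measurable
    also have "\<dots> = (\<integral>\<^sup>+w. emeasure M {w \<in> space M. Z 0 w \<in> G} * indicator (A n) w \<partial>M)"
    proof (rule nn_integral_cong)
      fix w assume "w \<in> space M"
      then show "(\<integral>\<^sup>+w'. ?\<phi> (F n (?Z w), Z 0 w') \<partial>M)
          = emeasure M {w \<in> space M. Z 0 w \<in> G} * indicator (A n) w"
        by (cases "F n (?Z w)") (simp_all add: A_def G0)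
    qed
    finally show ?thesis by (simp add: nn_integral_cmult_indicator)
  qed
  have dis: "disjoint_family A" "disjoint_family A'"
    unfolding disjoint_family_on_def A_def A'_def FQ
    by (fastforce simp: not_le elim: linorder_neqE_nat)+
  have UA: "(\<Union>n. A n) = {w \<in> space M. \<exists>n\<ge>k. Q n w \<le> K}"
  proof (intro equalityI subsetI)
    fix w assume y: "w \<in> {w \<in> space M. \<exists>n\<ge>k. Q n w \<le> K}"
    then have "\<exists>n. k \<le> n \<and> Q n w \<le> K" by blast
    then obtain n where "k \<le> n \<and> Q n w \<le> K" and least: "\<forall>i<n. \<not> (k \<le> i \<and> Q i w \<le> K)"
      using exists_least_iff[of "\<lambda>n. k \<le> n \<and> Q n w \<le> K"] by blast
    moreover have "\<forall>i\<in>{k..<n}. \<not> Q i w \<le> K" using least by auto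
    ultimately have "w \<in> A n" using y unfolding A_def FQ by blast
    then show "w \<in> (\<Union>n. A n)" by blast
  next
    fix w assume "w \<in> (\<Union>n. A n)"
    then show "w \<in> {w \<in> space M. \<exists>n\<ge>k. Q n w \<le> K}" unfolding A_def FQ by blast
  qed
  have "emeasure M {w \<in> space M. Z 0 w \<in> G} * emeasure M (\<Union>n. A n)
      = (\<Sum>n. emeasure M (A' n))"
    unfolding prod using dis(1) by (subst suminf_emeasure[symmetric]) auto
  also have "\<dots> = emeasure M (\<Union>n. A' n)" by (rule suminf_emeasure) (use dis(2) in auto)
  also have "\<dots> \<le> emeasure M {w \<in> space M. \<exists>n\<ge>k. Q n w \<le> K \<and> Z n w \<in> G}"
  proof (rule emeasure_mono)
    show "(\<Union>n. A' n) \<subseteq> {w \<in> space M. \<exists>n\<ge>k. Q n w \<le> K \<and> Z n w \<in> G}"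
      unfolding A'_def FQ by blast
  qed measurable
  finally show ?thesis unfolding UA
    by (simp add: emeasure_eq_measure ennreal_mult'[symmetric])
qed

lemma chain_qstep_Suc: "chain qstep x z (Suc n) = exp (fst (z n)) * chain qstep x z n + snd (z n)"
  by (simp add: qstep_def)

text \<open>Forgetting the first \<open>k\<close> inputs means restarting at 1 instead of
  \<open>Q k\<close>; as all coefficients are nonnegative, the two solutions stay within these
  constant factors. Bounded values along a subsequence are thus unaffected by finitely many
  inputs.\<close>

lemma Q_shift:
  "min 1 (Q k w) * chain qstep 1 (\<lambda>i. Z (k + i) w) n \<le> Q (k + n) w \<and>
   Q (k + n) w \<le> max 1 (Q k w) * chain qstep 1 (\<lambda>i. Z (k + i) w) n"
proof (induction n)
  case (Suc n)
  let ?c = "chain qstep 1 (\<lambda>i. Z (k + i) w) n" and ?x = "exp (X (k + n) w)" and ?b = "B (k + n) w"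
  have b: "0 \<le> ?b" by (rule B_nonneg)
  have "?x * (min 1 (Q k w) * ?c) \<le> ?x * Q (k + n) w" "?x * Q (k + n) w \<le> ?x * (max 1 (Q k w) * ?c)"
    using Suc by (auto intro: mult_left_mono)
  moreover have "min 1 (Q k w) * ?b \<le> 1 * ?b" "1 * ?b \<le> max 1 (Q k w) * ?b"
    using b by (intro mult_right_mono; simp)+
  ultimately show ?case unfolding chain_qstep_Suc add_Suc_right Q_Suc
    by (simp only: distrib_left mult.left_commute[of _ ?x] mult_1) linarith
qed simp

text \<open>With the bound \<open>K\<close> quantified inside, the event is a tail event by
  \<open>Q_shift\<close>. It has positive probability because the lower bounds are uniform in
  \<open>k\<close> and pass to the decreasing intersection.\<close>

theorem small_values_infinitely_often:
  assumes G [measurable]: "G \<in> sets (borel \<Otimes>\<^sub>M borel)" and Gpos: "0 < prob {w \<in> space M. Z 0 w \<in> G}"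
  shows "AE w in M. \<exists>K::nat. \<exists>\<^sub>\<infinity>n. Q n w \<le> real K \<and> Z n w \<in> G"
proof -
  define E where "E = {w \<in> space M. \<exists>K::nat. \<exists>\<^sub>\<infinity>n. Q n w \<le> real K \<and> Z n w \<in> G}"
  have [measurable]: "E \<in> sets M" unfolding E_def INFM_nat by measurable
  have "prob E = 0 \<or> prob E = 1"
  proof (rule prob_tail_event)
    fix k
    let ?L = "sigma (space M) (\<Union>i\<in>{k..}. {Z i -` A \<inter> space M | A. A \<in> sets (borel \<Otimes>\<^sub>M borel)})"
    have sub: "(\<Union>i\<in>{k..}. {Z i -` A \<inter> space M | A. A \<in> sets (borel \<Otimes>\<^sub>M borel)}) \<subseteq> Pow (space M)" by auto
    have ZL: "Z i \<in> ?L \<rightarrow>\<^sub>M borel \<Otimes>\<^sub>M borel" if "k \<le> i" for i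
      using that sub by (intro measurableI) (auto simp: space_measure_of sets_measure_of space_pair_measure)
    let ?c = "\<lambda>n w. chain qstep 1 (\<lambda>i. Z (k + i) w) n"
    have [measurable]: "(\<lambda>w. ?c n w) \<in> borel_measurable ?L" "Z (k + n) \<in> ?L \<rightarrow>\<^sub>M borel \<Otimes>\<^sub>M borel" for n
      by (auto intro!: chain_measurable[OF qstep_measurable] ZL)
    have "E = {w \<in> space ?L. \<exists>K::nat. \<forall>m. \<exists>n>m. ?c n w \<le> real K \<and> Z (k + n) w \<in> G}" (is "_ = ?R")
    proof (intro equalityI subsetI)
      fix w assume "w \<in> E"
      then obtain K :: nat where y: "w \<in> space M" and K: "\<And>m. \<exists>n>m. Q n w \<le> real K \<and> Z n w \<in> G"
        by (auto simp: E_def INFM_nat)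
      let ?m = "min 1 (Q k w)"
      have m: "0 < ?m" using Q_pos[of k w] by simp
      obtain K' :: nat where K': "real K / ?m \<le> real K'" using real_arch_simple by blast
      have "\<exists>n>m. ?c n w \<le> real K' \<and> Z (k + n) w \<in> G" for m
      proof -
        obtain n where n: "k + m < n" "Q n w \<le> real K" "Z n w \<in> G" using K by blast
        define n' where "n' = n - k"
        have nn: "n = k + n'" "m < n'" using n by (auto simp: n'_def)
        have "?m * ?c n' w \<le> real K" using Q_shift[of k w n'] n nn by simp
        then have "?c n' w \<le> real K / ?m" using m by (simp add: field_simps)
        then show ?thesis using K' n nn by (intro exI[of _ n']) auto
      qed
      then show "w \<in> ?R" using y sub by (auto simp: space_measure_of)
    next
      fix w assume "w \<in> ?R"
      then obtain K :: nat where y: "w \<in> space M" and K: "\<And>m. \<exists>n>m. ?c n w \<le> real K \<and> Z (k + n) w \<in> G"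
        using sub by (auto simp: space_measure_of)
      obtain K' :: nat where K': "max 1 (Q k w) * real K \<le> real K'" using real_arch_simple by blast
      have "\<exists>n>m. Q n w \<le> real K' \<and> Z n w \<in> G" for m
      proof -
        obtain n where n: "m < n" "?c n w \<le> real K" "Z (k + n) w \<in> G" using K by blast
        have "max 1 (Q k w) * ?c n w \<le> max 1 (Q k w) * real K" using n by (intro mult_left_mono) auto
        then have "Q (k + n) w \<le> real K'" using Q_shift[of k w n] K' by linarith
        then show ?thesis using n by (intro exI[of _ "k + n"]) auto
      qed
      then show "w \<in> E" using y by (auto simp: E_def INFM_nat)
    qed
    also have "\<dots> \<in> sets ?L" by measurable
    finally show "E \<in> sigma_sets (space M) (\<Union>i\<in>{k..}. {Z i -` A \<inter> space M | A. A \<in> sets (borel \<Otimes>\<^sub>M borel)})"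
      using sub by (simp add: sets_measure_of)
  qed
  moreover have "0 < prob E"
  proof -
    obtain \<delta> K where \<delta>: "0 < \<delta>" "\<And>k. \<delta> \<le> prob {w \<in> space M. \<exists>n\<ge>k. Q n w \<le> K}"
      using small_values_prob by blast
    let ?\<gamma> = "prob {w \<in> space M. Z 0 w \<in> G}"
    let ?F = "\<lambda>k. {w \<in> space M. \<exists>n\<ge>k. Q n w \<le> K \<and> Z n w \<in> G}"
    have F: "?\<gamma> * \<delta> \<le> prob (?F k)" for k
      using small_values_prob_and_next[OF G, of k K] mult_left_mono[OF \<delta>(2)[of k], of ?\<gamma>] by simp
    have "(\<lambda>k. prob (?F k)) \<longlonglongrightarrow> prob (\<Inter>k. ?F k)"
      by (rule finite_Lim_measure_decseq) (auto simp: decseq_def intro: order_trans)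
    then have "?\<gamma> * \<delta> \<le> prob (\<Inter>k. ?F k)" by (rule LIMSEQ_le_const) (use F in auto)
    also have "\<dots> \<le> prob E"
    proof (rule finite_measure_mono)
      obtain K' :: nat where K': "K \<le> real K'" using real_arch_simple by blast
      show "(\<Inter>k. ?F k) \<subseteq> E"
      proof
        fix w assume y: "w \<in> (\<Inter>k. ?F k)"
        then have "w \<in> space M" by auto
        moreover have "\<exists>n>m. Q n w \<le> real K' \<and> Z n w \<in> G" for m
        proof -
          have "w \<in> ?F (Suc m)" using y by blast
          then obtain n where "Suc m \<le> n" "Q n w \<le> K" "Z n w \<in> G" by auto
          then show ?thesis using K' by (intro exI[of _ n]) auto
        qed
        ultimately show "w \<in> E" by (auto simp: E_def INFM_nat)
      qed
    qed simp
    finally show ?thesis using Gpos \<delta>(1) by (meson less_le_trans mult_pos_pos)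
  qed
  ultimately have "prob E = 1" by simp
  then have "AE w in M. w \<in> E" by (simp add: prob_eq_1)
  then show ?thesis by eventually_elim (simp add: E_def)
qed

end

section \<open>From path weights to the annealed walk\<close>

text \<open>Every path is continued by 0 after time \<open>n\<close>. This selects one
  representative for each finite path, so the set is finite and can be summed over.\<close>

primrec paths :: "nat \<Rightarrow> (nat \<Rightarrow> int) set" where
  "paths 0 = {\<lambda>_. 0}"
| "paths (Suc n) = (\<Union>s\<in>paths n. {s(Suc n := s n + 1), s(Suc n := s n - 1)})"

lemma paths_beyond: "s \<in> paths n \<Longrightarrow> n < m \<Longrightarrow> s m = 0"
  by (induction n arbitrary: s) auto

lemma paths_eqI: "s \<in> paths n \<Longrightarrow> s' \<in> paths n \<Longrightarrow> \<forall>m\<le>n. s m = s' m \<Longrightarrow> s = s'"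
  using paths_beyond[of s n] paths_beyond[of s' n] by (metis ext not_le)

lemma finite_paths: "finite (paths n)"
  by (induction n) auto

lemma paths_nearest_neighbour: "s \<in> paths n \<Longrightarrow> m < n \<Longrightarrow> s (Suc m) = s m + 1 \<or> s (Suc m) = s m - 1"
  by (induction n arbitrary: s) (fastforce simp: less_Suc_eq)+

lemma sum_paths_Suc:
  "(\<Sum>s\<in>paths (Suc n). g s) = (\<Sum>s\<in>paths n. g (s(Suc n := s n + 1)) + g (s(Suc n := s n - 1)))"
proof -
  have eq: "s = s'" if "s \<in> paths n" "s' \<in> paths n" "s(Suc n := a) = s'(Suc n := b)" for s s' and a b :: int
  proof
    fix m
    show "s m = s' m"
      using paths_beyond[OF that(1), of m] paths_beyond[OF that(2), of m] fun_cong[OF that(3), of m]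
      by (cases "m = Suc n") auto
  qed
  have "(\<Sum>s\<in>paths (Suc n). g s) = (\<Sum>s\<in>paths n. \<Sum>t\<in>{s(Suc n := s n + 1), s(Suc n := s n - 1)}. g t)"
    unfolding paths.simps
  proof (rule sum.UNION_disjoint)
    show "\<forall>s\<in>paths n. \<forall>s'\<in>paths n. s \<noteq> s' \<longrightarrow>
      {s(Suc n := s n + 1), s(Suc n := s n - 1)} \<inter> {s'(Suc n := s' n + 1), s'(Suc n := s' n - 1)} = {}"
      using eq by blast
  qed (simp_all add: finite_paths)
  also have "\<dots> = (\<Sum>s\<in>paths n. g (s(Suc n := s n + 1)) + g (s(Suc n := s n - 1)))"
  proof (rule sum.cong[OF refl])
    fix s :: "nat \<Rightarrow> int"
    have "s(Suc n := s n + 1) \<noteq> s(Suc n := s n - 1)" 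
    proof
      assume "s(Suc n := s n + 1) = s(Suc n := s n - 1)"
      from fun_cong[OF this, of "Suc n"] show False by simp
    qed
    then show "(\<Sum>t\<in>{s(Suc n := s n + 1), s(Suc n := s n - 1)}. g t)
        = g (s(Suc n := s n + 1)) + g (s(Suc n := s n - 1))" by simp
  qed
  finally show ?thesis .
qed

lemma path_weight_cong:
  assumes "\<And>m. m \<le> n \<Longrightarrow> s m = s' m"
  shows "path_weight w z s n = path_weight w z s' n"
proof -
  have "walk_step w s m = walk_step w s' m" if "m < n" for m
  proof -
    have "{k. k \<le> m \<and> s k = s m} = {k. k \<le> m \<and> s' k = s' m}" using that assms by auto
    moreover have "s m = s' m" "s (Suc m) = s' (Suc m)" using that assms by auto
    ultimately show ?thesis by (simp add: walk_step_def Let_def)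
  qed
  then show ?thesis unfolding path_weight_def using assms[of 0] by (auto intro!: prod.cong)
qed

abbreviation right_prob :: "env \<Rightarrow> (nat \<Rightarrow> int) \<Rightarrow> nat \<Rightarrow> real" where
  "right_prob w s n \<equiv> w (s n) (card {k. k \<le> n \<and> s k = s n})"

lemma path_weight_extend:
  "path_weight w z (s(Suc n := s n + 1)) (Suc n) = path_weight w z s n * right_prob w s n"
  "path_weight w z (s(Suc n := s n - 1)) (Suc n) = path_weight w z s n * (1 - right_prob w s n)"
proof -
  have *: "path_weight w z (s(Suc n := v)) (Suc n)
      = path_weight w z (s(Suc n := v)) n * walk_step w (s(Suc n := v)) n" for v
    by (simp add: path_weight_def)
  have w: "path_weight w z (s(Suc n := v)) n = path_weight w z s n" for v
    by (rule path_weight_cong) auto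
  have c: "{k. k \<le> n \<and> (s(Suc n := v)) k = (s(Suc n := v)) n} = {k. k \<le> n \<and> s k = s n}" for v by auto
  show "path_weight w z (s(Suc n := s n + 1)) (Suc n) = path_weight w z s n * right_prob w s n"
    "path_weight w z (s(Suc n := s n - 1)) (Suc n) = path_weight w z s n * (1 - right_prob w s n)"
    unfolding * w unfolding walk_step_def c by (simp_all add: Let_def)
qed

text \<open>The weights of the two one-step extensions of a path add up to its own weight, in any
  environment.\<close>

lemma sum_paths_marginal:
  assumes g: "\<And>s s'. (\<And>m. m \<le> n \<Longrightarrow> s m = s' m) \<Longrightarrow> g s = g s'"
  shows "(\<Sum>s\<in>paths (n + k). g s * path_weight w 0 s (n + k)) = (\<Sum>s\<in>paths n. g s * path_weight w 0 s n)"
proof (induction k)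
  case (Suc k)
  have g': "g (s(Suc (n + k) := v)) = g s" for s v by (rule g) auto
  have "(\<Sum>s\<in>paths (n + Suc k). g s * path_weight w 0 s (n + Suc k))
      = (\<Sum>s\<in>paths (n + k). g s * path_weight w 0 s (n + k))"
    unfolding add_Suc_right sum_paths_Suc path_weight_extend g'
    by (rule sum.cong[OF refl]) (simp add: algebra_simps)
  then show ?case using Suc by simp
qed simp

lemma sum_paths_weight: "(\<Sum>s\<in>paths n. path_weight w 0 s n) = 1"
  using sum_paths_marginal[of 0 "\<lambda>_. 1" w n] by (simp add: path_weight_def)

section \<open>Remaining cookies and hitting events along a path\<close>

definition remaining :: "(int \<Rightarrow> nat) \<Rightarrow> (nat \<Rightarrow> int) \<Rightarrow> nat \<Rightarrow> int \<Rightarrow> nat" where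
  "remaining c s n x = c x - card {k. k < n \<and> s k = x}"

lemma remaining_cong: "(\<And>m. m < n \<Longrightarrow> s m = s' m) \<Longrightarrow> remaining c s n = remaining c s' n"
proof -
  assume "\<And>m. m < n \<Longrightarrow> s m = s' m"
  then have "{k. k < n \<and> s k = x} = {k. k < n \<and> s' k = x}" for x by auto
  then show ?thesis by (auto simp: remaining_def)
qed

lemma remaining_le: "remaining c s n \<le> c"
  by (auto simp: remaining_def le_fun_def)

lemma remaining_0: "remaining c s 0 = c"
  by (auto simp: remaining_def)

lemma card_visits: "card {k::nat. k \<le> n \<and> s k = x} = card {k. k < n \<and> s k = x} + of_bool (s n = x)"
proof -
  have "{k. k \<le> n \<and> s k = x} = {k. k < n \<and> s k = x} \<union> (if s n = x then {n} else {})"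
    by (auto simp: le_less)
  then show ?thesis by (auto simp: card_insert_if)
qed

lemma remaining_Suc: "remaining c s (Suc n) = (remaining c s n)(s n := remaining c s n (s n) - 1)"
proof
  fix x
  have "{k. k < Suc n \<and> s k = x} = {k. k \<le> n \<and> s k = x}" by auto
  then show "remaining c s (Suc n) x = ((remaining c s n)(s n := remaining c s n (s n) - 1)) x"
    by (auto simp: remaining_def card_visits)
qed

definition hits_before :: "((int \<Rightarrow> nat) \<Rightarrow> int \<Rightarrow> bool) \<Rightarrow> ((int \<Rightarrow> nat) \<Rightarrow> int \<Rightarrow> bool)
    \<Rightarrow> (int \<Rightarrow> nat) \<Rightarrow> nat \<Rightarrow> nat \<Rightarrow> (nat \<Rightarrow> int) \<Rightarrow> bool" where
  "hits_before T U c a b s \<longleftrightarrow> (\<exists>j. a \<le> j \<and> j \<le> b \<and> T (remaining c s j) (s j) \<and>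
      (\<forall>l. a \<le> l \<and> l < j \<longrightarrow> \<not> U (remaining c s l) (s l)))"

lemma hits_before_Suc:
  assumes "a \<le> b"
  shows "hits_before T U c a (Suc b) s \<longleftrightarrow> T (remaining c s a) (s a) \<or>
    \<not> U (remaining c s a) (s a) \<and> hits_before T U c (Suc a) (Suc b) s" (is "?L \<longleftrightarrow> ?R")
proof
  assume ?L
  then obtain j where j: "a \<le> j" "j \<le> Suc b" "T (remaining c s j) (s j)"
    "\<forall>l. a \<le> l \<and> l < j \<longrightarrow> \<not> U (remaining c s l) (s l)" by (auto simp: hits_before_def)
  show ?R
  proof (cases "j = a")
    case False
    with j show ?thesis unfolding hits_before_def by (intro disjI2 conjI exI[of _ j]) auto
  qed (use j in auto)
next
  assume ?R
  then show ?L
  proof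
    assume "T (remaining c s a) (s a)"
    then show ?L using assms unfolding hits_before_def by (intro exI[of _ a]) auto
  next
    assume "\<not> U (remaining c s a) (s a) \<and> hits_before T U c (Suc a) (Suc b) s"
    then obtain j where "Suc a \<le> j" "j \<le> Suc b" "T (remaining c s j) (s j)"
      "\<forall>l. Suc a \<le> l \<and> l < j \<longrightarrow> \<not> U (remaining c s l) (s l)" "\<not> U (remaining c s a) (s a)"
      by (auto simp: hits_before_def)
    moreover have "\<not> U (remaining c s l) (s l)" if "a \<le> l" "l < j" for l
      using calculation that by (cases "l = a") (auto simp: Suc_le_eq)
    ultimately show ?L unfolding hits_before_def by (intro exI[of _ j]) auto
  qed
qed

lemma hits_before_cong: "(\<And>m. m \<le> b \<Longrightarrow> s m = s' m) \<Longrightarrow> hits_before T U c a b s = hits_before T U c a b s'"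
proof -
  assume s: "\<And>m. m \<le> b \<Longrightarrow> s m = s' m"
  then have "remaining c s j = remaining c s' j" if "j \<le> b" for j
    using that by (intro remaining_cong) auto
  then have "V (remaining c s j) (s j) = V (remaining c s' j) (s' j)" if "j \<le> b" for j and V :: "(int \<Rightarrow> nat) \<Rightarrow> int \<Rightarrow> bool"
    using s that by simp
  then show ?thesis unfolding hits_before_def by (intro ex_cong1 conj_cong refl all_cong) auto
qed

context cookie_chain
begin

context
  fixes w :: env and c :: "int \<Rightarrow> nat"
  assumes env: "\<And>x i. 1 \<le> i \<Longrightarrow> w x i = (if i \<le> c x then 1 else p x)"
begin

text \<open>\<open>remaining\<close> counts the visits strictly before \<open>n\<close>, the
  environment also counts the one at \<open>n\<close>. So the current visit has a number at most
  \<open>c\<close> exactly if a cookie is still left.\<close>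

lemma right_prob_eq: "right_prob w s n = (if remaining c s n (s n) > 0 then 1 else p (s n))"
proof -
  have "1 \<le> card {k. k \<le> n \<and> s k = s n}" by (simp add: card_visits)
  then show ?thesis using env[of "card {k. k \<le> n \<and> s k = s n}" "s n"]
    by (auto simp: remaining_def card_visits)
qed

lemma path_weight_step:
  fixes F :: "(int \<Rightarrow> nat) \<Rightarrow> int \<Rightarrow> real" and n :: nat
  defines "G \<equiv> \<lambda>s. path_weight w 0 s (Suc n) * F (remaining c s (Suc n)) (s (Suc n))"
  shows "G (s(Suc n := s n + 1)) + G (s(Suc n := s n - 1))
    = path_weight w 0 s n * step F (remaining c s n) (s n)"
proof -
  have r: "remaining c (s(Suc n := v)) (Suc n) = (remaining c s n)(s n := remaining c s n (s n) - 1)" for v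
    unfolding remaining_Suc[symmetric] by (rule remaining_cong) auto
  have "remaining c s n (s n) = 0 \<Longrightarrow> (remaining c s n)(s n := 0) = remaining c s n" by auto
  then show ?thesis unfolding G_def path_weight_extend r right_prob_eq
    by (auto simp: step_def algebra_simps)
qed

text \<open>The Markov property at time \<open>n\<close>, and the bridge from path weights to
  \<open>hit\<close>. In the induction on \<open>k\<close> the factor \<open>g\<close> absorbs the
  event that neither \<open>T\<close> nor \<open>U\<close> holds at time \<open>n\<close>, which is
  why \<open>g\<close> and \<open>n\<close> are arbitrary.\<close>

lemma sum_paths_hit:
  assumes "\<And>s s'. (\<And>m. m \<le> n \<Longrightarrow> s m = s' m) \<Longrightarrow> g s = g s'"
  shows "(\<Sum>s\<in>paths (n + k). g s * of_bool (hits_before T U c n (n + k) s) * path_weight w 0 s (n + k))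
    = (\<Sum>s\<in>paths n. g s * path_weight w 0 s n * hit T U k (remaining c s n) (s n))"
  using assms
proof (induction k arbitrary: n g)
  case 0
  have "hits_before T U c n n s \<longleftrightarrow> T (remaining c s n) (s n)" for s
    unfolding hits_before_def by (auto intro: le_antisym)
  then show ?case by (simp add: ac_simps of_bool_def)
next
  case (Suc k)
  let ?T = "\<lambda>s. T (remaining c s n) (s n)" and ?U = "\<lambda>s. U (remaining c s n) (s n)"
  let ?g1 = "\<lambda>s. g s * of_bool (?T s)" and ?g2 = "\<lambda>s. g s * of_bool (\<not> ?T s \<and> \<not> ?U s)"
  have dep: "g s = g s'" "?T s = ?T s'" "?U s = ?U s'" if "\<And>m. m \<le> n \<Longrightarrow> s m = s' m" for s s'
    using Suc.prems[OF that] remaining_cong[of n s s' c] that by auto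
  have "(\<Sum>s\<in>paths (n + Suc k). g s * of_bool (hits_before T U c n (n + Suc k) s) * path_weight w 0 s (n + Suc k))
     = (\<Sum>s\<in>paths (n + Suc k). ?g1 s * path_weight w 0 s (n + Suc k))
     + (\<Sum>s\<in>paths (Suc n + k). ?g2 s * of_bool (hits_before T U c (Suc n) (Suc n + k) s) * path_weight w 0 s (Suc n + k))"
    unfolding sum.distrib[symmetric] add_Suc_right add_Suc
    by (intro sum.cong) (auto simp: hits_before_Suc algebra_simps)
  also have "(\<Sum>s\<in>paths (n + Suc k). ?g1 s * path_weight w 0 s (n + Suc k)) = (\<Sum>s\<in>paths n. ?g1 s * path_weight w 0 s n)"
  proof (rule sum_paths_marginal)
    fix s s' :: "nat \<Rightarrow> int" assume "\<And>m. m \<le> n \<Longrightarrow> s m = s' m"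
    from dep[of s s', OF this] show "?g1 s = ?g1 s'" by simp
  qed
  also have "(\<Sum>s\<in>paths (Suc n + k). ?g2 s * of_bool (hits_before T U c (Suc n) (Suc n + k) s) * path_weight w 0 s (Suc n + k))
     = (\<Sum>s\<in>paths (Suc n). ?g2 s * path_weight w 0 s (Suc n) * hit T U k (remaining c s (Suc n)) (s (Suc n)))"
  proof (rule Suc.IH)
    fix s s' :: "nat \<Rightarrow> int" assume "\<And>m. m \<le> Suc n \<Longrightarrow> s m = s' m"
    then have "\<And>m. m \<le> n \<Longrightarrow> s m = s' m" by auto
    from dep[of s s', OF this] show "?g2 s = ?g2 s'" by simp
  qed
  also have "\<dots> = (\<Sum>s\<in>paths n. ?g2 s * (path_weight w 0 s n * step (hit T U k) (remaining c s n) (s n)))"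
  proof -
    have "?g2 (s(Suc n := v)) = ?g2 s" for s v
      using dep[of "s(Suc n := v)" s] by auto
    then show ?thesis unfolding sum_paths_Suc path_weight_step[symmetric]
      by (simp only: distrib_left mult.assoc)
  qed
  also have "(\<Sum>s\<in>paths n. ?g1 s * path_weight w 0 s n) + \<dots>
     = (\<Sum>s\<in>paths n. g s * path_weight w 0 s n * hit T U (Suc k) (remaining c s n) (s n))"
    unfolding sum.distrib[symmetric] by (intro sum.cong) auto
  finally show ?case .
qed

end
end

section \<open>The random environment\<close>

locale environment =
  fixes PE :: "env measure" and p :: "int \<Rightarrow> env \<Rightarrow> real"
  assumes A: "assumption_A PE p"
begin

sublocale PE: prob_space PE
  using A by (simp add: assumption_A_def)

definition ncookies :: "env \<Rightarrow> int \<Rightarrow> nat" where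
  "ncookies w x = the_enat (cookies w x)"

lemma coordinate_measurable [measurable]: "(\<lambda>w. w x i) \<in> borel_measurable PE"
proof -
  have "(\<lambda>w. w x i) \<in> borel_measurable env_measure" unfolding env_measure_def
    by (rule measurable_compose[OF measurable_component_singleton[of x UNIV] measurable_component_singleton[of i UNIV]]) auto
  moreover have "sets PE = sets env_measure" using A by (simp add: assumption_A_def)
  ultimately show ?thesis using measurable_cong_sets by blast
qed

lemma pair_measurable [measurable]:
  "(\<lambda>w. (p x w, cookies w x)) \<in> PE \<rightarrow>\<^sub>M borel \<Otimes>\<^sub>M count_space UNIV"
  using A unfolding assumption_A_def PE.indep_vars_def by auto

lemma p_measurable [measurable]: "p x \<in> borel_measurable PE"
  and cookies_measurable [measurable]: "(\<lambda>w. cookies w x) \<in> PE \<rightarrow>\<^sub>M count_space UNIV"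
  using measurable_compose[OF pair_measurable measurable_fst, of x]
    measurable_compose[OF pair_measurable measurable_snd, of x] by simp_all

lemma ncookies_measurable [measurable]: "(\<lambda>w. ncookies w x) \<in> PE \<rightarrow>\<^sub>M count_space UNIV"
  unfolding ncookies_def by (rule measurable_compose[OF cookies_measurable]) simp

lemma prob_pair_ident:
  assumes [measurable]: "C \<in> sets (borel \<Otimes>\<^sub>M count_space UNIV)"
  shows "PE.prob {w \<in> space PE. (p x w, cookies w x) \<in> C} = PE.prob {w \<in> space PE. (p 0 w, cookies w 0) \<in> C}"
proof -
  have d: "distr PE (borel \<Otimes>\<^sub>M count_space UNIV) (\<lambda>w. (p x w, cookies w x))
      = distr PE (borel \<Otimes>\<^sub>M count_space UNIV) (\<lambda>w. (p 0 w, cookies w 0))"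
    using A by (simp add: assumption_A_def)
  have "PE.prob {w \<in> space PE. (p y w, cookies w y) \<in> C}
      = measure (distr PE (borel \<Otimes>\<^sub>M count_space UNIV) (\<lambda>w. (p y w, cookies w y))) C" for y
    by (subst measure_distr) (auto intro!: arg_cong[where f = "measure PE"])
  then show ?thesis by (simp add: d)
qed

text \<open>(A.4) speaks of the origin only; identical distribution carries it to each of the
  countably many sites.\<close>

lemma AE_cookies_finite: "AE w in PE. \<forall>x. cookies w x \<noteq> \<infinity>"
proof -
  have "AE w in PE. cookies w x \<noteq> \<infinity>" for x
  proof -
    have "PE.prob {w \<in> space PE. cookies w x = \<infinity>} = 0"
      using prob_pair_ident[of "UNIV \<times> {\<infinity>}" x] A by (simp add: assumption_A_def pair_measureI)
    then show ?thesis
      by (intro AE_I[where N = "{w \<in> space PE. cookies w x = \<infinity>}"]) (auto simp: PE.emeasure_eq_measure)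
  qed
  then show ?thesis by (simp add: AE_all_countable)
qed

text \<open>Attainment of the supremum is avoided: the strict inequality for \<open>i - 1\<close>
  yields a member of the set that is at least \<open>i\<close>.\<close>

lemma cookies_eq_1: "cookies w x = enat n \<Longrightarrow> 1 \<le> i \<Longrightarrow> i \<le> n \<Longrightarrow> w x i = 1"
proof -
  assume c: "cookies w x = enat n" and i: "1 \<le> i" "i \<le> n"
  have "enat (i - 1) < cookies w x" using c i by simp
  then obtain j where j: "enat (i - 1) < enat j" "\<forall>l. 1 \<le> l \<and> l \<le> j \<longrightarrow> w x l = 1"
    unfolding cookies_def less_Sup_iff by blast
  then have "i \<le> j" by simp
  then show ?thesis using j(2) i by blast
qed

definition good :: "env \<Rightarrow> bool" where
  "good w \<longleftrightarrow> (\<forall>x i. 0 \<le> w x i \<and> w x i \<le> 1) \<and> (\<forall>x. 0 < p x w \<and> p x w < 1 \<and> cookies w x = enat (ncookies w x)) \<and>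
     (\<forall>x i. 1 \<le> i \<longrightarrow> w x i = (if i \<le> ncookies w x then 1 else p x w))"

lemma AE_good: "AE w in PE. good w"
proof -
  have 1: "AE w in PE. \<forall>x i. 0 \<le> w x i \<and> w x i \<le> 1" using A by (simp add: assumption_A_def)
  have 2: "AE w in PE. \<forall>x. 0 < p x w \<and> p x w < 1 \<and> (\<forall>i. enat i > cookies w x \<longrightarrow> w x i = p x w)"
    using A by (simp add: assumption_A_def)
  from 1 2 AE_cookies_finite show ?thesis
  proof eventually_elim
    case (elim w)
    have c: "cookies w x = enat (ncookies w x)" for x 
    proof -
      have "cookies w x \<noteq> \<infinity>" using elim(3) by blast
      then show ?thesis by (cases "cookies w x") (auto simp: ncookies_def)
    qed
    show ?case unfolding good_def
      using elim c cookies_eq_1[OF c] by (auto simp: not_le)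
  qed
qed

lemma good_chain: "good w \<Longrightarrow> cookie_chain (\<lambda>x. p x w)"
  by unfold_locales (auto simp: good_def)

lemma path_weight_measurable [measurable]: "(\<lambda>w. path_weight w z s n) \<in> borel_measurable PE"
  unfolding path_weight_def walk_step_def Let_def by measurable

lemma path_weight_bounds:
  assumes "good w"
  shows "0 \<le> path_weight w z s n" "path_weight w z s n \<le> 1"
proof -
  have "0 \<le> walk_step w s m \<and> walk_step w s m \<le> 1" for m
    using assms unfolding good_def walk_step_def Let_def by auto
  then show "0 \<le> path_weight w z s n" "path_weight w z s n \<le> 1"
    unfolding path_weight_def by (auto intro!: prod_nonneg prod_le_1)
qed

lemma path_weight_integrable:
  assumes [measurable]: "A \<in> sets PE"
  shows "integrable PE (\<lambda>w. indicator A w * path_weight w z s n)"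
proof (rule PE.integrable_const_bound[where B = 1])
  show "AE w in PE. norm (indicator A w * path_weight w z s n) \<le> 1"
    using AE_good by eventually_elim (auto simp: path_weight_bounds split: split_indicator)
qed measurable

end

section \<open>Annealed probabilities as averages of quenched weights\<close>

locale realization = environment PE p for PE :: "env measure" and p :: "int \<Rightarrow> env \<Rightarrow> real" +
  fixes M :: "'a measure" and Ev :: "'a \<Rightarrow> env" and S :: "nat \<Rightarrow> 'a \<Rightarrow> int"
  assumes real: "ERWRE_realization PE 0 M Ev S"
begin

sublocale prob_space M
  using real by (simp add: ERWRE_realization_def)

lemma Ev_measurable [measurable]: "Ev \<in> M \<rightarrow>\<^sub>M PE"
  and S_measurable [measurable]: "S n \<in> M \<rightarrow>\<^sub>M count_space UNIV"
  using real by (auto simp: ERWRE_realization_def)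

lemma cylinder: "A \<in> sets PE \<Longrightarrow> prob {a \<in> space M. Ev a \<in> A \<and> (\<forall>m\<le>n. S m a = s m)}
    = (\<integral>w. indicator A w * path_weight w 0 s n \<partial>PE)"
  using real by (auto simp: ERWRE_realization_def)

text \<open>The cylinder probabilities of the finitely many members of \<open>paths n\<close>
  already add up to 1.\<close>

lemma AE_path: "AE a in M. \<exists>s\<in>paths n. \<forall>m\<le>n. S m a = s m"
proof -
  let ?C = "\<lambda>s. {a \<in> space M. \<forall>m\<le>n. S m a = s m}"
  have "prob (\<Union>s\<in>paths n. ?C s) = (\<Sum>s\<in>paths n. prob (?C s))"
    by (rule finite_measure_finite_Union) (auto simp: finite_paths disjoint_family_on_def intro!: paths_eqI)
  also have "\<dots> = (\<Sum>s\<in>paths n. \<integral>w. indicator (space PE) w * path_weight w 0 s n \<partial>PE)"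
  proof (rule sum.cong[OF refl])
    fix s
    have "?C s = {a \<in> space M. Ev a \<in> space PE \<and> (\<forall>m\<le>n. S m a = s m)}"
      using measurable_space[OF Ev_measurable] by auto
    then show "prob (?C s) = (\<integral>w. indicator (space PE) w * path_weight w 0 s n \<partial>PE)"
      using cylinder[of "space PE" n s] by simp
  qed
  also have "\<dots> = (\<integral>w. (\<Sum>s\<in>paths n. indicator (space PE) w * path_weight w 0 s n) \<partial>PE)"
    by (rule Bochner_Integration.integral_sum[symmetric]) (simp add: path_weight_integrable)
  also have "\<dots> = (\<integral>w. 1 \<partial>PE)"
    by (intro Bochner_Integration.integral_cong refl)
       (simp add: sum_distrib_left[symmetric] sum_paths_weight)
  finally have "prob (\<Union>s\<in>paths n. ?C s) = 1" by (simp add: PE.prob_space)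
  then have "AE a in M. a \<in> (\<Union>s\<in>paths n. ?C s)"
    by (subst (asm) prob_eq_1) (auto simp: finite_paths)
  then show ?thesis by eventually_elim auto
qed

text \<open>There are uncountably many functions \<open>s\<close>, so the event is split according
  to a list that records the first positions; lists of integers are countable.\<close>

lemma path_event_sets:
  assumes dep: "\<And>w s s'. (\<And>m. m \<le> n \<Longrightarrow> s m = s' m) \<Longrightarrow> P w s = P w s'"
    and meas: "\<And>s. {w \<in> space PE. P w s} \<in> sets PE"
  shows "{a \<in> space M. P (Ev a) (\<lambda>m. S m a)} \<in> sets M"
proof -
  let ?D = "\<lambda>l. {a \<in> space M. Ev a \<in> {w \<in> space PE. P w (\<lambda>m. l ! m)} \<and> (\<forall>m\<le>n. S m a = l ! m)}"
  have "{a \<in> space M. P (Ev a) (\<lambda>m. S m a)} = (\<Union>l. ?D l)"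
  proof (intro equalityI subsetI)
    fix a assume a: "a \<in> {a \<in> space M. P (Ev a) (\<lambda>m. S m a)}"
    let ?l = "map (\<lambda>m. S m a) [0..<Suc n]"
    have l: "S m a = ?l ! m" if "m \<le> n" for m using that by (simp add: nth_map_upt del: upt_Suc)
    then have "P (Ev a) (\<lambda>m. ?l ! m)" using a dep[of "\<lambda>m. S m a" "\<lambda>m. ?l ! m"] by blast
    then have "a \<in> ?D ?l" using a l measurable_space[OF Ev_measurable] by blast
    then show "a \<in> (\<Union>l. ?D l)" by blast
  next
    fix a assume "a \<in> (\<Union>l. ?D l)"
    then obtain l where l: "a \<in> ?D l" by blast
    then have "P (Ev a) (\<lambda>m. S m a) = P (Ev a) (\<lambda>m. l ! m)" by (intro dep) auto
    with l show "a \<in> {a \<in> space M. P (Ev a) (\<lambda>m. S m a)}" by blast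
  qed
  moreover have "?D l \<in> sets M" for l using meas[of "\<lambda>m. l ! m"] by measurable
  ultimately show ?thesis by (auto intro!: sets.countable_UN')
qed

lemma prob_path_event:
  assumes dep: "\<And>w s s'. (\<And>m. m \<le> n \<Longrightarrow> s m = s' m) \<Longrightarrow> P w s = P w s'"
    and meas: "\<And>s. {w \<in> space PE. P w s} \<in> sets PE"
  shows "prob {a \<in> space M. P (Ev a) (\<lambda>m. S m a)} = (\<integral>w. (\<Sum>s\<in>paths n. of_bool (P w s) * path_weight w 0 s n) \<partial>PE)"
proof -
  let ?C = "\<lambda>s. {a \<in> space M. Ev a \<in> {w \<in> space PE. P w s} \<and> (\<forall>m\<le>n. S m a = s m)}"
  have Cm [measurable]: "?C s \<in> sets M" for s using meas[of s] by measurable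
  have "prob {a \<in> space M. P (Ev a) (\<lambda>m. S m a)} = prob (\<Union>s\<in>paths n. ?C s)"
  proof (rule measure_eq_AE)
    show "AE a in M. a \<in> {a \<in> space M. P (Ev a) (\<lambda>m. S m a)} \<longleftrightarrow> a \<in> (\<Union>s\<in>paths n. ?C s)"
      using AE_path[of n] AE_space
    proof eventually_elim
      case (elim a)
      then obtain s where s: "s \<in> paths n" "\<And>m. m \<le> n \<Longrightarrow> S m a = s m" by blast
      have Ea: "Ev a \<in> space PE" using measurable_space[OF Ev_measurable elim(2)] .
      have "P (Ev a) (\<lambda>m. S m a) = P (Ev a) t" if "\<forall>m\<le>n. S m a = t m" for t
        using dep[of "\<lambda>m. S m a" t] that by auto
      then show ?case using s elim(2) Ea by auto
    qed
    show "{a \<in> space M. P (Ev a) (\<lambda>m. S m a)} \<in> sets M" by (rule path_event_sets[OF dep meas])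
    show "(\<Union>s\<in>paths n. ?C s) \<in> sets M" by (intro sets.finite_UN finite_paths Cm)
  qed
  also have "\<dots> = (\<Sum>s\<in>paths n. prob (?C s))"
  proof (rule finite_measure_finite_Union)
    show "?C ` paths n \<subseteq> sets M" using Cm by blast
    show "disjoint_family_on ?C (paths n)" by (auto simp: disjoint_family_on_def intro!: paths_eqI)
  qed (rule finite_paths)
  also have "\<dots> = (\<Sum>s\<in>paths n. \<integral>w. indicator {w \<in> space PE. P w s} w * path_weight w 0 s n \<partial>PE)"
    by (intro sum.cong refl cylinder meas)
  also have "\<dots> = (\<integral>w. (\<Sum>s\<in>paths n. indicator {w \<in> space PE. P w s} w * path_weight w 0 s n) \<partial>PE)"
    by (rule Bochner_Integration.integral_sum[symmetric]) (intro path_weight_integrable meas)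
  also have "\<dots> = (\<integral>w. (\<Sum>s\<in>paths n. of_bool (P w s) * path_weight w 0 s n) \<partial>PE)"
    by (intro Bochner_Integration.integral_cong sum.cong refl) (auto split: split_indicator)
  finally show ?thesis .
qed

lemma AE_start: "AE a in M. S 0 a = 0"
  using AE_path[of 0] by eventually_elim auto

lemma AE_nearest_neighbour: "AE a in M. \<forall>n. S (Suc n) a = S n a + 1 \<or> S (Suc n) a = S n a - 1"
proof -
  have "AE a in M. S (Suc n) a = S n a + 1 \<or> S (Suc n) a = S n a - 1" for n
    using AE_path[of "Suc n"]
  proof eventually_elim
    case (elim a)
    then obtain s where "s \<in> paths (Suc n)" "S n a = s n" "S (Suc n) a = s (Suc n)"
      by (auto simp del: paths.simps)
    then show ?case using paths_nearest_neighbour[of s "Suc n" n] by simp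
  qed
  then show ?thesis by (simp add: AE_all_countable)
qed

text \<open>In a good environment a left step from a site with a cookie contributes the factor
  \<open>1 - 1\<close> to the path weight.\<close>

lemma AE_left_step:
  "AE a in M. \<forall>n. S (Suc n) a = S n a - 1 \<longrightarrow> remaining (ncookies (Ev a)) (\<lambda>m. S m a) n (S n a) = 0"
proof -
  have "AE a in M. S (Suc n) a = S n a - 1 \<longrightarrow> remaining (ncookies (Ev a)) (\<lambda>m. S m a) n (S n a) = 0" for n
  proof -
    define P where "P w s \<longleftrightarrow> s (Suc n) = s n - 1 \<and> 0 < remaining (ncookies w) s n (s n)"
      for w and s :: "nat \<Rightarrow> int"
    have dep: "P w s = P w s'" if "\<And>m. m \<le> Suc n \<Longrightarrow> s m = s' m" for w s s'
      using that remaining_cong[of n s s' "ncookies w"] by (simp add: P_def)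
    have meas: "{w \<in> space PE. P w s} \<in> sets PE" for s
      unfolding P_def remaining_def by measurable
    note ev = path_event_sets[OF dep meas, of "Suc n"]
    have "prob {a \<in> space M. P (Ev a) (\<lambda>m. S m a)}
       = (\<integral>w. (\<Sum>s\<in>paths (Suc n). of_bool (P w s) * path_weight w 0 s (Suc n)) \<partial>PE)"
      by (rule prob_path_event[OF dep meas])
    also have "\<dots> = (\<integral>w. 0 \<partial>PE)"
    proof (rule integral_cong_AE)
      show "AE w in PE. (\<Sum>s\<in>paths (Suc n). of_bool (P w s) * path_weight w 0 s (Suc n)) = 0"
        using AE_good
      proof eventually_elim
        case (elim w)
        interpret cookie_chain "\<lambda>x. p x w" by (rule good_chain) fact
        have rp: "right_prob w s n = (if remaining (ncookies w) s n (s n) > 0 then 1 else p (s n) w)" for s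
          by (rule right_prob_eq) (use elim in \<open>auto simp: good_def\<close>)
        have z: "of_bool (P w s) * path_weight w 0 s (Suc n) = 0" for s
        proof (cases "P w s")
          case True
          then have "s = s(Suc n := s n - 1)" by (auto simp: P_def)
          then have "path_weight w 0 s (Suc n) = path_weight w 0 s n * (1 - right_prob w s n)"
            using path_weight_extend(2)[of w 0 s n] by metis
          then show ?thesis using True rp[of s] by (simp add: P_def)
        qed simp
        show ?case unfolding z by simp
      qed
    next
      show "(\<lambda>w. \<Sum>s\<in>paths (Suc n). of_bool (P w s) * path_weight w 0 s (Suc n)) \<in> borel_measurable PE"
        unfolding P_def remaining_def by measurable
    qed simp
    finally have "AE a in M. \<not> P (Ev a) (\<lambda>m. S m a)"
      using ev by (intro AE_I[where N = "{a \<in> space M. P (Ev a) (\<lambda>m. S m a)}"]) (auto simp: emeasure_eq_measure)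
    then show ?thesis by eventually_elim (auto simp: P_def)
  qed
  then show ?thesis by (simp add: AE_all_countable)
qed

text \<open>The hypothesis covers every state with at most the initial cookies, hence whichever
  state is occupied at time \<open>n\<close>. The quenched failure probabilities tend to 0, and
  dominated convergence gives the annealed statement.\<close>

lemma AE_hits_again:
  assumes hit: "AE w in PE. good w \<longrightarrow>
    (\<forall>m y. m \<le> ncookies w \<longrightarrow> cookie_chain.hitting (\<lambda>x. p x w) (\<lambda>m. T) (\<lambda>m y. False) m y = 1)"
  shows "AE a in M. \<exists>j\<ge>n. T (S j a)"
proof -
  define P where "P k s \<longleftrightarrow> (\<forall>j. n \<le> j \<and> j \<le> n + k \<longrightarrow> \<not> T (s j))" for k and s :: "nat \<Rightarrow> int"
  have dep: "P k s = P k s'" if "\<And>m. m \<le> n + k \<Longrightarrow> s m = s' m" for k s s'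
    using that by (auto simp: P_def)
  have meas: "{w \<in> space PE. P k s} \<in> sets PE" for k s by simp
  let ?f = "\<lambda>k w. \<Sum>s\<in>paths (n + k). of_bool (P k s) * path_weight w 0 s (n + k)"
  have eq: "prob {a \<in> space M. P k (\<lambda>m. S m a)} = (\<integral>w. ?f k w \<partial>PE)" for k
    by (rule prob_path_event[OF dep meas])
  have lim: "AE w in PE. (\<lambda>k. ?f k w) \<longlonglongrightarrow> 0"
    using hit AE_good
  proof eventually_elim
    case (elim w)
    interpret cookie_chain "\<lambda>x. p x w" by (rule good_chain) fact
    let ?c = "ncookies w"
    have env: "w x i = (if i \<le> ?c x then 1 else p x w)" if "1 \<le> i" for x i
      using elim(2) that by (auto simp: good_def)
    have hb: "of_bool (P k s) = (1 - of_bool (hits_before (\<lambda>m. T) never ?c n (n + k) s) :: real)" for k s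
      by (auto simp: P_def hits_before_def)
    have "?f k w = (\<Sum>s\<in>paths (n + k). 1 * path_weight w 0 s (n + k))
        - (\<Sum>s\<in>paths (n + k). 1 * of_bool (hits_before (\<lambda>m. T) never ?c n (n + k) s) * path_weight w 0 s (n + k))" for k
      unfolding hb sum_subtractf[symmetric] by (intro sum.cong refl) (simp add: algebra_simps)
    also have "\<dots> k = (\<Sum>s\<in>paths n. path_weight w 0 s n)
        - (\<Sum>s\<in>paths n. path_weight w 0 s n * hit (\<lambda>m. T) never k (remaining ?c s n) (s n))" for k
      using sum_paths_hit[OF env, of n "\<lambda>_. 1" "\<lambda>m. T" never k] sum_paths_marginal[of n "\<lambda>_. 1" w k] by simp
    finally have f: "?f k w = (\<Sum>s\<in>paths n. path_weight w 0 s n)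
        - (\<Sum>s\<in>paths n. path_weight w 0 s n * hit (\<lambda>m. T) never k (remaining ?c s n) (s n))" for k .
    have "(\<lambda>k. ?f k w) \<longlonglongrightarrow> (\<Sum>s\<in>paths n. path_weight w 0 s n)
        - (\<Sum>s\<in>paths n. path_weight w 0 s n * hitting (\<lambda>m. T) never (remaining ?c s n) (s n))"
      unfolding f by (intro tendsto_intros hit_tendsto)
    moreover have "hitting (\<lambda>m. T) never (remaining ?c s n) (s n) = 1" for s
      using elim remaining_le by blast
    ultimately show ?case by simp
  qed
  have "(\<lambda>k. \<integral>w. ?f k w \<partial>PE) \<longlonglongrightarrow> (\<integral>w. 0 \<partial>PE)"
  proof (rule integral_dominated_convergence[where w = "\<lambda>_. 1"])
    show "AE w in PE. norm (?f k w) \<le> 1" for k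
      using AE_good
    proof eventually_elim
      case (elim w)
      have "?f k w \<le> (\<Sum>s\<in>paths (n + k). path_weight w 0 s (n + k))"
        by (intro sum_mono) (auto simp: path_weight_bounds[OF elim])
      moreover have "0 \<le> ?f k w" by (intro sum_nonneg) (auto simp: path_weight_bounds[OF elim])
      ultimately show ?case by (simp add: sum_paths_weight)
    qed
  qed (use lim in auto)
  then have "(\<lambda>k. prob {a \<in> space M. P k (\<lambda>m. S m a)}) \<longlonglongrightarrow> 0" by (simp add: eq)
  moreover have sub: "{a \<in> space M. \<forall>j\<ge>n. \<not> T (S j a)} \<in> sets M" by measurable
  have "prob {a \<in> space M. \<forall>j\<ge>n. \<not> T (S j a)} \<le> prob {a \<in> space M. P k (\<lambda>m. S m a)}" for k
    by (rule finite_measure_mono) (auto simp: P_def intro!: path_event_sets[OF dep meas, unfolded P_def])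
  ultimately have "prob {a \<in> space M. \<forall>j\<ge>n. \<not> T (S j a)} \<le> 0"
    by (intro LIMSEQ_le_const) auto
  then have "AE a in M. \<not> (\<forall>j\<ge>n. \<not> T (S j a))"
    using sub by (intro AE_I[where N = "{a \<in> space M. \<forall>j\<ge>n. \<not> T (S j a)}"])
      (auto simp: emeasure_eq_measure measure_le_0_iff)
  then show ?thesis by eventually_elim auto
qed

definition backtracks :: "int \<Rightarrow> int \<Rightarrow> 'a \<Rightarrow> bool" where
  "backtracks x Y a \<longleftrightarrow> (\<exists>j. S j a = x - 1 \<and> remaining (ncookies (Ev a)) (\<lambda>m. S m a) j x = 0 \<and> (\<forall>l<j. S l a < Y))"

text \<open>The events up to time \<open>k\<close> increase to the full event, and each is
  controlled by the quenched \<open>hit\<close> through \<open>sum_paths_hit\<close>. The set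
  \<open>C\<close> admits bounds that hold in favourable environments only.\<close>

lemma prob_backtracks:
  assumes C [measurable]: "C \<in> sets PE" and e: "0 \<le> e"
    and bound: "AE w in PE. good w \<longrightarrow> w \<in> C \<longrightarrow> (\<forall>k. cookie_chain.hit (\<lambda>x. p x w)
        (\<lambda>m z. z = x - 1 \<and> m x = 0) (\<lambda>m y. Y \<le> y) k (ncookies w) 0 \<le> e)"
  shows "prob {a \<in> space M. Ev a \<in> C \<and> backtracks x Y a} \<le> e" and "{a \<in> space M. backtracks x Y a} \<in> sets M"
proof -
  let ?T = "\<lambda>m z. z = x - 1 \<and> m x = (0::nat)" and ?U = "\<lambda>(m :: int \<Rightarrow> nat) y. Y \<le> y"
  define P where "P D k w s \<longleftrightarrow> w \<in> D \<and> hits_before ?T ?U (ncookies w) 0 k s" for D k w s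
  have dep: "P D k w s = P D k w s'" if "\<And>m. m \<le> k \<Longrightarrow> s m = s' m" for D k w s s'
  proof -
    have "hits_before ?T ?U (ncookies w) 0 k s = hits_before ?T ?U (ncookies w) 0 k s'"
      by (rule hits_before_cong) (rule that)
    then show ?thesis by (simp only: P_def)
  qed
  have meas: "{w \<in> space PE. P D k w s} \<in> sets PE" if [measurable]: "D \<in> sets PE" for D k s
    unfolding P_def hits_before_def remaining_def by measurable
  let ?E = "\<lambda>D k. {a \<in> space M. P D k (Ev a) (\<lambda>m. S m a)}"
  have E[measurable]: "?E D k \<in> sets M" if "D \<in> sets PE" for D k by (rule path_event_sets[OF dep meas[OF that]])
  have un: "{a \<in> space M. Ev a \<in> D \<and> backtracks x Y a} = (\<Union>k. ?E D k)" for D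
  proof (intro equalityI subsetI)
    fix a assume "a \<in> {a \<in> space M. Ev a \<in> D \<and> backtracks x Y a}"
    then obtain j where "a \<in> space M" "Ev a \<in> D" "S j a = x - 1"
      "remaining (ncookies (Ev a)) (\<lambda>m. S m a) j x = 0" "\<forall>l<j. S l a < Y"
      unfolding backtracks_def by blast
    then have "a \<in> ?E D j" unfolding P_def hits_before_def by (auto simp: not_le intro!: exI[of _ j])
    then show "a \<in> (\<Union>k. ?E D k)" by blast
  next
    fix a assume "a \<in> (\<Union>k. ?E D k)"
    then obtain k j where "a \<in> space M" "Ev a \<in> D" "S j a = x - 1"
      "remaining (ncookies (Ev a)) (\<lambda>m. S m a) j x = 0" "\<forall>l. 0 \<le> l \<and> l < j \<longrightarrow> \<not> Y \<le> S l a"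
      unfolding P_def hits_before_def by blast
    then show "a \<in> {a \<in> space M. Ev a \<in> D \<and> backtracks x Y a}"
      unfolding backtracks_def by (auto simp: not_le intro!: exI[of _ j])
  qed
  have "{a \<in> space M. backtracks x Y a} = (\<Union>k. ?E (space PE) k)"
    using un[of "space PE"] measurable_space[OF Ev_measurable] by blast
  then show "{a \<in> space M. backtracks x Y a} \<in> sets M" by simp
  have "prob (?E C k) \<le> e" for k
  proof -
    let ?f = "\<lambda>w. \<Sum>s\<in>paths k. of_bool (P C k w s) * path_weight w 0 s k"
    have m: "?f \<in> borel_measurable PE"
      unfolding P_def hits_before_def remaining_def by measurable
    have le: "AE w in PE. 0 \<le> ?f w \<and> ?f w \<le> e"
      using bound AE_good
    proof eventually_elim
      case (elim w)
      interpret cookie_chain "\<lambda>x. p x w" by (rule good_chain) fact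
      have env: "w x i = (if i \<le> ncookies w x then 1 else p x w)" if "1 \<le> i" for x i
        using elim(2) that by (auto simp: good_def)
      have "0 \<le> ?f w" by (intro sum_nonneg) (auto simp: path_weight_bounds[OF elim(2)])
      moreover have "?f w \<le> e"
      proof (cases "w \<in> C")
        case True
        have "?f w = (\<Sum>s\<in>paths (0 + k). 1 * of_bool (hits_before ?T ?U (ncookies w) 0 (0 + k) s) * path_weight w 0 s (0 + k))"
          using True by (simp add: P_def)
        also have "\<dots> = (\<Sum>s\<in>paths 0. 1 * path_weight w 0 s 0 * hit ?T ?U k (remaining (ncookies w) s 0) (s 0))"
          by (rule sum_paths_hit[OF env]) auto
        also have "\<dots> = hit ?T ?U k (ncookies w) 0" by (simp add: remaining_0 path_weight_def)
        also have "\<dots> \<le> e" using elim True by blast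
        finally show ?thesis .
      qed (use e in \<open>simp add: P_def\<close>)
      ultimately show ?case by simp
    qed
    have "prob (?E C k) = (\<integral>w. ?f w \<partial>PE)" by (rule prob_path_event[OF dep meas[OF C]])
    also have "\<dots> \<le> (\<integral>w. e \<partial>PE)"
    proof (rule integral_mono_AE)
      show "integrable PE ?f" using le m by (intro PE.integrable_const_bound[where B = e]) auto
      show "AE w in PE. ?f w \<le> e" using le by eventually_elim auto
    qed simp
    finally show ?thesis by (simp add: PE.prob_space)
  qed
  moreover have "(\<lambda>k. prob (?E C k)) \<longlonglongrightarrow> prob (\<Union>k. ?E C k)"
  proof (rule finite_Lim_measure_incseq)
    show "incseq (?E C)" unfolding P_def hits_before_def incseq_def by (blast intro: le_trans)
  qed (use E[OF C] in auto)
  ultimately show "prob {a \<in> space M. Ev a \<in> C \<and> backtracks x Y a} \<le> e"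
    unfolding un by (intro LIMSEQ_le_const2) auto
qed

end

section \<open>Recurrence and transience\<close>

context environment
begin

abbreviation pairs :: "int \<Rightarrow> env \<Rightarrow> real \<times> enat" where
  "pairs x w \<equiv> (p x w, cookies w x)"
abbreviation N where "N \<equiv> (borel :: real measure) \<Otimes>\<^sub>M count_space (UNIV :: enat set)"

lemma distr_pairs: "distr PE N (pairs x) = distr PE N (pairs 0)"
  using A by (simp add: assumption_A_def)

lemma pairs_integral_ident:
  fixes f :: "real \<times> enat \<Rightarrow> real"
  assumes [measurable]: "f \<in> borel_measurable N"
  shows "(\<integral>w. f (pairs x w) \<partial>PE) = (\<integral>w. f (pairs 0 w) \<partial>PE)"
    and "integrable PE (\<lambda>w. f (pairs x w)) \<longleftrightarrow> integrable PE (\<lambda>w. f (pairs 0 w))"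
  using integral_distr[of "pairs x" PE N f] integral_distr[of "pairs 0" PE N f]
    integrable_distr_eq[of "pairs x" PE N f] integrable_distr_eq[of "pairs 0" PE N f]
  by (simp_all add: distr_pairs[of x])

text \<open>Reindexing by an injection lets the same machinery run to the right and to the left of
  the origin.\<close>

lemma iid_pairs:
  assumes f: "inj f" and h [measurable]: "h \<in> N \<rightarrow>\<^sub>M L"
  shows "iid_sequence PE L (\<lambda>n w. h (pairs (f n) w))"
proof
  have ind: "PE.indep_vars (\<lambda>_. N) pairs UNIV" using A by (simp add: assumption_A_def)
  have "PE.indep_vars (\<lambda>j. PiM {f j} (\<lambda>_. N)) (\<lambda>j w. restrict (\<lambda>i. pairs i w) {f j}) (UNIV :: nat set)"
    by (rule PE.indep_vars_restrict[OF ind])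
       (use f in \<open>auto simp: disjoint_family_on_def dest: injD\<close>)
  then have "PE.indep_vars (\<lambda>_. L) (\<lambda>j w. h (restrict (\<lambda>i. pairs i w) {f j} (f j))) (UNIV :: nat set)"
  proof (rule PE.indep_vars_compose2)
    fix j
    have "(\<lambda>z. z (f j)) \<in> PiM {f j} (\<lambda>_. N) \<rightarrow>\<^sub>M N" by (rule measurable_component_singleton) simp
    from measurable_compose[OF this h] show "(\<lambda>z. h (z (f j))) \<in> PiM {f j} (\<lambda>_. N) \<rightarrow>\<^sub>M L" .
  qed
  then show "PE.indep_vars (\<lambda>_. L) (\<lambda>n w. h (pairs (f n) w)) UNIV" by simp
  have "distr PE L (\<lambda>w. h (pairs x w)) = distr (distr PE N (pairs x)) L h" for x
    by (subst distr_distr) (auto simp: comp_def)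
  then show "distr PE L (\<lambda>w. h (pairs (f n) w)) = distr PE L (\<lambda>w. h (pairs (f 0) w))" for n
    using distr_pairs[of "f n"] distr_pairs[of "f 0"] by simp
qed

text \<open>The sign makes \<open>exp (X x w)\<close> the factor \<open>1 / \<rho>\<close> that
  multiplies \<open>Q\<close> when the recursion passes the site \<open>x\<close>.\<close>

definition X :: "int \<Rightarrow> env \<Rightarrow> real" where "X x w = - ln (rho p x w)"

lemma X_eq: "X x w = (\<lambda>z. - ln ((1 - fst z) / fst z)) (pairs x w)"
  by (simp add: X_def rho_def)

lemma X_measurable [measurable]: "X x \<in> borel_measurable PE"
  unfolding X_def[abs_def] rho_def by measurable

lemma X_mean: "PE.expectation (X x) = 0"
proof -
  have "PE.expectation (X x) = PE.expectation (X 0)"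
    unfolding X_eq[abs_def] by (rule pairs_integral_ident) measurable
  also have "\<dots> = 0" using A by (simp add: X_def[abs_def] assumption_A_def)
  finally show ?thesis .
qed

text \<open>Zero variance would mean \<open>rho = 1\<close>, that is \<open>p = 1/2\<close> almost
  surely, which (A.1) excludes.\<close>

lemma X_var_pos:
  assumes "integrable PE (\<lambda>w. (X 0 w)\<^sup>2)"
  shows "0 < PE.expectation (\<lambda>w. (X 0 w)\<^sup>2)"
proof -
  have "PE.expectation (\<lambda>w. (X 0 w)\<^sup>2) \<noteq> 0"
  proof
    assume "PE.expectation (\<lambda>w. (X 0 w)\<^sup>2) = 0"
    then have "AE w in PE. (X 0 w)\<^sup>2 = 0"
      using assms by (subst (asm) integral_nonneg_eq_0_iff_AE) auto
    then have "AE w in PE. p 0 w = 1 / 2"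
      using AE_good
    proof eventually_elim
      case (elim w)
      have p: "0 < p 0 w" "p 0 w < 1" using elim(2) by (auto simp: good_def)
      then have "rho p 0 w = 1" using elim(1) by (auto simp: X_def rho_def)
      then show ?case using p by (simp add: rho_def field_simps)
    qed
    then have "measure PE {w \<in> space PE. p 0 w = 1 / 2} = 1"
      by (subst PE.prob_eq_1) auto
    then show False using A by (simp add: assumption_A_def)
  qed
  then show ?thesis by (simp add: order.not_eq_order_implies_strict)
qed

end

locale square_integrable_environment = environment +
  assumes X_sq: "\<And>x. integrable PE (\<lambda>w. (X x w)\<^sup>2)"
begin

lemma X_sq_ident: "PE.expectation (\<lambda>w. (X x w)\<^sup>2) = PE.expectation (\<lambda>w. (X 0 w)\<^sup>2)"
  unfolding X_eq by (rule pairs_integral_ident(1)[of "\<lambda>z. (- ln ((1 - fst z) / fst z))\<^sup>2"]) measurable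

text \<open>With \<open>B = 0\<close> the recursion is a pure product, here the reciprocal of
  \<open>slope (- int n)\<close>. Bounded values infinitely often mean slopes bounded away from 0
  infinitely often, so their sum diverges. The exponent 3 is an arbitrary choice above 2.\<close>

lemma scale_unbounded_left:
  "AE w in PE. good w \<longrightarrow> (\<forall>K. \<exists>l. cookie_chain.scale (\<lambda>x. p x w) l < K)"
proof -
  define Z :: "nat \<Rightarrow> env \<Rightarrow> real \<times> real" where "Z n w = (- X (- int n) w, 0)" for n w
  interpret Z: iid_sequence PE "borel \<Otimes>\<^sub>M borel" Z
  proof -
    have "iid_sequence PE (borel \<Otimes>\<^sub>M borel) (\<lambda>n w. (\<lambda>z. (ln ((1 - fst z) / fst z), 0::real)) (pairs (- int n) w))"
      by (rule iid_pairs) (auto simp: inj_def)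
    then show "iid_sequence PE (borel \<Otimes>\<^sub>M borel) Z" by (simp add: Z_def[abs_def] X_def rho_def)
  qed
  interpret Z: critical_recursion PE Z 3
  proof
    show "integrable PE (\<lambda>w. (fst (Z 0 w))\<^sup>2)" "0 < PE.expectation (\<lambda>w. (fst (Z 0 w))\<^sup>2)"
      using X_sq[of 0] X_var_pos by (auto simp: Z_def)
    show "PE.expectation (\<lambda>w. fst (Z 0 w)) = 0" using X_mean[of 0] by (simp add: Z_def)
  qed (simp_all add: Z_def)
  have "AE w in PE. \<exists>K::nat. \<exists>\<^sub>\<infinity>n. Z.Q n w \<le> real K \<and> Z n w \<in> UNIV"
  proof (rule Z.small_values_infinitely_often)
    show "UNIV \<in> sets ((borel :: real measure) \<Otimes>\<^sub>M (borel :: real measure))" by (subst borel_prod) simp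
  qed (simp add: PE.prob_space)
  then show ?thesis
  proof eventually_elim
    case (elim w)
    show ?case
    proof (intro impI allI)
      fix B :: real
      assume g: "good w"
      interpret cookie_chain "\<lambda>x. p x w" by (rule good_chain) fact
      obtain K :: nat where K: "\<And>m. \<exists>n>m. Z.Q n w \<le> real K" using elim by (auto simp: INFM_nat)
      have Q: "Z.Q n w * slope (- int n) = 1" for n
      proof (induction n)
        case 0
        then show ?case by (simp add: Z.Q_0 slope_0)
      next
        case (Suc n)
        have r: "rho p (- int n) w = \<rho> (- int n)" by (simp add: rho_def \<rho>_def)
        have s: "slope (- int n) = slope (- int (Suc n)) * \<rho> (- int n)"
        proof -
          have "- int (Suc n) = - int n - 1" by simp
          then show ?thesis using slope_step[of "- int n"] by metis
        qed
        have "Z.Q (Suc n) w = \<rho> (- int n) * Z.Q n w"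
          using \<rho>_pos[of "- int n"] by (simp add: Z.Q_Suc Z_def X_def r)
        then show ?case using Suc unfolding s by (simp add: algebra_simps)
      qed
      have Kpos: "0 < real K"
        using K[of 0] Z.Q_pos by (metis less_le_trans)
      have sl: "1 / real K \<le> slope (- int n)" if "Z.Q n w \<le> real K" for n
      proof -
        have "1 \<le> real K * slope (- int n)"
          using mult_right_mono[OF that, of "slope (- int n)"] Q[of n] slope_pos[of "- int n"] by simp
        then show ?thesis using Kpos by (simp add: field_simps)
      qed
      have "\<exists>n::nat. scale (- int n) \<le> - (real j / real K)" for j
      proof (induction j)
        case 0
        then show ?case by (intro exI[of _ 0]) (simp add: scale_0)
      next
        case (Suc j)
        then obtain n :: nat where n: "scale (- int n) \<le> - (real j / real K)" by blast
        obtain n' where n': "n < n'" "Z.Q n' w \<le> real K" using K by blast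
        have "scale (- int n' + 1) \<le> scale (- int n)" using n' by (intro scale_mono) auto
        moreover have "scale (- int n' + 1) = scale (- int n') + slope (- int n')" by (rule scale_step)
        ultimately show ?case using n sl[OF n'(2)] by (intro exI[of _ n']) (simp add: add_divide_distrib)
      qed
      moreover obtain j :: nat where "- B * real K < real j" using reals_Archimedean2 by blast
      then have "- (real j / real K) < B" using Kpos by (simp add: field_simps)
      ultimately show "\<exists>l. scale l < B" by (meson le_less_trans)
    qed
  qed
qed

lemma recurrent_potential:
  assumes q: "2 < q" and mom: "integrable PE (\<lambda>w. ln (1 + real (ncookies w 1) * rho p 1 w) powr q)"
  shows "AE w in PE. good w \<longrightarrow> (\<exists>K. \<exists>e>0. \<exists>\<^sub>\<infinity>n::nat.
      1 + (\<Sum>x\<in>{1..int n}. cookie_chain.slope (\<lambda>x. p x w) x * real (ncookies w x))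
        \<le> K * cookie_chain.slope (\<lambda>x. p x w) (int n)
      \<and> ncookies w (int n + 1) = 0 \<and> p (int n + 1) w \<le> 1 - e)"
proof -
  define Z :: "nat \<Rightarrow> env \<Rightarrow> real \<times> real" where "Z n w = (X (int n + 1) w, real (ncookies w (int n + 1)))" for n w
  interpret Z: iid_sequence PE "borel \<Otimes>\<^sub>M borel" Z
  proof -
    have "iid_sequence PE (borel \<Otimes>\<^sub>M borel)
       (\<lambda>n w. (\<lambda>z. (- ln ((1 - fst z) / fst z), real (the_enat (snd z)))) (pairs (int n + 1) w))"
    proof (rule iid_pairs)
      have [measurable]: "(\<lambda>z. real (the_enat (snd z))) \<in> borel_measurable N"
        by (rule measurable_compose[OF measurable_snd]) simp
      show "(\<lambda>z. (- ln ((1 - fst z) / fst z), real (the_enat (snd z)))) \<in> N \<rightarrow>\<^sub>M borel \<Otimes>\<^sub>M borel"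
        by measurable
    qed (auto simp: inj_def)
    then show "iid_sequence PE (borel \<Otimes>\<^sub>M borel) Z" by (simp add: Z_def[abs_def] X_def rho_def ncookies_def)
  qed
  interpret Z: critical_recursion PE Z q
  proof
    show "integrable PE (\<lambda>w. (fst (Z 0 w))\<^sup>2)" "0 < PE.expectation (\<lambda>w. (fst (Z 0 w))\<^sup>2)"
      using X_sq[of 1] X_sq_ident[of 1] X_var_pos X_sq[of 0] by (auto simp: Z_def)
    show "PE.expectation (\<lambda>w. fst (Z 0 w)) = 0" using X_mean[of 1] by (simp add: Z_def)
    have "AE w in PE. ln (1 + real (ncookies w 1) * rho p 1 w) powr q = ln (1 + snd (Z 0 w) * exp (- fst (Z 0 w))) powr q"
      using AE_good
    proof eventually_elim
      case (elim w)
      then have "0 < rho p 1 w" by (simp add: good_def rho_def)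
      then show ?case by (simp add: Z_def X_def)
    qed
    then show "integrable PE (\<lambda>w. ln (1 + snd (Z 0 w) * exp (- fst (Z 0 w))) powr q)"
    proof -
      have [measurable]: "(\<lambda>w. real (ncookies w x)) \<in> borel_measurable PE" for x
        by (rule measurable_compose[OF ncookies_measurable]) simp
      have "(\<lambda>w. ln (1 + real (ncookies w 1) * rho p 1 w) powr q) \<in> borel_measurable PE"
        unfolding rho_def by measurable
      moreover have "(\<lambda>w. ln (1 + snd (Z 0 w) * exp (- fst (Z 0 w))) powr q) \<in> borel_measurable PE"
        by measurable
      moreover assume "AE w in PE. ln (1 + real (ncookies w 1) * rho p 1 w) powr q = ln (1 + snd (Z 0 w) * exp (- fst (Z 0 w))) powr q"
      ultimately show ?thesis using mom integrable_cong_AE by blast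
    qed
  qed (use q in \<open>simp_all add: Z_def\<close>)
  have "0 < PE.prob {w \<in> space PE. cookies w 1 = 0}"
    using prob_pair_ident[of "UNIV \<times> {0}" 1] A by (simp add: assumption_A_def pair_measureI)
  \<comment> \<open>Cutting off large \<open>X\<close> keeps \<open>p\<close> away from 1 without
    losing all the probability of having no cookie.\<close>
  then obtain t :: nat where t: "PE.prob {w \<in> space PE. X 1 w > real t} < PE.prob {w \<in> space PE. cookies w 1 = 0}"
    using order_tendstoD(2)[OF PE.prob_gt_tendsto_0[OF X_measurable[of 1]]]
    by (fastforce simp: eventually_sequentially)
  define G :: "(real \<times> real) set" where "G = {..real t} \<times> {0}"
  have G [measurable]: "G \<in> sets (borel \<Otimes>\<^sub>M borel)" unfolding G_def by simp
  have "0 < PE.prob {w \<in> space PE. Z 0 w \<in> G}"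
  proof -
    have "PE.prob {w \<in> space PE. cookies w 1 = 0}
        \<le> PE.prob ({w \<in> space PE. Z 0 w \<in> G} \<union> {w \<in> space PE. X 1 w > real t})"
      by (rule PE.finite_measure_mono) (auto simp: Z_def G_def ncookies_def zero_enat_def)
    also have "\<dots> \<le> PE.prob {w \<in> space PE. Z 0 w \<in> G} + PE.prob {w \<in> space PE. X 1 w > real t}"
      by (rule measure_Un_le) measurable
    finally show ?thesis using t by simp
  qed
  from Z.small_values_infinitely_often[OF G this] show ?thesis
  proof eventually_elim
    case (elim w)
    show ?case
    proof
      assume g: "good w"
      interpret cookie_chain "\<lambda>x. p x w" by (rule good_chain) fact
      obtain K :: nat where K: "\<exists>\<^sub>\<infinity>n. Z.Q n w \<le> real K \<and> Z n w \<in> G" using elim by blast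
      let ?s = "\<lambda>n. \<Sum>x\<in>{1..int n}. slope x * real (ncookies w x)"
      have Q: "Z.Q n w * slope (int n) = 1 + ?s n" for n
      proof (induction n)
        case 0
        then show ?case by (simp add: Z.Q_0 slope_0)
      next
        case (Suc n)
        have r: "rho p (int n + 1) w = \<rho> (int n + 1)" by (simp add: rho_def \<rho>_def)
        have s: "slope (int n + 1) = slope (int n) * \<rho> (int n + 1)"
          using slope_step[of "int n + 1"] by simp
        have q: "Z.Q (Suc n) w = Z.Q n w / \<rho> (int n + 1) + real (ncookies w (int n + 1))"
        proof -
          have "exp (X (int n + 1) w) = 1 / \<rho> (int n + 1)"
            unfolding X_def r using \<rho>_pos[of "int n + 1"] by (simp add: exp_minus inverse_eq_divide)
          then show ?thesis by (simp add: Z.Q_Suc Z_def)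
        qed
        have "Z.Q (Suc n) w * slope (int n + 1) = Z.Q n w * slope (int n) + slope (int n + 1) * real (ncookies w (int n + 1))"
        proof -
          have "Z.Q n w / \<rho> (int n + 1) * slope (int n + 1) = Z.Q n w * slope (int n)"
            unfolding s using \<rho>_pos[of "int n + 1"] by simp
          then show ?thesis unfolding q distrib_right by (simp add: mult.commute)
        qed
        moreover have "{1..int (Suc n)} = insert (int n + 1) {1..int n}" by auto
        ultimately show ?case using Suc by (simp add: add.commute)
      qed
      \<comment> \<open>\<open>X \<le> t\<close> means \<open>p / (1 - p) \<le> exp t\<close>, which
        is \<open>p \<le> 1 - e\<close> for this \<open>e\<close>.\<close>
      define e where "e = 1 / (1 + exp (real t))"
      have e: "0 < e" by (simp add: e_def add_pos_pos)
      have "\<exists>\<^sub>\<infinity>n. 1 + ?s n \<le> real K * slope (int n) \<and> ncookies w (int n + 1) = 0 \<and> p (int n + 1) w \<le> 1 - e"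
        using K
      proof (rule INFM_mono)
        fix n assume n: "Z.Q n w \<le> real K \<and> Z n w \<in> G"
        have "1 + ?s n \<le> real K * slope (int n)"
          unfolding Q[symmetric] using n slope_pos[of "int n"] by (intro mult_right_mono) auto
        moreover have "p (int n + 1) w \<le> 1 - e"
        proof -
          have p: "0 < p (int n + 1) w" "p (int n + 1) w < 1" by (rule p_pos p_less_1)+
          then have rp: "0 < rho p (int n + 1) w" by (simp add: rho_def)
          have "- ln (rho p (int n + 1) w) \<le> real t" using n by (auto simp: Z_def G_def X_def)
          then have "ln (1 / rho p (int n + 1) w) \<le> real t" using rp by (simp add: ln_div)
          then have "1 / rho p (int n + 1) w \<le> exp (real t)" using rp by (metis exp_le_cancel_iff exp_ln divide_pos_pos zero_less_one)
          then have "p (int n + 1) w \<le> exp (real t) * (1 - p (int n + 1) w)"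
            using p by (simp add: rho_def field_simps)
          then have "p (int n + 1) w * (1 + exp (real t)) \<le> exp (real t)" by (simp add: algebra_simps)
          then have "p (int n + 1) w \<le> exp (real t) / (1 + exp (real t))"
            by (simp add: pos_le_divide_eq add_pos_pos)
          also have "\<dots> = 1 - e" unfolding e_def using add_pos_pos[of 1 "exp (real t)"] by (simp add: field_simps)
          finally show ?thesis .
        qed
        moreover have "ncookies w (int n + 1) = 0" using n by (auto simp: Z_def G_def)
        ultimately show "1 + ?s n \<le> real K * slope (int n) \<and> ncookies w (int n + 1) = 0 \<and> p (int n + 1) w \<le> 1 - e" by blast
      qed
      with e show "\<exists>K. \<exists>e>0. \<exists>\<^sub>\<infinity>n. 1 + ?s n \<le> K * slope (int n) \<and> ncookies w (int n + 1) = 0 \<and> p (int n + 1) w \<le> 1 - e"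
        by blast
    qed
  qed
qed

section \<open>Blocks that contain a site with many cookies\<close>

abbreviation big :: "real \<Rightarrow> int \<Rightarrow> env \<Rightarrow> bool" where
  "big t x w \<equiv> ereal t < log_enat (cookies w x)"

lemma big_measurable [measurable]: "Measurable.pred PE (\<lambda>w. big t x w)"
  by (rule measurable_compose[OF cookies_measurable]) simp

lemma prob_no_big_cookies:
  fixes J :: "int set"
  assumes "finite J" "J \<noteq> {}"
  shows "PE.prob {w \<in> space PE. \<forall>x\<in>J. \<not> big t x w}
    = (1 - PE.prob {w \<in> space PE. big t 0 w}) ^ card J"
proof -
  have ind: "PE.indep_vars (\<lambda>_. N) pairs UNIV" using A by (simp add: assumption_A_def)
  let ?A = "{z :: real \<times> enat. \<not> ereal t < log_enat (snd z)}"
  have "?A = UNIV \<times> {z. \<not> ereal t < log_enat z}" by auto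
  moreover have "(UNIV :: real set) \<times> {z. \<not> ereal t < log_enat z} \<in> sets N" by (rule pair_measureI) auto
  ultimately have meas: "?A \<in> sets N" by simp
  have "{w \<in> space PE. \<forall>x\<in>J. \<not> big t x w} = (\<Inter>x\<in>J. pairs x -` ?A \<inter> space PE)"
    using assms by auto
  then have "PE.prob {w \<in> space PE. \<forall>x\<in>J. \<not> big t x w}
      = (\<Prod>x\<in>J. PE.prob (pairs x -` ?A \<inter> space PE))"
    using PE.indep_varsD[OF ind assms(2,1), of "\<lambda>_. ?A"] meas by simp
  also have "\<dots> = (\<Prod>x\<in>J. 1 - PE.prob {w \<in> space PE. big t 0 w})"
  proof (rule prod.cong[OF refl])
    fix x
    have "PE.prob (pairs x -` ?A \<inter> space PE) = PE.prob {w \<in> space PE. pairs x w \<in> ?A}"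
      by (intro arg_cong[where f = PE.prob]) auto
    also have "\<dots> = PE.prob {w \<in> space PE. pairs 0 w \<in> ?A}" by (rule prob_pair_ident[OF meas])
    also have "\<dots> = 1 - PE.prob {w \<in> space PE. big t 0 w}"
      using PE.prob_neg[of "\<lambda>w. big t 0 w"] by simp
    finally show "PE.prob (pairs x -` ?A \<inter> space PE) = 1 - PE.prob {w \<in> space PE. big t 0 w}" .
  qed
  finally show ?thesis by simp
qed

abbreviation walk :: "nat \<Rightarrow> env \<Rightarrow> real" where
  "walk z w \<equiv> \<Sum>i<z. X (int i + 1) w"

definition flat :: "real \<Rightarrow> nat \<Rightarrow> env set" where
  "flat t n = {w \<in> space PE. \<forall>z\<le>n. \<bar>walk z w\<bar> < t}"

lemma flat_sets [measurable]: "flat t n \<in> sets PE"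
  unfolding flat_def by measurable

lemma prob_not_flat:
  assumes "0 < t"
  shows "PE.prob (space PE - flat t n) \<le> real n * PE.expectation (\<lambda>w. (X 0 w)\<^sup>2) / t\<^sup>2"
proof -
  interpret Z: iid_sequence PE N "\<lambda>n. pairs (int n + 1)"
    using iid_pairs[of "\<lambda>n. int n + 1" "\<lambda>z. z" N] by (simp add: inj_def)
  let ?f = "\<lambda>z :: real \<times> enat. - ln ((1 - fst z) / fst z)"
  have f: "?f (pairs x w) = X x w" for x w by (simp add: X_eq)
  have "PE.prob {w \<in> space PE. \<exists>k\<le>n. t \<le> \<bar>\<Sum>i<k. ?f (pairs (int i + 1) w)\<bar>}
      \<le> real n * PE.expectation (\<lambda>w. (?f (pairs (int 0 + 1) w))\<^sup>2) / t\<^sup>2"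
  proof (rule Z.maximal_inequality[OF _ _ _ assms])
    show "integrable PE (\<lambda>w. (?f (pairs (int 0 + 1) w))\<^sup>2)" unfolding f by (rule X_sq)
    show "PE.expectation (\<lambda>w. ?f (pairs (int 0 + 1) w)) = 0" unfolding f using X_mean[of 1] by simp
  qed measurable
  moreover have "space PE - flat t n = {w \<in> space PE. \<exists>k\<le>n. t \<le> \<bar>walk k w\<bar>}"
    by (auto simp: flat_def not_less)
  ultimately show ?thesis unfolding f using X_sq_ident[of 1] by simp
qed

lemma big_cookies_in_blocks:
  assumes lam: "0 < lam" "lam < 2"
    and tail: "Liminf at_top (\<lambda>t::real. ereal (t powr lam *
        measure PE {w \<in> space PE. log_enat (cookies w 0) > ereal t})) > 0"
  obtains T where "1 < T" "2 < T\<^sup>2"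
    "AE w in PE. \<forall>\<^sub>F k in sequentially. w \<in> flat (T ^ k / 4) (2 ^ (k + 2)) \<and>
      (\<exists>x\<in>{2 ^ k..<2 ^ (k + 1)}. big (T ^ k) x w)"
proof -
  \<comment> \<open>Any exponent strictly between \<open>lam\<close> and 2 would do. From
    \<open>l < 2\<close> follows \<open>2 < T\<^sup>2\<close>, so the fluctuations are negligible
    against \<open>T ^ k\<close>; from \<open>lam < l\<close> follows \<open>T powr lam < 2\<close>,
    so the mean number of suitable sites in a block is eventually at least \<open>c * r ^ k\<close>
    with \<open>r > 1\<close>.\<close>
  define l where "l = (lam + 2) / 2"
  have l: "0 < l" "l < 2" "lam < l" using lam by (auto simp: l_def)
  define T :: real where "T = 2 powr (1 / l)"
  have T1: "1 < T" unfolding T_def using l by simp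
  have T2: "2 < T\<^sup>2"
  proof -
    have "T\<^sup>2 = 2 powr (2 / l)" unfolding T_def by (simp add: powr_power)
    moreover have "2 powr 1 < (2::real) powr (2 / l)" using l by (intro powr_less_mono) auto
    ultimately show ?thesis by simp
  qed
  have Tl: "T powr lam < 2"
  proof -
    have "T powr lam = 2 powr (lam / l)" unfolding T_def by (simp add: powr_powr)
    moreover have "(2::real) powr (lam / l) < 2 powr 1" using l by (intro powr_less_mono) auto
    ultimately show ?thesis by simp
  qed
  define v where "v = PE.expectation (\<lambda>w. (X 0 w)\<^sup>2)"
  have v: "0 \<le> v" by (simp add: v_def)
  have "AE w in PE. \<forall>\<^sub>F k in sequentially. w \<in> space PE - (space PE - flat (T ^ k / 4) (2 ^ (k + 2)))"
  proof (rule borel_cantelli_AE1)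
    show "summable (\<lambda>k. PE.prob (space PE - flat (T ^ k / 4) (2 ^ (k + 2))))"
    proof (rule summable_comparison_test')
      have "2 / T\<^sup>2 < 1" using T2 by (subst divide_less_eq_1_pos) auto
      then show "summable (\<lambda>k. 64 * v * (2 / T\<^sup>2) ^ k)" by (intro summable_mult summable_geometric) simp
      fix k
      have "PE.prob (space PE - flat (T ^ k / 4) (2 ^ (k + 2))) \<le> real (2 ^ (k + 2)) * v / (T ^ k / 4)\<^sup>2"
        unfolding v_def using T1 by (intro prob_not_flat) simp
      also have "\<dots> = 64 * v * (2 / T\<^sup>2) ^ k"
        using T1 by (simp add: power_divide power_add power_mult[symmetric] mult.commute field_simps)
      finally show "norm (PE.prob (space PE - flat (T ^ k / 4) (2 ^ (k + 2)))) \<le> 64 * v * (2 / T\<^sup>2) ^ k" by simp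
    qed
  qed (auto simp: PE.emeasure_eq_measure)
  then have flat: "AE w in PE. \<forall>\<^sub>F k in sequentially. w \<in> flat (T ^ k / 4) (2 ^ (k + 2))"
    by eventually_elim (auto elim: eventually_mono)
  let ?pi = "\<lambda>t. PE.prob {w \<in> space PE. big t 0 w}"
  obtain c where c: "0 < ereal c" "ereal c < Liminf at_top (\<lambda>t. ereal (t powr lam * ?pi t))"
    using ereal_dense2[OF tail] by auto
  from less_LiminfD[OF c(2)] have "\<forall>\<^sub>F t in at_top. c < t powr lam * ?pi t" by simp
  moreover have "filterlim (\<lambda>k. T ^ k) at_top sequentially" 
    by (rule filterlim_at_infinity_imp_filterlim_at_top[OF filterlim_realpow_sequentially_gt1]) (use T1 in auto)
  ultimately have "\<forall>\<^sub>F k in sequentially. c < (T ^ k) powr lam * ?pi (T ^ k)" by (rule eventually_compose_filterlim)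
  then obtain k0 where k0: "\<And>k. k0 \<le> k \<Longrightarrow> c < (T ^ k) powr lam * ?pi (T ^ k)"
    by (auto simp: eventually_sequentially)
  define r where "r = 2 / T powr lam"
  have r: "1 < r" using Tl T1 by (simp add: r_def field_simps)
  let ?nb = "\<lambda>k. {w \<in> space PE. \<forall>x\<in>{2 ^ k..<2 ^ (k + 1)}. \<not> big (T ^ k) x w}"
  have "AE w in PE. \<forall>\<^sub>F k in sequentially. w \<in> space PE - ?nb k"
  proof (rule borel_cantelli_AE1)
    show "summable (\<lambda>k. PE.prob (?nb k))"
    proof (rule summable_comparison_test')
      show "summable (\<lambda>k. 1 / c * (1 / r) ^ k)" using r by (intro summable_mult summable_geometric) simp
      fix k assume k: "k0 \<le> k"
      let ?q = "?pi (T ^ k)"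
      have card: "card {(2::int) ^ k..<2 ^ (k + 1)} = 2 ^ k" by (simp add: nat_power_eq)
      have "PE.prob (?nb k) = (1 - ?q) ^ (2 ^ k)"
        unfolding card[symmetric] by (rule prob_no_big_cookies) auto
      also have "\<dots> \<le> exp (- ?q) ^ (2 ^ k)"
        using exp_ge_add_one_self[of "- ?q"] by (intro power_mono) auto
      also have "\<dots> = exp (- (2 ^ k * ?q))" by (simp add: exp_of_nat_mult[symmetric])
      also have "\<dots> \<le> exp (- (c * r ^ k))"
      proof -
        have "(T ^ k) powr lam = (T powr lam) ^ k" using T1 by (simp add: powr_power powr_realpow[symmetric] powr_powr mult.commute)
        then have "c < (T powr lam) ^ k * ?q" using k0[OF k] by simp
        then have "c * r ^ k \<le> (T powr lam) ^ k * ?q * r ^ k" using r by (intro mult_right_mono) auto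
        also have "\<dots> = 2 ^ k * ?q" using T1 by (simp add: r_def power_divide)
        finally show ?thesis by simp
      qed
      \<comment> \<open>This crude bound for the exponential suffices, since \<open>r ^ k\<close>
        grows geometrically.\<close>
      also have "\<dots> \<le> 1 / (c * r ^ k)"
      proof -
        have pos: "0 < c * r ^ k" using c r by simp
        have "c * r ^ k \<le> exp (c * r ^ k)" using exp_ge_add_one_self[of "c * r ^ k"] by linarith
        then show ?thesis using pos by (simp add: exp_minus field_simps)
      qed
      also have "\<dots> = 1 / c * (1 / r) ^ k" by (simp add: power_divide)
      finally show "norm (PE.prob (?nb k)) \<le> 1 / c * (1 / r) ^ k" by simp
    qed
  qed (auto simp: PE.emeasure_eq_measure)
  with flat have "AE w in PE. \<forall>\<^sub>F k in sequentially. w \<in> flat (T ^ k / 4) (2 ^ (k + 2)) \<and>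
      (\<exists>x\<in>{2 ^ k..<2 ^ (k + 1)}. big (T ^ k) x w)"
  proof eventually_elim
    case (elim w)
    then show ?case by eventually_elim auto
  qed
  with T1 T2 show thesis by (rule that)
qed

text \<open>Flatness puts all slopes of the strip between \<open>exp (- t / 4)\<close> and
  \<open>exp (t / 4)\<close>, so one attempt succeeds with probability
  \<open>q \<ge> exp (- t / 2) / 2 ^ (k + 2)\<close>. More than \<open>exp t\<close> cookies make
  \<open>q * n\<close> at least \<open>exp (t / 2) / 2 ^ (k + 2)\<close>, and
  \<open>(1 - q) ^ n \<le> exp (- (q * n)) \<le> 1 / (q * n)\<close>.\<close>

lemma backtrack_estimate:
  assumes g: "good w" and flat: "w \<in> flat (t / 4) (2 ^ (k + 2))"
    and x: "x \<in> {2 ^ k..<2 ^ (k + 1)}" and big: "big t x w"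
  shows "cookie_chain.hit (\<lambda>x. p x w) (\<lambda>m z. z = x - 1 \<and> m x = 0) (\<lambda>m y. 2 ^ (k + 2) \<le> y) j (ncookies w) 0
    \<le> 2 ^ (k + 2) * exp (- t / 2)"
proof -
  interpret cookie_chain "\<lambda>x. p x w" by (rule good_chain) fact
  let ?Y = "2 ^ (k + 2) :: int"
  have xY: "0 \<le> x" "x < ?Y" using x by (auto intro: order_trans[of _ "2 ^ k"] simp: less_trans)
  have sl: "slope (int z) = exp (- walk z w)" for z
  proof (induction z)
    case (Suc z)
    have "slope (int z + 1) = slope (int z) * rho p (int z + 1) w"
      using slope_step[of "int z + 1"] by (simp add: \<rho>_def rho_def)
    moreover have "0 < rho p (int z + 1) w" using p_pos p_less_1 by (simp add: rho_def)
    then have "rho p (int z + 1) w = exp (- X (int z + 1) w)" by (simp add: X_def)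
    ultimately have "slope (int z + 1) = exp (- walk z w) * exp (- X (int z + 1) w)" using Suc by simp
    then show ?case by (simp add: exp_add[symmetric] add.commute)
  qed (simp add: slope_0)
  have slb: "exp (- (t / 4)) \<le> slope z \<and> slope z \<le> exp (t / 4)" if "0 \<le> z" "z \<le> ?Y" for z
  proof -
    have "nat z \<le> 2 ^ (k + 2)" using that by (simp add: nat_le_iff)
    then have "\<bar>walk (nat z) w\<bar> < t / 4" using flat by (auto simp: flat_def)
    then show ?thesis using sl[of "nat z"] that by auto
  qed
  define q where "q = slope x / (scale ?Y - scale x)"
  have "scale ?Y - scale x = (\<Sum>z\<in>{x..<?Y}. slope z)" using xY by (intro scale_diff) auto
  also have "\<dots> \<le> (\<Sum>z\<in>{x..<?Y}. exp (t / 4))" using slb xY by (intro sum_mono) auto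
  also have "\<dots> \<le> 2 ^ (k + 2) * exp (t / 4)"
  proof -
    have "real (nat (?Y - x)) \<le> real_of_int ?Y" using xY by (subst of_nat_nat) auto
    then show ?thesis by (simp add: mult_right_mono)
  qed
  finally have D: "scale ?Y - scale x \<le> 2 ^ (k + 2) * exp (t / 4)" .
  have Dpos: "0 < scale ?Y - scale x" using scale_strict_mono[OF xY(2)] by simp
  have q1: "q \<le> 1" unfolding q_def using scale_step[of x] scale_mono[of "x + 1" ?Y] xY Dpos by simp
  have "exp (- (t / 4)) / (2 ^ (k + 2) * exp (t / 4)) \<le> q"
    unfolding q_def using slb[of x] xY D Dpos slope_pos[of x] by (intro frac_le) (auto simp: less_imp_le)
  moreover have "exp (- (t / 4)) / (2 ^ (k + 2) * exp (t / 4)) = exp (- (t / 2)) / 2 ^ (k + 2)"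
    by (simp add: exp_minus field_simps exp_add[symmetric])
  ultimately have q: "exp (- (t / 2)) / 2 ^ (k + 2) \<le> q" by simp
  let ?n = "ncookies w x"
  have "cookies w x = enat ?n" using g by (simp add: good_def)
  then have "?n \<noteq> 0" "t < ln (real ?n)" using big by (auto simp: log_enat_def split: if_splits)
  then have n: "exp t \<le> real ?n" by (metis exp_le_cancel_iff exp_ln less_imp_le of_nat_0_less_iff neq0_conv)
  have "exp (t / 2) / 2 ^ (k + 2) = exp (- (t / 2)) / 2 ^ (k + 2) * exp t"
    by (simp add: exp_minus field_simps exp_add[symmetric])
  also have "\<dots> \<le> q * real ?n" using q n by (intro mult_mono) (auto intro: order_trans[OF _ q])
  finally have qn: "exp (t / 2) / 2 ^ (k + 2) \<le> q * real ?n" .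
  have "hit (\<lambda>m z. z = x - 1 \<and> m x = 0) (at_least ?Y) j (ncookies w) 0 \<le> (1 - q) ^ ?n"
    unfolding q_def using xY by (intro backtrack_bound) auto
  also have "\<dots> \<le> exp (- q) ^ ?n" using q1 exp_ge_add_one_self[of "- q"] by (intro power_mono) auto
  also have "\<dots> = exp (- (q * real ?n))" by (simp add: exp_of_nat_mult[symmetric] mult.commute)
  also have "\<dots> \<le> exp (- (exp (t / 2) / 2 ^ (k + 2)))" using qn by simp
  also have "\<dots> \<le> 2 ^ (k + 2) * exp (- t / 2)"
  proof -
    let ?u = "exp (t / 2) / 2 ^ (k + 2)"
    have "?u \<le> exp ?u" using exp_ge_add_one_self[of ?u] by linarith
    moreover have "0 < ?u" by simp
    ultimately have "inverse (exp ?u) \<le> inverse ?u" by (rule le_imp_inverse_le)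
    then have "exp (- ?u) \<le> 1 / ?u" by (simp only: exp_minus inverse_eq_divide)
    then show ?thesis by (simp add: exp_minus field_simps)
  qed
  finally show ?thesis .
qed

end

section \<open>Deterministic facts about nearest-neighbour sequences\<close>

lemma visits_zero_infinitely_often:
  fixes s :: "nat \<Rightarrow> int"
  assumes nn: "\<And>n. s (Suc n) = s n + 1 \<or> s (Suc n) = s n - 1"
    and low: "\<And>n. \<exists>j\<ge>n. s j \<le> 0" and high: "\<And>n. \<exists>j\<ge>n. 1 \<le> s j"
  shows "infinite {n. s n = 0}"
  unfolding infinite_nat_iff_unbounded_le
proof
  fix n
  obtain i where i: "n \<le> i" "1 \<le> s i" using high by blast
  have "\<exists>j. i \<le> j \<and> s j \<le> 0" using low by blast
  then obtain j where j: "i \<le> j" "s j \<le> 0" and least: "\<forall>l<j. \<not> (i \<le> l \<and> s l \<le> 0)"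
    using exists_least_iff[of "\<lambda>j. i \<le> j \<and> s j \<le> 0"] by blast
  have "j \<noteq> i" using i j by auto
  then obtain l where l: "j = Suc l" "i \<le> l" using j by (cases j) auto
  then have "\<not> s l \<le> 0" using least by blast
  then have "s j = 0" using nn[of l] j l by auto
  then show "\<exists>m\<ge>n. m \<in> {n. s n = 0}" using i j by (intro exI[of _ j]) auto
qed

text \<open>If the sequence is below \<open>x k\<close> after having reached it, consider the
  largest \<open>K\<close> whose site \<open>x K\<close> has been reached by then. The step from
  \<open>x K\<close> down to \<open>x K - 1\<close> requires an earlier visit to
  \<open>2 ^ (K + 2)\<close> or beyond, which lies above \<open>x (K + 1)\<close> and contradicts
  the choice of \<open>K\<close>.\<close>

lemma escapes_to_infinity:
  fixes s :: "nat \<Rightarrow> int"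
  assumes start: "s 0 = 0" and nn: "\<And>n. s (Suc n) = s n + 1 \<or> s (Suc n) = s n - 1"
    and high: "\<And>r. \<exists>j. r \<le> s j"
    and block: "\<And>k. k0 \<le> k \<Longrightarrow> 2 ^ k \<le> x k \<and> x k < 2 ^ (k + 1)"
    and no: "\<And>k j. k0 \<le> k \<Longrightarrow> s j = x k \<Longrightarrow> s (Suc j) = x k - 1 \<Longrightarrow> \<exists>l\<le>j. 2 ^ (k + 2) \<le> s l"
  shows "filterlim s at_top sequentially"
  unfolding filterlim_at_top eventually_sequentially
proof
  fix r :: int
  have pow: "int n \<le> 2 ^ n" for n by (metis less_exp of_nat_le_iff of_nat_numeral of_nat_power order_less_imp_le)
  define k where "k = max k0 (nat r)"
  have k: "k0 \<le> k" "r \<le> x k"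
    using block[of k] pow[of k] by (auto simp: k_def)
  obtain i where i: "x k \<le> s i" using high by blast
  have "x k \<le> s n" if n: "i \<le> n" for n
  proof (rule ccontr)
    assume "\<not> x k \<le> s n"
    then have sn: "s n < x k" by simp
    define P where "P k' \<longleftrightarrow> k \<le> k' \<and> (\<exists>l\<le>n. x k' \<le> s l)" for k'
    have "P k" unfolding P_def using i n by blast
    moreover have "\<forall>k'. P k' \<longrightarrow> k' \<le> nat (Max (s ` {..n}))"
    proof (intro allI impI)
      fix k' assume "P k'"
      then obtain l where l: "k \<le> k'" "l \<le> n" "x k' \<le> s l" by (auto simp: P_def)
      have "s l \<le> Max (s ` {..n})" using l by (intro Max_ge) auto
      moreover have "2 ^ k' \<le> x k'" using block[of k'] l k by auto
      ultimately show "k' \<le> nat (Max (s ` {..n}))" using pow[of k'] l by linarith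
    qed
    ultimately obtain K where K: "P K" "\<And>k'. P k' \<Longrightarrow> k' \<le> K"
      using ex_has_greatest_nat[of P k "\<lambda>k. k"] by (metis (full_types) GreatestI_nat Greatest_le_nat)
    obtain l where l: "k \<le> K" "l \<le> n" "x K \<le> s l" using K(1) by (auto simp: P_def)
    have "k0 \<le> K" using l k by simp
    have xK: "x k \<le> x K"
    proof (cases "K = k")
      case False
      then have "2 ^ (k + 1) \<le> (2::int) ^ K" using l by (intro power_increasing) auto
      then show ?thesis using block[of k] block[of K] k \<open>k0 \<le> K\<close> by auto
    qed simp
    have "\<not> P (Suc K)" using K(2)[of "Suc K"] by auto
    then have below: "s m < x (Suc K)" if "m \<le> n" for m using that l unfolding P_def by fastforce
    have "\<exists>j. l \<le> j \<and> s j < x K" using sn xK l by (intro exI[of _ n]) auto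
    then obtain j where j: "l \<le> j" "s j < x K" and least: "\<forall>m<j. \<not> (l \<le> m \<and> s m < x K)"
      using exists_least_iff[of "\<lambda>j. l \<le> j \<and> s j < x K"] by blast
    have "j \<le> n" using least sn xK l by (meson le_less_linear less_le_trans)
    have "j \<noteq> l" using j l by auto
    then obtain j' where j': "j = Suc j'" "l \<le> j'" using j by (cases j) auto
    then have "x K \<le> s j'" using least by (metis lessI not_less)
    then have "s j' = x K" "s (Suc j') = x K - 1" using nn[of j'] j j' by auto
    from no[OF \<open>k0 \<le> K\<close> this] obtain m where m: "m \<le> j'" "2 ^ (K + 2) \<le> s m" by blast
    have "s m < x (Suc K)" using below[of m] m \<open>j \<le> n\<close> j' by simp
    also have "x (Suc K) < 2 ^ (K + 2)" using block[of "Suc K"] \<open>k0 \<le> K\<close> by simp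
    finally show False using m by simp
  qed
  then show "\<exists>N. \<forall>n\<ge>N. r \<le> s n" using k by (meson order_trans)
qed

section \<open>Both statements for the annealed walk\<close>

locale square_integrable_realization = square_integrable_environment + realization
begin

text \<open>The law of \<open>Ev\<close> is given only through cylinder sets; the formula at time 0
  recovers that it is \<open>PE\<close>.\<close>

lemma AE_transfer: "AE w in PE. P w \<Longrightarrow> AE a in M. P (Ev a)"
proof -
  assume "AE w in PE. P w"
  then obtain N where N: "{w \<in> space PE. \<not> P w} \<subseteq> N" "emeasure PE N = 0" "N \<in> sets PE" by (rule AE_E)
  have NS: "{w \<in> space PE. w \<in> N} = N" using sets.sets_into_space[OF N(3)] by auto
  have "prob {a \<in> space M. Ev a \<in> N} = (\<integral>w. (\<Sum>s\<in>paths 0. of_bool (w \<in> N) * path_weight w 0 s 0) \<partial>PE)"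
    by (rule prob_path_event[where P = "\<lambda>w s. w \<in> N"]) (simp_all add: NS N)
  also have "\<dots> = (\<integral>w. indicator N w \<partial>PE)"
    by (intro Bochner_Integration.integral_cong) (auto simp: path_weight_def split: split_indicator)
  also have "\<dots> = 0" using N by (simp add: PE.emeasure_eq_measure)
  finally have z: "prob {a \<in> space M. Ev a \<in> N} = 0" .
  have "{a \<in> space M. Ev a \<in> N} \<in> sets M" using N(3) by measurable
  then show ?thesis
    using z N(1) measurable_space[OF Ev_measurable]
    by (intro AE_I[where N = "{a \<in> space M. Ev a \<in> N}"]) (auto simp: emeasure_eq_measure)
qed

text \<open>This depends only on the scale function to the left. It serves recurrence, where the
  walk must not remain at nonpositive sites, as well as transience, where every block must be
  reached.\<close>

lemma AE_high: "AE a in M. \<exists>j\<ge>n. r \<le> S j a"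
proof (rule AE_hits_again)
  show "AE w in PE. good w \<longrightarrow> (\<forall>m y. m \<le> ncookies w \<longrightarrow>
      cookie_chain.hitting (\<lambda>x. p x w) (\<lambda>m y. r \<le> y) (\<lambda>m y. False) m y = 1)"
    using scale_unbounded_left
  proof eventually_elim
    case (elim w)
    show ?case
    proof (intro impI allI)
      fix m y assume g: "good w"
      interpret cookie_chain "\<lambda>x. p x w" by (rule good_chain) fact
      show "hitting (at_least r) never m y = 1"
      proof (cases "y \<le> r")
        case True
        then show ?thesis using elim g by (intro hits_level_right) auto
      qed (simp add: hitting_target)
    qed
  qed
qed

theorem recurrent:
  assumes "2 < q" "integrable PE (\<lambda>w. ln (1 + real (ncookies w 1) * rho p 1 w) powr q)"
  shows "AE a in M. infinite {n. S n a = 0}"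
proof -
  have low: "AE a in M. \<exists>j\<ge>n. S j a \<le> 0" for n
  proof (rule AE_hits_again)
    show "AE w in PE. good w \<longrightarrow> (\<forall>m y. m \<le> ncookies w \<longrightarrow>
        cookie_chain.hitting (\<lambda>x. p x w) (\<lambda>m y. y \<le> 0) (\<lambda>m y. False) m y = 1)"
      using recurrent_potential[OF assms]
    proof eventually_elim
      case (elim w)
      show ?case
      proof (intro impI allI)
        fix m y assume g: "good w" and m: "m \<le> ncookies w"
        interpret cookie_chain "\<lambda>x. p x w" by (rule good_chain) fact
        show "hitting (at_most 0) never m y = 1"
        proof (cases "0 \<le> y")
          case True
          then show ?thesis using elim g m returns_from_right[of "ncookies w"] by blast
        qed (simp add: hitting_target)
      qed
    qed
  qed
  have "AE a in M. \<forall>n. \<exists>j\<ge>n. S j a \<le> 0" "AE a in M. \<forall>n. \<exists>j\<ge>n. 1 \<le> S j a"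
    using low AE_high by (simp_all add: AE_all_countable)
  then show ?thesis using AE_nearest_neighbour
    by eventually_elim (rule visits_zero_infinitely_often, auto)
qed

theorem transient:
  assumes lam: "0 < lam" "lam < 2"
    and tail: "Liminf at_top (\<lambda>t::real. ereal (t powr lam *
        measure PE {w \<in> space PE. log_enat (cookies w 0) > ereal t})) > 0"
  shows "AE a in M. filterlim (\<lambda>n. S n a) at_top sequentially"
proof -
  obtain T where T: "1 < T" "2 < T\<^sup>2" and blocks: "AE w in PE. \<forall>\<^sub>F k in sequentially.
      w \<in> flat (T ^ k / 4) (2 ^ (k + 2)) \<and> (\<exists>x\<in>{2 ^ k..<2 ^ (k + 1)}. big (T ^ k) x w)"
    using big_cookies_in_blocks[OF assms] by blast
  let ?C = "\<lambda>k x. {w \<in> space PE. w \<in> flat (T ^ k / 4) (2 ^ (k + 2)) \<and> big (T ^ k) x w}"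
  let ?bad = "\<lambda>k x. {a \<in> space M. Ev a \<in> ?C k x \<and> backtracks x (2 ^ (k + 2)) a}"
  \<comment> \<open>The site with many cookies depends on the environment. The union over the whole
    block avoids a measurable selection at the cost of a factor \<open>2 ^ k\<close>.\<close>
  define Bad where "Bad k = (\<Union>x\<in>{2 ^ k..<2 ^ (k + 1)}. ?bad k x)" for k :: nat
  have bad: "prob (?bad k x) \<le> 2 ^ (k + 2) * exp (- (T ^ k) / 2)" and bad_sets: "?bad k x \<in> sets M"
    if x: "x \<in> {2 ^ k..<2 ^ (k + 1)}" for k :: nat and x
  proof -
    have Cm: "?C k x \<in> sets PE" by measurable
    have "AE w in PE. good w \<longrightarrow> w \<in> ?C k x \<longrightarrow> (\<forall>j. cookie_chain.hit (\<lambda>x. p x w)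
        (\<lambda>m z. z = x - 1 \<and> m x = 0) (\<lambda>m y. 2 ^ (k + 2) \<le> y) j (ncookies w) 0 \<le> 2 ^ (k + 2) * exp (- (T ^ k) / 2))"
      using backtrack_estimate[OF _ _ x] by (intro AE_I2) blast
    from prob_backtracks[OF Cm _ this] show "prob (?bad k x) \<le> 2 ^ (k + 2) * exp (- (T ^ k) / 2)"
      and "?bad k x \<in> sets M"
    proof -
      assume *: "0 \<le> 2 ^ (k + 2) * exp (- (T ^ k) / 2) \<Longrightarrow> prob (?bad k x) \<le> 2 ^ (k + 2) * exp (- (T ^ k) / 2)"
        "0 \<le> 2 ^ (k + 2) * exp (- (T ^ k) / 2) \<Longrightarrow> {a \<in> space M. backtracks x (2 ^ (k + 2)) a} \<in> sets M"
      then show "prob (?bad k x) \<le> 2 ^ (k + 2) * exp (- (T ^ k) / 2)" by simp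
      have [measurable]: "{a \<in> space M. backtracks x (2 ^ (k + 2)) a} \<in> sets M" using *(2) by simp
      have "?bad k x = {a \<in> space M. Ev a \<in> ?C k x} \<inter> {a \<in> space M. backtracks x (2 ^ (k + 2)) a}" by auto
      also have "\<dots> \<in> sets M" using Cm by measurable
      finally show "?bad k x \<in> sets M" .
    qed
  qed
  have "AE a in M. \<forall>\<^sub>F k in sequentially. a \<in> space M - Bad k"
  proof (rule borel_cantelli_AE1)
    show "Bad k \<in> sets M" for k unfolding Bad_def by (intro sets.finite_UN bad_sets) auto
    show "summable (\<lambda>k. prob (Bad k))"
    proof (rule summable_comparison_test')
      show "summable (\<lambda>k. 4 * 12 ^ 6 * (1 / 2 :: real) ^ k)" by (intro summable_mult summable_geometric) simp
      fix k :: nat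
      let ?t = "T ^ k"
      have t: "0 < ?t" using T by simp
      have card: "card {(2::int) ^ k..<2 ^ (k + 1)} = 2 ^ k" by (simp add: nat_power_eq)
      have "prob (Bad k) \<le> (\<Sum>x\<in>{2 ^ k..<2 ^ (k + 1)}. prob (?bad k x))"
        unfolding Bad_def by (intro finite_measure_subadditive_finite) (use bad_sets in auto)
      also have "\<dots> \<le> (\<Sum>x\<in>{(2::int) ^ k..<2 ^ (k + 1)}. 2 ^ (k + 2) * exp (- ?t / 2))" by (intro sum_mono bad)
      also have "\<dots> = 2 ^ k * (2 ^ (k + 2) * exp (- ?t / 2))" using card by simp
      also have "\<dots> = 4 * 4 ^ k * exp (- ?t / 2)"
        by (simp add: power_add power_mult_distrib[symmetric])
      \<comment> \<open>The sixth power is enough because \<open>2 < T\<^sup>2\<close> gives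
        \<open>T ^ 6 \<ge> 8\<close>, so that \<open>4 ^ k / T ^ (6 * k)\<close> is at most
        \<open>(1 / 2) ^ k\<close>; 12 is twice the exponent.\<close>
      also have "\<dots> \<le> 4 * 4 ^ k * (12 / ?t) ^ 6"
      proof -
        have "?t / 12 \<le> exp (?t / 12)" using exp_ge_add_one_self[of "?t / 12"] by linarith
        then have "(?t / 12) ^ 6 \<le> exp (?t / 12) ^ 6" using t by (intro power_mono) auto
        also have "\<dots> = exp (?t / 2)" by (simp add: exp_of_nat_mult[symmetric])
        finally have "(?t / 12) ^ 6 \<le> exp (?t / 2)" .
        then have "1 / exp (?t / 2) \<le> 1 / (?t / 12) ^ 6" using T by (intro frac_le) auto
        then have "exp (- ?t / 2) \<le> (12 / ?t) ^ 6" by (simp add: exp_minus inverse_eq_divide power_divide)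
        then show ?thesis by simp
      qed
      also have "\<dots> \<le> 4 * 12 ^ 6 * (1 / 2) ^ k"
      proof -
        have "8 ^ k \<le> ?t ^ 6"
        proof -
          have "(2::real) ^ (3 * k) \<le> (T\<^sup>2) ^ (3 * k)" using T by (intro power_mono) auto
          moreover have "(2::real) ^ (3 * k) = 8 ^ k" by (simp add: power_mult)
          moreover have "(T\<^sup>2) ^ (3 * k) = ?t ^ 6" by (simp flip: power_mult add: mult.commute)
          ultimately show ?thesis by simp
        qed
        then have "4 ^ k * 12 ^ 6 / ?t ^ 6 \<le> 4 ^ k * 12 ^ 6 / (8 ^ k :: real)" by (intro divide_left_mono) (use T in auto)
        also have "\<dots> = 12 ^ 6 * (1 / 2) ^ k"
        proof -
          have "(4::real) ^ k / 8 ^ k = (1 / 2) ^ k" by (subst power_divide[symmetric]) simp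
          then have "12 ^ 6 * ((4::real) ^ k / 8 ^ k) = 12 ^ 6 * (1 / 2) ^ k" by (rule arg_cong)
          then show ?thesis by (simp only: times_divide_eq_right mult.commute)
        qed
        finally show ?thesis by (simp add: power_divide)
      qed
      finally show "norm (prob (Bad k)) \<le> 4 * 12 ^ 6 * (1 / 2) ^ k" by simp
    qed
  qed (auto simp: emeasure_eq_measure)
  moreover have "AE a in M. \<forall>\<^sub>F k in sequentially. Ev a \<in> flat (T ^ k / 4) (2 ^ (k + 2)) \<and>
      (\<exists>x\<in>{2 ^ k..<2 ^ (k + 1)}. big (T ^ k) x (Ev a))"
    by (rule AE_transfer[OF blocks])
  moreover have "AE a in M. \<forall>r. \<exists>j\<ge>0. r \<le> S j a" using AE_high[of 0] by (simp add: AE_all_countable)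
  ultimately show ?thesis using AE_start AE_nearest_neighbour AE_left_step AE_space
  proof eventually_elim
    case (elim a)
    from eventually_conj[OF elim(1,2)] obtain k0 where k0: "\<And>k. k0 \<le> k \<Longrightarrow> a \<notin> Bad k \<and>
       Ev a \<in> flat (T ^ k / 4) (2 ^ (k + 2)) \<and> (\<exists>x\<in>{2 ^ k..<2 ^ (k + 1)}. big (T ^ k) x (Ev a))"
      unfolding eventually_sequentially by blast
    define x where "x k = (SOME x. x \<in> {2 ^ k..<2 ^ (k + 1)} \<and> big (T ^ k) x (Ev a))" for k :: nat
    have x: "x k \<in> {2 ^ k..<2 ^ (k + 1)} \<and> big (T ^ k) (x k) (Ev a)" if "k0 \<le> k" for k
      unfolding x_def by (rule someI_ex) (use k0[OF that] in blast)
    show ?case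
    proof (rule escapes_to_infinity[where x = x and ?k0.0 = k0])
      fix k j assume k: "k0 \<le> k" and j: "S j a = x k" "S (Suc j) a = x k - 1"
      have "S (Suc j) a = S j a - 1" using j by simp
      then have "remaining (ncookies (Ev a)) (\<lambda>m. S m a) j (S j a) = 0" using elim(6) by blast
      then have r: "remaining (ncookies (Ev a)) (\<lambda>m. S m a) (Suc j) (x k) = 0"
        using j by (simp add: remaining_Suc)
      have "a \<notin> ?bad k (x k)" using k0[OF k] x[OF k] unfolding Bad_def by blast
      moreover have "Ev a \<in> ?C k (x k)"
        using k0[OF k] x[OF k] measurable_space[OF Ev_measurable elim(7)] by blast
      ultimately have "\<not> backtracks (x k) (2 ^ (k + 2)) a" using elim(7) by blast
      then have "\<not> (\<forall>l<Suc j. S l a < 2 ^ (k + 2))"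
        using j r unfolding backtracks_def by blast
      then show "\<exists>l\<le>j. 2 ^ (k + 2) \<le> S l a" by (auto simp: not_less less_Suc_eq_le)
    qed (use elim x in auto)
  qed
qed

end

text \<open>\<open>1 + n * r \<le> 2 * (max 1 n * max 1 r)\<close> separates the cookies from
  \<open>rho\<close> after taking logarithms. The cap on \<open>q\<close> at 3 keeps it inside the
  range of moments assumed for \<open>ln rho\<close>, and identical distribution moves the result
  from site 0 to site 1.\<close>

lemma cookie_moment:
  assumes A: "assumption_A PE p"
    and rho: "\<And>\<delta>::real. 0 < \<delta> \<Longrightarrow> \<delta> < 6 \<Longrightarrow> integrable PE (\<lambda>w. \<bar>ln (rho p 0 w)\<bar> powr \<delta>)"
    and e: "0 < \<epsilon>" and mom: "integrable PE (\<lambda>w. log_plus_cookies (cookies w 0) powr (2 + \<epsilon>))"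
  shows "\<exists>q>2. integrable PE (\<lambda>w. ln (1 + real (the_enat (cookies w 1)) * rho p 1 w) powr q)"
proof -
  interpret environment PE p by unfold_locales fact
  define q where "q = 2 + min \<epsilon> 1"
  have q: "2 < q" "q \<le> 2 + \<epsilon>" "q < 6" using e by (auto simp: q_def)
  let ?f = "\<lambda>z. ln (1 + real (the_enat (snd z)) * ((1 - fst z) / fst z)) powr q"
  have [measurable]: "(\<lambda>z. real (the_enat (snd z))) \<in> borel_measurable N"
    by (rule measurable_compose[OF measurable_snd]) simp
  have f: "?f \<in> borel_measurable N" by measurable
  have "integrable PE (\<lambda>w. ?f (pairs 0 w))"
  proof (rule Bochner_Integration.integrable_bound)
    let ?g = "\<lambda>w. 3 powr q * (1 + (1 + log_plus_cookies (cookies w 0) powr (2 + \<epsilon>)) + \<bar>ln (rho p 0 w)\<bar> powr q)"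
    show "integrable PE ?g" using mom rho[of q] q by auto
    show "(\<lambda>w. ?f (pairs 0 w)) \<in> borel_measurable PE" by (rule measurable_compose[OF pair_measurable f])
    show "AE w in PE. norm (?f (pairs 0 w)) \<le> norm (?g w)"
      using AE_good
    proof eventually_elim
      case (elim w)
      let ?n = "ncookies w 0" and ?r = "rho p 0 w"
      have r: "0 < ?r" using elim by (simp add: good_def rho_def)
      define a where "a = log_plus_cookies (cookies w 0)"
      define b where "b = \<bar>ln ?r\<bar>"
      have a: "a = ln (max 1 (real ?n))"
        using elim by (auto simp: a_def good_def log_plus_cookies_def max_def)
      have a0: "0 \<le> a" "0 \<le> b" by (auto simp: a b_def)
      have "1 + real ?n * ?r \<le> 2 * (max 1 (real ?n) * max 1 ?r)"
      proof -
        have "1 * 1 \<le> max 1 (real ?n) * max 1 ?r" by (intro mult_mono) auto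
        moreover have "real ?n * ?r \<le> max 1 (real ?n) * max 1 ?r" using r by (intro mult_mono) auto
        ultimately show ?thesis by linarith
      qed
      then have "ln (1 + real ?n * ?r) \<le> ln (2 * (max 1 (real ?n) * max 1 ?r))"
        using r by (subst ln_le_cancel_iff) (auto intro!: add_pos_nonneg mult_pos_pos)
      also have "\<dots> = ln 2 + (a + ln (max 1 ?r))"
        by (subst ln_mult; (subst ln_mult)?) (auto simp: a)
      also have "\<dots> \<le> 1 + (a + b)"
      proof -
        have "ln (max 1 ?r) \<le> b" unfolding b_def by (cases "1 \<le> ?r") (auto simp: max_def)
        then show ?thesis using ln_2_less_1 by linarith
      qed
      finally have le: "ln (1 + real ?n * ?r) \<le> 1 + (a + b)" .
      also have "\<dots> \<le> 3 * max 1 (max a b)" by auto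
      finally have le3: "ln (1 + real ?n * ?r) \<le> 3 * max 1 (max a b)" .
      have l0: "0 \<le> ln (1 + real ?n * ?r)" using r by simp
      have "ln (1 + real ?n * ?r) powr q \<le> (3 * max 1 (max a b)) powr q"
        using le3 l0 q by (intro powr_mono2) auto
      also have "\<dots> = 3 powr q * max 1 (max a b) powr q" by (rule powr_mult) 
      also have "max 1 (max a b) powr q \<le> 1 + a powr q + b powr q"
      proof -
        have "max 1 (max a b) = 1 \<or> max 1 (max a b) = a \<or> max 1 (max a b) = b" by (auto simp: max_def)
        moreover have "0 \<le> a powr q" "0 \<le> b powr q" by auto
        ultimately show ?thesis by (elim disjE) simp_all
      qed
      also have "a powr q \<le> 1 + a powr (2 + \<epsilon>)"
      proof (cases "a \<le> 1")
        case True
        then have "a powr q \<le> 1 powr q" using a0 q by (intro powr_mono2) auto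
        then show ?thesis by (simp add: add_increasing2)
      next
        case False
        then have "a powr q \<le> a powr (2 + \<epsilon>)" using q by (intro powr_mono) auto
        then show ?thesis by simp
      qed
      finally have "ln (1 + real ?n * ?r) powr q \<le> 3 powr q * (1 + (1 + a powr (2 + \<epsilon>)) + b powr q)"
        by (simp add: mult_left_mono)
      moreover have "0 \<le> 3 powr q * (1 + (1 + a powr (2 + \<epsilon>)) + b powr q)" by simp
      ultimately show ?case by (simp add: ncookies_def rho_def a_def b_def)
    qed
  qed
  then have "integrable PE (\<lambda>w. ?f (pairs 1 w))" by (subst pairs_integral_ident(2)[OF f])
  then show ?thesis using q by (intro exI[of _ q]) (simp add: rho_def)
qed

lemma square_integrable_environmentI:
  assumes A: "assumption_A PE p" and sq: "integrable PE (\<lambda>w. \<bar>ln (rho p 0 w)\<bar> powr 2)"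
  shows "square_integrable_environment PE p"
proof -
  interpret environment PE p by unfold_locales fact
  show ?thesis
  proof
    fix x
    let ?f = "\<lambda>z. (- ln ((1 - fst z) / fst z))\<^sup>2 :: real"
    have f: "?f \<in> borel_measurable N" by measurable
    have "\<bar>y\<bar> powr 2 = y\<^sup>2" for y :: real by (cases "y = 0") (auto simp: powr_numeral)
    then have "integrable PE (\<lambda>w. ?f (pairs 0 w))" using sq by (simp add: rho_def)
    then show "integrable PE (\<lambda>w. (X x w)\<^sup>2)"
      unfolding X_eq by (subst pairs_integral_ident(2)[OF f])
  qed
qed

theorem theorem1p1:
  fixes PE :: "env measure" and p :: "int \<Rightarrow> env \<Rightarrow> real"
  assumes "assumption_A PE p"
    and "\<forall>\<delta>::real. 0 < \<delta> \<and> \<delta> < 6 \<longrightarrow> integrable PE (\<lambda>\<omega>. \<bar>ln (rho p 0 \<omega>)\<bar> powr \<delta>)"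
  shows "((\<exists>\<epsilon>>0. integrable PE (\<lambda>\<omega>. log_plus_cookies (cookies \<omega> 0) powr (2 + \<epsilon>))) \<longrightarrow>
           (\<forall>(M :: 'a measure) Ev S. ERWRE_realization PE 0 M Ev S \<longrightarrow>
              (AE a in M. infinite {n. S n a = 0})))
       \<and> ((\<exists>lam::real. 0 < lam \<and> lam < 2 \<and>
             Liminf at_top (\<lambda>t::real. ereal (t powr lam *
                measure PE {\<omega> \<in> space PE. log_enat (cookies \<omega> 0) > ereal t})) > 0) \<longrightarrow>
           (\<forall>(M :: 'a measure) Ev S. ERWRE_realization PE 0 M Ev S \<longrightarrow>
              (AE a in M. filterlim (\<lambda>n. S n a) at_top sequentially)))"
proof -
  have env: "square_integrable_environment PE p"
    by (rule square_integrable_environmentI[OF assms(1)]) (rule assms(2)[rule_format], simp)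
  have real: "square_integrable_realization PE p M Ev S" if "ERWRE_realization PE 0 M Ev S"
    for M :: "'a measure" and Ev S
  proof -
    interpret square_integrable_environment PE p by (rule env)
    show ?thesis by unfold_locales (rule that)
  qed
  show ?thesis
  proof (intro conjI impI allI; elim exE conjE)
    fix \<epsilon> :: real and M :: "'a measure" and Ev S
    assume M: "ERWRE_realization PE 0 M Ev S" and e: "0 < \<epsilon>"
      and mom: "integrable PE (\<lambda>w. log_plus_cookies (cookies w 0) powr (2 + \<epsilon>))"
    interpret square_integrable_realization PE p M Ev S by (rule real[OF M])
    obtain q where "2 < q" "integrable PE (\<lambda>w. ln (1 + real (the_enat (cookies w 1)) * rho p 1 w) powr q)"
      using cookie_moment[OF assms(1) _ e mom] assms(2) by blast
    then show "AE a in M. infinite {n. S n a = 0}" by (intro recurrent[of q]) (auto simp: ncookies_def)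
  next
    fix lam :: real and M :: "'a measure" and Ev S
    assume M: "ERWRE_realization PE 0 M Ev S" and lam: "0 < lam" "lam < 2"
      and tail: "Liminf at_top (\<lambda>t::real. ereal (t powr lam *
                measure PE {w \<in> space PE. log_enat (cookies w 0) > ereal t})) > 0"
    interpret square_integrable_realization PE p M Ev S by (rule real[OF M])
    show "AE a in M. filterlim (\<lambda>n. S n a) at_top sequentially" by (rule transient[OF lam tail])
  qed
qed

end
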